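(* Let $G$ be of type $D_{\ell+1}$ over $\mathbb{C}$ and $\sigma$ a diagram automorphism of order $2$ (type $(D_{\ell+1},2)$). For $j=0,1,\dots,\ell$, $$\pi(\mathcal{M}_{(1^j0^{\ell-j})})=\begin{cases}\mathcal{N}_{\mathfrak p}\setminus\{0\}&\text{if } j \text{ is odd};\\ \{0\}&\text{if } j=0;\\ \mathcal{N}_{\mathfrak p}&\text{if } j\text{ is even and } j\ge2.\end{cases}$$ Moreover, $\mathcal{M}_{(1\,0^{\ell-1})}=\{(1+xt^{-1}+\tfrac12x^2t^{-2})\cdot e_0\mid x\in\mathcal{N}_{\mathfrak p}\setminus\{0\}\}$. Consequently, $\pi$ maps $\mathcal{M}_{(1\,0^{\ell-1})}$ isomorphically onto $\mathcal{N}_{\mathfrak p}\setminus\{0\}$.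
   Context: Let $\widetilde G=\mathrm{Spin}_{2\ell+2}$ with pinning-preserving diagram automorphism $\sigma$ of order $2$, maximal torus $T$, simple coroots $\check\alpha_1,\dots,\check\alpha_{\ell+1}$ ($\sigma$ swaps $\check\alpha_\ell,\check\alpha_{\ell+1}$). $\mathcal{O}=\mathbb{C}[[t]]$, $\mathcal{K}=\mathbb{C}((t))$, $\mathcal{O}^-=\mathbb{C}[t^{-1}]$, with $\sigma(t)=-t$, $\sigma|_{\mathbb C}=\mathrm{Id}$; $\sigma$ acts on $\widetilde G(\mathcal{K})$ etc. through both $\widetilde G$ and $t$. $\mathcal{G}r=\widetilde G(\mathcal{K})^\sigma/\widetilde G(\mathcal{O})^\sigma$ with base point $e_0$. $X_*(T)_\sigma=X_*(T)/(\mathrm{Id}-\sigma)X_*(T)$ is identified with $\mathbb{Z}^\ell$ so that the image of $\check\alpha_i$ is $e_i-e_{i+1}$ for $i<\ell$ and the images of $\check\alpha_\ell$ and $\check\alpha_{\ell+1}$ are $e_\ell$. For $\lambda\in X_*(T)$ with class $\bar\lambda=(a_1\ge\dots\ge a_\ell\ge0)$, $n^\lambda=t^\lambda\sigma(t^\lambda)$ and $\mathcal{G}r_{\bar\lambda}=\widetilde G(\mathcal{O})^\sigma n^\lambda\cdot e_0$. $\mathcal{G}r_0^-=\widetilde G(\mathcal{O}^-)^\sigma\cdot e_0\simeq\widetilde G(\mathcal{O}^-)_0^\sigma$ where the subscript $0$ denotes the kernel of evaluation at $t=\infty$, and $\mathcal{M}_{\bar\lambda}=\mathcal{G}r_{\bar\lambda}\cap\mathcal{G}r_0^-$.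 $(1^j0^{\ell-j})$ is the tuple of $j$ ones followed by zeros. Working with $G=\mathrm{SO}_{2\ell+2}$ instead of $\mathrm{Spin}_{2\ell+2}$: $\mathcal{G}r_0^-$ is identified with $G(\mathcal{O}^-)_0^\sigma$ (via $g\mapsto g\cdot e_0$), so its points are written as matrices $1+xt^{-1}+yt^{-2}+\cdots$. $\mathfrak p$ is the $(-1)$-eigenspace of $\sigma$ on $\mathfrak{so}_{2\ell+2}$ and $\mathcal{N}_{\mathfrak p}$ its set of nilpotent elements (concretely, one may realize $\mathfrak{so}_{2\ell+2}$ as skew-symmetric matrices with $\sigma(x)=w_0xw_0$, $w_0=\mathrm{diag}(-1,1,\dots,1)$, and $G$ as matrices with $g^Tg=I$, $\det g=1$). $\pi:\mathcal{G}r_0^-\to\mathfrak p$ sends $(1+xt^{-1}+\cdots)\cdot e_0$ to $x$. Spaces are regarded as varieties (reduced). *)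

theory Defs
  imports
    "HOL-Computational_Algebra.Formal_Laurent_Series"
    "Jordan_Normal_Form.Determinant"
begin

section \<open>Cocharacters\<close>

text \<open>
  A function \<open>\<lambda> :: nat \<Rightarrow> int\<close> supported on \<open>{1..l+1}\<close> stands for the cocharacter
  \<open>\<Sum>k. \<lambda> k * \<epsilon>\<^sub>k\<close> of the standard maximal torus of \<open>SO\<^bsub>2l+2\<^esub>\<close>. Since the spin group is simply
  connected, its cocharacter lattice is the span of the simple coroots.
\<close>

definition coroot :: "nat \<Rightarrow> nat \<Rightarrow> nat \<Rightarrow> int" where
  "coroot l i = (\<lambda>k. if i \<le> l
     then (if k = i then 1 else 0) - (if k = i + 1 then 1 else 0)
     else (if k = l then 1 else 0) + (if k = l + 1 then 1 else 0))"

definition spin_cochars :: "nat \<Rightarrow> (nat \<Rightarrow> int) set" where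
  "spin_cochars l = {\<lambda>k. \<Sum>i=1..l+1. c i * coroot l i k | c. True}"

definition sigma_cochar :: "nat \<Rightarrow> (nat \<Rightarrow> int) \<Rightarrow> nat \<Rightarrow> int" where
  "sigma_cochar l lam = (\<lambda>k. if k = l + 1 then - lam k else lam k)"

text \<open>
  The class of a cocharacter in the coinvariants, identified with \<open>\<int>\<^sup>l\<close> (functions supported
  on \<open>{1..l}\<close>); the lemmas below show that this is the identification determined by the images of the coroots.
\<close>

definition coinv_class :: "nat \<Rightarrow> (nat \<Rightarrow> int) \<Rightarrow> nat \<Rightarrow> int" where
  "coinv_class l lam = (\<lambda>k. if 1 \<le> k \<and> k \<le> l then lam k else 0)"

lemma sigma_coroot:
  assumes "1 \<le> i" "i < l"
  shows "sigma_cochar l (coroot l i) = coroot l i"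
    and "sigma_cochar l (coroot l l) = coroot l (l + 1)"
    and "sigma_cochar l (coroot l (l + 1)) = coroot l l"
  using assms by (auto simp: sigma_cochar_def coroot_def fun_eq_iff)

lemma coinv_class_coroot:
  "1 \<le> i \<Longrightarrow> i < l \<Longrightarrow>
     coinv_class l (coroot l i) = (\<lambda>k. (if k = i then 1 else 0) - (if k = i + 1 then 1 else 0))"
  "1 \<le> l \<Longrightarrow> coinv_class l (coroot l l) = (\<lambda>k. if k = l then 1 else 0)"
  "1 \<le> l \<Longrightarrow> coinv_class l (coroot l (l + 1)) = (\<lambda>k. if k = l then 1 else 0)"
  by (auto simp: coinv_class_def coroot_def fun_eq_iff)

lemma coroot_sum:
  assumes "1 \<le> l"
  shows "(\<Sum>i=1..l+1. c i * coroot l i k) = (if 1 \<le> k \<and> k \<le> l then c k else 0)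
     - (if 2 \<le> k \<and> k \<le> l + 1 then c (k - 1) else 0) + (if k = l \<or> k = l + 1 then c (l + 1) else 0)"
proof -
  have 1: "(\<Sum>i=1..l. c i * (if k = i then 1 else 0)) = (if 1 \<le> k \<and> k \<le> l then c k else 0)"
    using sum.delta[of "{1..l}" k c] by (simp add: if_distrib eq_commute[of k] cong: if_cong)
  have "(\<Sum>i=1..l. c i * (if k = i + 1 then 1 else 0)) =
      (\<Sum>i=1..l. if k - 1 = i then c i else 0)"
    by (intro sum.cong) auto
  also have "\<dots> = (if 2 \<le> k \<and> k \<le> l + 1 then c (k - 1) else 0)"
    using sum.delta'[of "{1..l}" "k - 1" c] by auto
  finally have 2: "(\<Sum>i=1..l. c i * (if k = i + 1 then 1 else 0)) =
      (if 2 \<le> k \<and> k \<le> l + 1 then c (k - 1) else 0)" .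
  have "(\<Sum>i=1..l. c i * coroot l i k) =
      (\<Sum>i=1..l. c i * (if k = i then 1 else 0) - c i * (if k = i + 1 then 1 else 0))"
    by (intro sum.cong) (auto simp: coroot_def)
  then have "(\<Sum>i=1..l. c i * coroot l i k) = (if 1 \<le> k \<and> k \<le> l then c k else 0)
     - (if 2 \<le> k \<and> k \<le> l + 1 then c (k - 1) else 0)"
    by (simp only: sum_subtractf 1 2)
  moreover have "c (l + 1) * coroot l (l + 1) k = (if k = l \<or> k = l + 1 then c (l + 1) else 0)"
    using assms by (auto simp: coroot_def)
  ultimately show ?thesis using assms by simp
qed

lemma spin_cochars_iff:
  assumes "1 \<le> l"
  shows "lam \<in> spin_cochars l \<longleftrightarrow>
    (\<forall>k. k \<notin> {1..l+1} \<longrightarrow> lam k = 0) \<and> even (\<Sum>k=1..l+1. lam k)"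
proof
  assume "lam \<in> spin_cochars l"
  then obtain c where lam: "lam = (\<lambda>k. \<Sum>i=1..l+1. c i * coroot l i k)"
    by (auto simp: spin_cochars_def)
  have ev: "even (\<Sum>k=1..l+1. coroot l i k)" if "i \<in> {1..l+1}" for i
  proof (cases "i \<le> l")
    case True
    have "(\<Sum>k=1..l+1. coroot l i k) =
        (\<Sum>k=1..l+1. if k = i then 1 else 0) - (\<Sum>k=1..l+1. if k = i + 1 then 1 else 0)"
      using True by (simp only: coroot_def if_True sum_subtractf)
    then show ?thesis using True that by (simp del: sum.cl_ivl_Suc)
  next
    case False
    have "(\<Sum>k=1..l+1. coroot l i k) =
        (\<Sum>k=1..l+1. if k = l then 1 else 0) + (\<Sum>k=1..l+1. if k = l + 1 then 1 else 0)"
      using False by (simp only: coroot_def if_False sum.distrib)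
    then show ?thesis using assms by (simp del: sum.cl_ivl_Suc)
  qed
  have "(\<Sum>k=1..l+1. lam k) = (\<Sum>i=1..l+1. c i * (\<Sum>k=1..l+1. coroot l i k))"
    unfolding lam by (subst sum.swap) (simp only: sum_distrib_left)
  also have "even \<dots>"
    by (intro dvd_sum) (rule dvd_mult[OF ev])
  finally show "(\<forall>k. k \<notin> {1..l+1} \<longrightarrow> lam k = 0) \<and> even (\<Sum>k=1..l+1. lam k)"
    unfolding lam coroot_sum[OF assms] using assms by auto
next
  assume R: "(\<forall>k. k \<notin> {1..l+1} \<longrightarrow> lam k = 0) \<and> even (\<Sum>k=1..l+1. lam k)"
  define S where "S k = (\<Sum>i=1..k. lam i)" for k
  have S_Suc: "S (Suc k) = S k + lam (Suc k)" for k by (simp add: S_def)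
  have S0: "S 0 = 0" by (simp add: S_def)
  have "even (S l + lam (l + 1))" using R by (simp add: S_def)
  then obtain h where h: "S l + lam (l + 1) = 2 * h" by (elim evenE)
  define c where "c i = (if i < l then S i else if i = l then S l - h else h)" for i
  have *: "h - lam (Suc l) = S l - h" using h by simp
  have "lam k = (\<Sum>i=1..l+1. c i * coroot l i k)" for k
  proof (cases "k \<in> {1..l+1}")
    case True
    then obtain m where m: "k = Suc m" "m \<le> l" by (cases k) auto
    show ?thesis
      unfolding coroot_sum[OF assms] using m S_Suc[of m] S0 h assms
      by (cases "m = 0") (auto simp: c_def)
  next
    case False
    then show ?thesis unfolding coroot_sum[OF assms] using R assms by auto
  qed
  then show "lam \<in> spin_cochars l" by (auto simp: spin_cochars_def)
qed

lemma coinv_class_eq_iff: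
  assumes "1 \<le> l" "lam \<in> spin_cochars l" "mu \<in> spin_cochars l"
  shows "coinv_class l lam = coinv_class l mu \<longleftrightarrow>
    (\<exists>nu\<in>spin_cochars l. \<forall>k. lam k - mu k = nu k - sigma_cochar l nu k)"
proof
  assume eq: "coinv_class l lam = coinv_class l mu"
  have agree: "lam k = mu k" if "k \<noteq> l + 1" for k
    using fun_cong[OF eq, of k] assms that unfolding spin_cochars_iff[OF assms(1)]
    by (cases "k \<in> {1..l}") (auto simp: coinv_class_def)
  then have "(\<Sum>k=1..l. lam k) = (\<Sum>k=1..l. mu k)" by (intro sum.cong) auto
  then have "even (lam (l + 1) - mu (l + 1))"
    using assms unfolding spin_cochars_iff[OF assms(1)] by auto
  then obtain d where d: "lam (l + 1) - mu (l + 1) = 2 * d" by (elim evenE)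
  define nu where "nu k = (if k = l + 1 then d else if k = l then d else 0)" for k
  have "(\<Sum>k=1..l+1. nu k) = (\<Sum>k=1..l. if k = l then d else 0) + d"
    by (auto simp: nu_def intro!: sum.cong)
  then have "even (\<Sum>k=1..l+1. nu k)" using assms(1) by (simp del: sum.cl_ivl_Suc)
  then have "nu \<in> spin_cochars l"
    unfolding spin_cochars_iff[OF assms(1)] using assms(1) by (auto simp: nu_def)
  moreover have "\<forall>k. lam k - mu k = nu k - sigma_cochar l nu k"
    using agree d by (auto simp: nu_def sigma_cochar_def)
  ultimately show "\<exists>nu\<in>spin_cochars l. \<forall>k. lam k - mu k = nu k - sigma_cochar l nu k"
    by blast
next
  assume "\<exists>nu\<in>spin_cochars l. \<forall>k. lam k - mu k = nu k - sigma_cochar l nu k"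
  then obtain nu where nu: "\<And>k. lam k - mu k = nu k - sigma_cochar l nu k" by blast
  have "lam k = mu k" if "k \<le> l" for k
    using nu[of k] that by (auto simp: sigma_cochar_def)
  then show "coinv_class l lam = coinv_class l mu"
    by (auto simp: coinv_class_def)
qed

lemma coinv_class_surj:
  assumes "1 \<le> l" "\<And>k. k \<notin> {1..l} \<Longrightarrow> a k = 0"
  shows "\<exists>lam\<in>spin_cochars l. coinv_class l lam = a"
proof
  define lam where "lam k = (if k = l + 1 then (\<Sum>i=1..l. a i) else a k)" for k
  have "(\<Sum>k=1..l. lam k) = (\<Sum>i=1..l. a i)" by (intro sum.cong) (auto simp: lam_def)
  then have "even (\<Sum>k=1..l+1. lam k)" by (simp add: lam_def)
  then show "lam \<in> spin_cochars l"
    unfolding spin_cochars_iff[OF assms(1)] using assms(2) by (auto simp: lam_def)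
  show "coinv_class l lam = a"
    using assms(2) by (auto simp: lam_def coinv_class_def fun_eq_iff)
qed

definition ones :: "nat \<Rightarrow> nat \<Rightarrow> int" where
  "ones j = (\<lambda>k. if 1 \<le> k \<and> k \<le> j then 1 else 0)"


section \<open>The twisted loop groups of \<open>SO\<^bsub>2l+2\<^esub>\<close>\<close>

text \<open>
  The Grassmannian of the spin group is described through \<open>SO\<^bsub>2l+2\<^esub>\<close>. The twisted group \<open>GO l\<close> below
  is the image of its spin analogue times \<open>{1, -1}\<close>, and \<open>-1\<close> is not in the image of the twisted
  loop group of the spin group, so the spin Grassmannian embeds, orbit by orbit, in the quotient
  \<open>GK l / GO l\<close>. Rows and columns are numbered \<open>0, \<dots>, 2l+1\<close>.
\<close>

definition w0 :: "nat \<Rightarrow> 'a::comm_ring_1 mat" where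
  "w0 l = mat (2*l+2) (2*l+2) (\<lambda>(p, q). if p \<noteq> q then 0 else if p = 0 then - 1 else 1)"

definition neg_t :: "complex fls \<Rightarrow> complex fls" where
  "neg_t f = fls_compose_fps f (- fps_X)"

definition sigma :: "nat \<Rightarrow> complex fls mat \<Rightarrow> complex fls mat" where
  "sigma l g = w0 l * map_mat neg_t g * w0 l"

definition GK :: "nat \<Rightarrow> complex fls mat set" where
  "GK l = {g \<in> carrier_mat (2*l+2) (2*l+2).
     transpose_mat g * g = 1\<^sub>m (2*l+2) \<and> det g = 1 \<and> sigma l g = g}"

definition GO :: "nat \<Rightarrow> complex fls mat set" where
  "GO l = {g \<in> GK l. \<forall>p<2*l+2. \<forall>q<2*l+2. \<forall>k<0. fls_nth (g $$ (p, q)) k = 0}"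

text \<open>A Laurent series without positive powers of \<open>t\<close> is a polynomial in \<open>t\<^sup>-\<^sup>1\<close>.\<close>

definition GOminus :: "nat \<Rightarrow> complex fls mat set" where
  "GOminus l = {g \<in> GK l. \<forall>p<2*l+2. \<forall>q<2*l+2. \<forall>k>0. fls_nth (g $$ (p, q)) k = 0}"

definition coeff_mat :: "int \<Rightarrow> complex fls mat \<Rightarrow> complex mat" where
  "coeff_mat k g = map_mat (\<lambda>f. fls_nth f k) g"

text \<open>The value at \<open>t = \<infinity>\<close> of a polynomial in \<open>t\<^sup>-\<^sup>1\<close> is its constant coefficient.\<close>

definition GOminus0 :: "nat \<Rightarrow> complex fls mat set" where
  "GOminus0 l = {g \<in> GOminus l. coeff_mat 0 g = 1\<^sub>m (2*l+2)}"

text \<open>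
  The maximal torus is the product of the groups \<open>SO\<^sub>2\<close> on the coordinate planes \<open>{2b, 2b+1}\<close>.
  Plane \<open>0\<close>, on which \<open>w0\<close> is \<open>diag(-1,1)\<close>, carries \<open>\<epsilon>\<^bsub>l+1\<^esub>\<close>, so that \<open>\<sigma>\<close> negates \<open>\<epsilon>\<^bsub>l+1\<^esub>\<close> and fixes
  the other \<open>\<epsilon>\<^sub>b\<close>; plane \<open>b\<close> carries \<open>\<epsilon>\<^sub>b\<close> for \<open>1 \<le> b \<le> l\<close>. The point \<open>s\<close> of the multiplicative group
  acts on a plane by the rotation with cosine \<open>(s + s\<^sup>-\<^sup>1)/2\<close> and sine \<open>(s - s\<^sup>-\<^sup>1)/(2\<i>)\<close>.
\<close>

definition t_pow :: "nat \<Rightarrow> (nat \<Rightarrow> int) \<Rightarrow> complex fls mat" where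
  "t_pow l lam = mat (2*l+2) (2*l+2) (\<lambda>(p, q).
     let m = lam (if p div 2 = 0 then l + 1 else p div 2);
         c = fls_const (1/2) * (fls_X_intpow m + fls_X_intpow (-m));
         s = fls_const (1/(2*\<i>)) * (fls_X_intpow m - fls_X_intpow (-m))
     in if p div 2 \<noteq> q div 2 then 0 else if p = q then c else if p < q then s else - s)"

definition n_pow :: "nat \<Rightarrow> (nat \<Rightarrow> int) \<Rightarrow> complex fls mat" where
  "n_pow l lam = t_pow l lam * sigma l (t_pow l lam)"


section \<open>The affine Grassmannian\<close>

text \<open>Points of the Grassmannian are left cosets of \<open>GO l\<close> in \<open>GK l\<close>.\<close>

definition act :: "complex fls mat \<Rightarrow> complex fls mat set \<Rightarrow> complex fls mat set" where
  "act g X = (\<lambda>h. g * h) ` X"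

definition e0 :: "nat \<Rightarrow> complex fls mat set" where
  "e0 l = GO l"

definition Gr :: "nat \<Rightarrow> complex fls mat set set" where
  "Gr l = {act g (e0 l) | g. g \<in> GK l}"

definition Gr_orbit :: "nat \<Rightarrow> (nat \<Rightarrow> int) \<Rightarrow> complex fls mat set set" where
  "Gr_orbit l lam = {act k (act (n_pow l lam) (e0 l)) | k. k \<in> GO l}"

definition Gr0_minus :: "nat \<Rightarrow> complex fls mat set set" where
  "Gr0_minus l = {act g (e0 l) | g. g \<in> GOminus l}"

definition M :: "nat \<Rightarrow> (nat \<Rightarrow> int) \<Rightarrow> complex fls mat set set" where
  "M l lam = Gr_orbit l lam \<inter> Gr0_minus l"

text \<open>The inverse of the bijection \<open>g \<mapsto> g \<cdot> e\<^sub>0\<close> from \<open>GOminus0 l\<close> onto \<open>Gr0_minus l\<close>; see \<open>rep_act\<close>.\<close>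

definition rep :: "nat \<Rightarrow> complex fls mat set \<Rightarrow> complex fls mat" where
  "rep l X = (THE g. g \<in> GOminus0 l \<and> act g (e0 l) = X)"

lemma GO_one: "1\<^sub>m (2*l+2) \<in> GO l"
proof -
  have "w0 l * (w0 l :: complex fls mat) = 1\<^sub>m (2*l+2)"
  proof (rule eq_matI)
    fix p q assume pq: "p < dim_row (1\<^sub>m (2*l+2))" "q < dim_col (1\<^sub>m (2*l+2))"
    have "(w0 l * w0 l :: complex fls mat) $$ (p, q) =
        (\<Sum>i=0..<2*l+2. w0 l $$ (p, i) * w0 l $$ (i, q))"
      using pq by (simp add: w0_def scalar_prod_def del: sum.op_ivl_Suc)
    also have "\<dots> = (\<Sum>i=0..<2*l+2. if i = p then (if p = q then 1 else 0) else 0)"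
      using pq by (intro sum.cong) (auto simp: w0_def)
    finally have "(w0 l * w0 l :: complex fls mat) $$ (p, q) =
        (\<Sum>i=0..<2*l+2. if i = p then (if p = q then 1 else 0) else 0)" .
    then show "(w0 l * w0 l :: complex fls mat) $$ (p, q) = 1\<^sub>m (2*l+2) $$ (p, q)"
      using pq by (simp del: sum.op_ivl_Suc)
  qed (auto simp: w0_def)
  moreover have "map_mat neg_t (1\<^sub>m (2*l+2)) = 1\<^sub>m (2*l+2)"
    by (rule eq_matI) (auto simp: neg_t_def)
  moreover have "(w0 l :: complex fls mat) \<in> carrier_mat (2*l+2) (2*l+2)" by (simp add: w0_def)
  ultimately have "sigma l (1\<^sub>m (2*l+2)) = 1\<^sub>m (2*l+2)"
    by (simp add: sigma_def)
  then show ?thesis by (auto simp: GO_def GK_def)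
qed

lemma rep_act:
  assumes "g \<in> GOminus0 l"
  shows "rep l (act g (e0 l)) = g"
  unfolding rep_def
proof (rule the_equality)
  show "g \<in> GOminus0 l \<and> act g (e0 l) = act g (e0 l)" using assms by simp
next
  let ?n = "2*l+2"
  fix g' assume g': "g' \<in> GOminus0 l \<and> act g' (e0 l) = act g (e0 l)"
  have "g' * 1\<^sub>m ?n \<in> act g' (e0 l)" using GO_one by (auto simp: act_def e0_def)
  moreover have G: "g \<in> carrier_mat ?n ?n" "g' \<in> carrier_mat ?n ?n" "transpose_mat g * g = 1\<^sub>m ?n"
    using assms g' by (auto simp: GOminus0_def GOminus_def GK_def)
  ultimately obtain h where h: "h \<in> GO l" "g' = g * h"
    using g' by (auto simp: act_def e0_def)
  have H: "h \<in> carrier_mat ?n ?n" using h by (auto simp: GO_def GK_def)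
  have prod: "fls_nth (a * b) k = (if k = 0 then fls_nth a 0 * fls_nth b 0 else 0)"
    if "0 \<le> k" "\<And>i. 0 < i \<Longrightarrow> fls_nth a i = 0" "\<And>i. 0 < i \<Longrightarrow> fls_nth b i = 0"
    for a b :: "complex fls" and k
  proof -
    have "fls_nth (a * b) k = (\<Sum>i=fls_subdegree a..k - fls_subdegree b.
        if i = 0 then (if k = 0 then fls_nth a 0 * fls_nth b 0 else 0) else 0)"
      unfolding fls_times_nth(2)
    proof (intro sum.cong refl)
      fix i
      show "fls_nth a i * fls_nth b (k - i) =
          (if i = 0 then (if k = 0 then fls_nth a 0 * fls_nth b 0 else 0) else 0)"
      proof (cases "i > 0 \<or> k - i > 0")
        case True
        then show ?thesis using that(1) that(2)[of i] that(3)[of "k - i"] by auto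
      next
        case False
        then have "i = 0" "k = 0" using that(1) by auto
        then show ?thesis by simp
      qed
    qed
    also have "\<dots> = (if 0 \<in> {fls_subdegree a..k - fls_subdegree b}
        then (if k = 0 then fls_nth a 0 * fls_nth b 0 else 0) else 0)"
      by (simp add: sum.delta)
    also have "\<dots> = (if k = 0 then fls_nth a 0 * fls_nth b 0 else 0)"
      by (auto simp: not_le)
    finally show ?thesis .
  qed
  have c0: "fls_nth (f $$ (i, p)) 0 = (if i = p then 1 else 0)"
    if "f \<in> GOminus0 l" "i < ?n" "p < ?n" for f i p
  proof -
    have "f \<in> carrier_mat ?n ?n" using that(1) by (auto simp: GOminus0_def GOminus_def GK_def)
    then have "coeff_mat 0 f $$ (i, p) = fls_nth (f $$ (i, p)) 0"
      using that by (simp add: coeff_mat_def)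
    then show ?thesis using that by (auto simp: GOminus0_def)
  qed
  have pos: "fls_nth (f $$ (i, p)) k = 0" if "f \<in> GOminus0 l" "i < ?n" "p < ?n" "0 < k" for f i p k
    using that by (auto simp: GOminus0_def GOminus_def)
  have hg: "h = transpose_mat g * g'"
    using G H h(2) assoc_mult_mat[of "transpose_mat g" ?n ?n g ?n h ?n] by simp
  also have "transpose_mat g * g' = 1\<^sub>m ?n"
  proof (rule eq_matI)
    fix p q assume "p < dim_row (1\<^sub>m ?n :: complex fls mat)" "q < dim_col (1\<^sub>m ?n :: complex fls mat)"
    then have pq: "p < ?n" "q < ?n" by auto
    have e: "(transpose_mat g * g') $$ (p, q) = (\<Sum>i=0..<?n. g $$ (i, p) * g' $$ (i, q))"
      using pq G by (simp add: scalar_prod_def del: sum.op_ivl_Suc)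
    have nth: "fls_nth ((transpose_mat g * g') $$ (p, q)) k = (if k = 0 \<and> p = q then 1 else 0)" for k
    proof (cases "k < 0")
      case True
      have "fls_nth (h $$ (p, q)) k = 0" using h(1) pq True by (simp add: GO_def)
      then show ?thesis using True unfolding hg by simp
    next
      case False
      have "fls_nth ((transpose_mat g * g') $$ (p, q)) k =
          (\<Sum>i=0..<?n. fls_nth (g $$ (i, p) * g' $$ (i, q)) k)"
        unfolding e by (simp add: fls_nth_sum del: sum.op_ivl_Suc)
      also have "\<dots> = (\<Sum>i=0..<?n. if i = p then (if k = 0 \<and> p = q then 1 else 0) else 0)"
      proof (rule sum.cong[OF refl])
        fix i assume "i \<in> {0..<?n}"
        then show "fls_nth (g $$ (i, p) * g' $$ (i, q)) k =
            (if i = p then (if k = 0 \<and> p = q then 1 else 0) else 0)"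
          using False pq assms g' by (simp add: prod pos c0)
      qed
      also have "\<dots> = (if k = 0 \<and> p = q then 1 else 0)"
        using pq by (simp del: sum.op_ivl_Suc)
      finally show ?thesis .
    qed
    show "(transpose_mat g * g') $$ (p, q) = 1\<^sub>m ?n $$ (p, q)"
      using pq by (intro fls_eqI) (auto simp: nth)
  qed (use G in auto)
  finally show "g' = g" using h(2) G by simp
qed

definition proj :: "nat \<Rightarrow> complex fls mat set \<Rightarrow> complex mat" where
  "proj l X = coeff_mat (-1) (rep l X)"

definition so_alg :: "nat \<Rightarrow> complex mat set" where
  "so_alg l = {x \<in> carrier_mat (2*l+2) (2*l+2). transpose_mat x = - x}"

definition p_space :: "nat \<Rightarrow> complex mat set" where
  "p_space l = {x \<in> so_alg l. w0 l * x * w0 l = - x}"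

definition nilp_p :: "nat \<Rightarrow> complex mat set" where
  "nilp_p l = {x \<in> p_space l. \<exists>k. x ^\<^sub>m k = 0\<^sub>m (2*l+2) (2*l+2)}"

text \<open>The loop \<open>1 + x t\<^sup>-\<^sup>1 + 1/2 x\<^sup>2 t\<^sup>-\<^sup>2\<close>.\<close>

definition quad_loop :: "nat \<Rightarrow> complex mat \<Rightarrow> complex fls mat" where
  "quad_loop l x = 1\<^sub>m (2*l+2) + fls_X_intpow (-1) \<cdot>\<^sub>m map_mat fls_const x
     + fls_X_intpow (-2) \<cdot>\<^sub>m map_mat fls_const ((1/2) \<cdot>\<^sub>m (x * x))"


section \<open>Morphisms of quasi-affine varieties\<close>

text \<open>
  A set of points is described inside an (ind-)affine space by the set \<open>C\<close> of its coordinate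
  functions. The Zariski topology, regular functions and morphisms are those of classical
  varieties: a function is regular if it is locally a quotient of polynomials, and a morphism is
  a continuous map that pulls back regular functions to regular functions.
\<close>

inductive_set poly_funs :: "('a \<Rightarrow> complex) set \<Rightarrow> ('a \<Rightarrow> complex) set"
  for C :: "('a \<Rightarrow> complex) set" where
  const: "(\<lambda>_. a) \<in> poly_funs C"
| coord: "f \<in> C \<Longrightarrow> f \<in> poly_funs C"
| add: "f \<in> poly_funs C \<Longrightarrow> g \<in> poly_funs C \<Longrightarrow> (\<lambda>z. f z + g z) \<in> poly_funs C"
| mult: "f \<in> poly_funs C \<Longrightarrow> g \<in> poly_funs C \<Longrightarrow> (\<lambda>z. f z * g z) \<in> poly_funs C"

definition zariski_open_in :: "('a \<Rightarrow> complex) set \<Rightarrow> 'a set \<Rightarrow> 'a set \<Rightarrow> bool" where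
  "zariski_open_in C Z U \<longleftrightarrow> (\<exists>F\<subseteq>poly_funs C. U = {z \<in> Z. \<exists>f\<in>F. f z \<noteq> 0})"

definition regular_on :: "('a \<Rightarrow> complex) set \<Rightarrow> 'a set \<Rightarrow> ('a \<Rightarrow> complex) \<Rightarrow> bool" where
  "regular_on C U f \<longleftrightarrow> (\<forall>z\<in>U. \<exists>g\<in>poly_funs C. \<exists>h\<in>poly_funs C. h z \<noteq> 0 \<and>
     (\<forall>w\<in>U. h w \<noteq> 0 \<longrightarrow> f w = g w / h w))"

definition variety_morphism ::
  "('a \<Rightarrow> complex) set \<Rightarrow> 'a set \<Rightarrow> ('b \<Rightarrow> complex) set \<Rightarrow> 'b set \<Rightarrow> ('a \<Rightarrow> 'b) \<Rightarrow> bool" where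
  "variety_morphism C Z D W \<phi> \<longleftrightarrow> \<phi> ` Z \<subseteq> W \<and>
     (\<forall>U. zariski_open_in D W U \<longrightarrow> zariski_open_in C Z {z \<in> Z. \<phi> z \<in> U} \<and>
        (\<forall>f. regular_on D U f \<longrightarrow> regular_on C {z \<in> Z. \<phi> z \<in> U} (f \<circ> \<phi>)))"

definition variety_iso ::
  "('a \<Rightarrow> complex) set \<Rightarrow> 'a set \<Rightarrow> ('b \<Rightarrow> complex) set \<Rightarrow> 'b set \<Rightarrow> ('a \<Rightarrow> 'b) \<Rightarrow> bool" where
  "variety_iso C Z D W \<phi> \<longleftrightarrow> variety_morphism C Z D W \<phi> \<and>
     (\<exists>\<psi>. variety_morphism D W C Z \<psi> \<and> (\<forall>z\<in>Z. \<psi> (\<phi> z) = z) \<and> (\<forall>w\<in>W. \<phi> (\<psi> w) = w))"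

definition mat_coords :: "nat \<Rightarrow> (complex mat \<Rightarrow> complex) set" where
  "mat_coords l = {\<lambda>x. x $$ (p, q) | p q. p < 2*l+2 \<and> q < 2*l+2}"

text \<open>The coordinates on \<open>Gr0_minus l\<close> are the matrix coefficients of the representative.\<close>

definition Gr_coords :: "nat \<Rightarrow> (complex fls mat set \<Rightarrow> complex) set" where
  "Gr_coords l = {\<lambda>X. coeff_mat k (rep l X) $$ (p, q) | k p q. p < 2*l+2 \<and> q < 2*l+2}"

end

theory Submission
  imports Defs
begin

text \<open>
  A point \<open>g \<cdot> e0\<close> with \<open>g = 1 + x t^-1 + \<dots>\<close> lies in the orbit of \<open>lam\<close> iff \<open>g = k * n_pow l lam * k'\<close> for
  some \<open>k\<close> and \<open>k'\<close> in \<open>GO l\<close>. For the class \<open>(1\<^sup>j 0\<^bsup>l-j\<^esup>)\<close>, the matrix \<open>n_pow l lam\<close> is \<open>(-1)\<^sup>j\<close> on plane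
  \<open>0\<close>, a rotation with eigenvalues \<open>-t\<^sup>2\<close> and \<open>-t^-2\<close> on the planes \<open>1, \<dots>, j\<close>, and the identity elsewhere.
  Hence \<open>g = 1 + x t^-1 + y t^-2\<close>, where \<open>y = U V\<close> has rank \<open>j\<close>. The symmetry under \<open>sigma\<close> and orthogonality
  give \<open>y + y\<^sup>T = x\<^sup>2\<close> and \<open>x = e\<^sub>0 v\<^sup>T - v e\<^sub>0\<^sup>T\<close> with an isotropic vector \<open>v\<close>, that is, \<open>x\<close> is nilpotent. If
  \<open>x = 0\<close>, then \<open>y\<close> is skew and \<open>j\<close> is even; if \<open>j = 1\<close>, the equation for a matrix \<open>y\<close> of rank one forces
  \<open>y = x\<^sup>2/2\<close>. Conversely, block sums of explicit loops in dimension four and six reach \<open>x = 0\<close> for even \<open>j\<close>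
  and one \<open>x \<noteq> 0\<close> for each \<open>j \<ge> 1\<close>, and constant orthogonal matrices, products of reflections, act transitively
  on the non-zero isotropic vectors.
\<close>

(* Keeps the dimension in the form 2*l+2, so that carrier facts match syntactically. *)
declare add_2_eq_Suc [simp del] add_2_eq_Suc' [simp del] index_mult_mat(1) [simp del]

section \<open>Twisted orthogonal matrices over Laurent series\<close>

text \<open>No intrinsic description of the orbits is used. The exclusions rest on what survives
  multiplication by integral loops on both sides: the bound 2 on the pole order, and the coefficient
  matrix of t^-2 up to invertible constant factors, which keeps its rank. The twist acts as a parity
  rule: entries mixing index 0 with another index are odd in t, all others even, so the t^-1
  coefficient lives in row and column 0. That the expansion stops at t^-2 is what makes
  \<open>v\<close> isotropic. For existence, few explicit loops are enough, because conjugation by a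
  constant orthogonal matrix that does not mix index 0 with the others preserves both the double
  coset and the normalization at infinity. Reflections are convenient conjugators but have
  determinant -1; the construction therefore runs in the full orthogonal group
  \<open>torth_int\<close>, and the determinants are repaired once, in \<open>hits_GO\<close>. Even
  and odd \<open>j\<close> differ because rotation planes can be realized with vanishing t^-1
  coefficient only in pairs, as a skew matrix has even rank; a single plane must borrow index 0,
  which leaves a nonzero \<open>x\<close>.\<close>

lemma neg_t_nth: "fls_nth (neg_t f) k = (if even k then fls_nth f k else - fls_nth f k)"
proof -
  \<comment> \<open>A linear argument \<open>c * X\<close> multiplies the k-th coefficient by c^k;
    this brings \<open>- fps_X\<close> into that form.\<close>
  have "- fps_X = fps_const (-1::complex) * fps_X" by simp
  then have "fls_nth (neg_t f) k = fls_nth f k * (-1) powi k"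
    unfolding neg_t_def by (metis fls_nth_fls_compose_fps_linear neg_equal_0_iff_equal zero_neq_one)
  then show ?thesis by simp
qed

lemma neg_t_mult [simp]: "neg_t (f * g) = neg_t f * neg_t g"
  by (simp add: neg_t_def fls_compose_fps_mult)

lemma neg_t_add [simp]: "neg_t (f + g) = neg_t f + neg_t g"
  by (rule fls_eqI) (simp add: neg_t_nth)

lemma neg_t_diff [simp]: "neg_t (f - g) = neg_t f - neg_t g"
  by (rule fls_eqI) (simp add: neg_t_nth)

lemma neg_t_uminus [simp]: "neg_t (- f) = - neg_t f"
  by (rule fls_eqI) (simp add: neg_t_nth)

lemma neg_t_const [simp]: "neg_t (fls_const c) = fls_const c"
  by (simp add: neg_t_def)

lemma neg_t_0 [simp]: "neg_t 0 = 0" and neg_t_1 [simp]: "neg_t 1 = 1"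
  by (simp_all add: neg_t_def)

lemma neg_t_X [simp]: "neg_t fls_X = - fls_X"
  by (rule fls_eqI) (simp add: neg_t_nth)

lemma neg_t_X_intpow [simp]: "neg_t (fls_X_intpow k) = (if even k then fls_X_intpow k else - fls_X_intpow k)"
  by (rule fls_eqI) (simp add: neg_t_nth)

lemma neg_t_sum [simp]: "neg_t (sum f A) = (\<Sum>i\<in>A. neg_t (f i))"
  by (induction A rule: infinite_finite_induct) auto

lemma neg_t_power [simp]: "neg_t (f ^ n) = neg_t f ^ n"
  by (induction n) auto

section \<open>Pole order at 0 and degree at infinity\<close>

text \<open>A bound on coefficients instead of one on \<open>fls_subdegree\<close>: it holds for the
  zero series with every \<open>d\<close>, so zero entries and cancelling sums need no special
  case.\<close>

definition ord_ge :: "int \<Rightarrow> complex fls \<Rightarrow> bool" where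
  "ord_ge d f \<longleftrightarrow> (\<forall>k<d. fls_nth f k = 0)"

definition deg_le :: "int \<Rightarrow> complex fls \<Rightarrow> bool" where
  "deg_le d f \<longleftrightarrow> (\<forall>k>d. fls_nth f k = 0)"

text \<open>Every summand of the convolution with i different from \<open>a\<close> contains a
  factor below its bound. If \<open>a\<close> is outside the range of summation, then at k = a + b
  either \<open>a\<close> is below the subdegree of \<open>f\<close> or \<open>b\<close> is below
  that of \<open>g\<close>, so the claimed value is zero as well.\<close>

lemma ord_mult_aux:
  assumes "ord_ge a f" "ord_ge b g" "k \<le> a + b"
  shows "fls_nth (f * g) k = (if k = a + b then fls_nth f a * fls_nth g b else 0)"
proof -
  have "fls_nth (f * g) k = (\<Sum>i=fls_subdegree f..k - fls_subdegree g.
      if i = a then (if k = a + b then fls_nth f a * fls_nth g b else 0) else 0)"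
    unfolding fls_times_nth(2)
  proof (intro sum.cong refl)
    fix i
    show "fls_nth f i * fls_nth g (k - i) =
        (if i = a then (if k = a + b then fls_nth f a * fls_nth g b else 0) else 0)"
    proof (cases "i < a \<or> k - i < b")
      case True
      then show ?thesis using assms unfolding ord_ge_def by force
    next
      case False
      then have "i = a" "k = a + b" using assms(3) by auto
      then show ?thesis by simp
    qed
  qed
  also have "\<dots> = (if a \<in> {fls_subdegree f..k - fls_subdegree g}
      then (if k = a + b then fls_nth f a * fls_nth g b else 0) else 0)"
    by (simp add: sum.delta)
  also have "\<dots> = (if k = a + b then fls_nth f a * fls_nth g b else 0)"
    by (auto simp: not_le)
  finally show ?thesis .
qed

lemma ord_ge_mult: "ord_ge a f \<Longrightarrow> ord_ge b g \<Longrightarrow> ord_ge (a + b) (f * g)"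
  using ord_mult_aux[of a f b g] by (simp add: ord_ge_def)

lemma nth_mult_ord_ge: "ord_ge a f \<Longrightarrow> ord_ge b g \<Longrightarrow> fls_nth (f * g) (a + b) = fls_nth f a * fls_nth g b"
  by (simp add: ord_mult_aux)

lemma deg_mult_aux:
  assumes "deg_le a f" "deg_le b g" "k \<ge> a + b"
  shows "fls_nth (f * g) k = (if k = a + b then fls_nth f a * fls_nth g b else 0)"
proof -
  have "fls_nth (f * g) k = (\<Sum>i=fls_subdegree f..k - fls_subdegree g.
      if i = a then (if k = a + b then fls_nth f a * fls_nth g b else 0) else 0)"
    unfolding fls_times_nth(2)
  proof (intro sum.cong refl)
    fix i
    show "fls_nth f i * fls_nth g (k - i) =
        (if i = a then (if k = a + b then fls_nth f a * fls_nth g b else 0) else 0)"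
    proof (cases "i > a \<or> k - i > b")
      case True
      then show ?thesis using assms unfolding deg_le_def by force
    next
      case False
      then have "i = a" "k = a + b" using assms(3) by auto
      then show ?thesis by simp
    qed
  qed
  also have "\<dots> = (if a \<in> {fls_subdegree f..k - fls_subdegree g}
      then (if k = a + b then fls_nth f a * fls_nth g b else 0) else 0)"
    by (simp add: sum.delta)
  also have "\<dots> = (if k = a + b then fls_nth f a * fls_nth g b else 0)"
    by (auto simp: not_le)
  finally show ?thesis .
qed

lemma deg_le_mult: "deg_le a f \<Longrightarrow> deg_le b g \<Longrightarrow> deg_le (a + b) (f * g)"
  using deg_mult_aux[of a f b g] by (simp add: deg_le_def)

lemma nth_mult_deg_le: "deg_le a f \<Longrightarrow> deg_le b g \<Longrightarrow> fls_nth (f * g) (a + b) = fls_nth f a * fls_nth g b"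
  by (simp add: deg_mult_aux)

lemma ord_ge_sum: "(\<And>i. i \<in> A \<Longrightarrow> ord_ge d (f i)) \<Longrightarrow> ord_ge d (sum f A)"
  by (simp add: ord_ge_def fls_nth_sum)

lemma deg_le_sum: "(\<And>i. i \<in> A \<Longrightarrow> deg_le d (f i)) \<Longrightarrow> deg_le d (sum f A)"
  by (simp add: deg_le_def fls_nth_sum)

lemma ord_ge_0_intros [simp, intro]:
  "ord_ge 0 0" "ord_ge 0 1" "ord_ge 0 (fls_const c)" "ord_ge 0 (numeral n)" "ord_ge 0 fls_X"
  "ord_ge 0 f \<Longrightarrow> ord_ge 0 (- f)"
  "ord_ge 0 f \<Longrightarrow> ord_ge 0 g \<Longrightarrow> ord_ge 0 (f + g)"
  "ord_ge 0 f \<Longrightarrow> ord_ge 0 g \<Longrightarrow> ord_ge 0 (f - g)"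
  "ord_ge 0 f \<Longrightarrow> ord_ge 0 g \<Longrightarrow> ord_ge 0 (f * g)"
  using ord_ge_mult[of 0 f 0 g]
  by (auto simp: ord_ge_def simp flip: fls_const_numeral)

lemma ord_ge_0_power [simp, intro]: "ord_ge 0 f \<Longrightarrow> ord_ge 0 (f ^ n)"
  by (induction n) auto

text \<open>
  The flag tells whether index \<open>0\<close> is the one negated by \<open>w0\<close>. It is needed because a twisted matrix is
  assembled from one block containing index \<open>0\<close> and further, untwisted blocks.
\<close>

definition tsgn :: "bool \<Rightarrow> nat \<Rightarrow> complex fls" where
  "tsgn t p = (if t \<and> p = 0 then -1 else 1)"

lemma tsgn_cases: "tsgn t p = 1 \<or> tsgn t p = -1"
  by (simp add: tsgn_def)

lemma tsgn_square [simp]: "tsgn t p * tsgn t p = 1" "tsgn t p * (tsgn t p * x) = x"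
  by (simp_all add: tsgn_def)

text \<open>The last condition is invariance under \<open>sigma\<close>, entry by entry. The
  determinant is left free so that reflections, needed later for transitivity, belong to the
  group.\<close>

definition torth :: "bool \<Rightarrow> nat \<Rightarrow> complex fls mat set" where
  "torth t m = {g \<in> carrier_mat m m. transpose_mat g * g = 1\<^sub>m m \<and>
     (\<forall>p<m. \<forall>q<m. neg_t (g $$ (p, q)) = tsgn t p * tsgn t q * g $$ (p, q))}"

definition torth_int :: "bool \<Rightarrow> nat \<Rightarrow> complex fls mat set" where
  "torth_int t m = {g \<in> torth t m. \<forall>p<m. \<forall>q<m. ord_ge 0 (g $$ (p, q))}"

lemma mult_index:
  assumes "A \<in> carrier_mat n m" "B \<in> carrier_mat m r" "p < n" "q < r"
  shows "(A * B) $$ (p, q) = (\<Sum>i<m. A $$ (p, i) * B $$ (i, q))"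
  using assms by (simp add: index_mult_mat(1) scalar_prod_def lessThan_atLeast0)

lemma mult3_index:
  assumes "A \<in> carrier_mat n m" "B \<in> carrier_mat m r" "C \<in> carrier_mat r s" "p < n" "q < s"
  shows "(A * B * C) $$ (p, q) = (\<Sum>i<m. \<Sum>k<r. A $$ (p, i) * B $$ (i, k) * C $$ (k, q))"
proof -
  have AB: "A * B \<in> carrier_mat n r" using assms by auto
  have "(A * B * C) $$ (p, q) = (\<Sum>k<r. (A * B) $$ (p, k) * C $$ (k, q))"
    using AB assms by (intro mult_index)
  also have "\<dots> = (\<Sum>k<r. \<Sum>i<m. A $$ (p, i) * B $$ (i, k) * C $$ (k, q))"
    using assms by (intro sum.cong refl) (simp only: mult_index[of A n m B r] lessThan_iff sum_distrib_right)
  also have "\<dots> = (\<Sum>i<m. \<Sum>k<r. A $$ (p, i) * B $$ (i, k) * C $$ (k, q))"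
    by (rule sum.swap)
  finally show ?thesis .
qed

lemma torth_carrier: "g \<in> torth t m \<Longrightarrow> g \<in> carrier_mat m m"
  and torth_int_carrier: "g \<in> torth_int t m \<Longrightarrow> g \<in> carrier_mat m m"
  by (auto simp: torth_def torth_int_def)

lemma torth_inverse: "g \<in> torth t m \<Longrightarrow> transpose_mat g * g = 1\<^sub>m m"
  and torth_neg_t: "g \<in> torth t m \<Longrightarrow> p < m \<Longrightarrow> q < m \<Longrightarrow>
    neg_t (g $$ (p, q)) = tsgn t p * tsgn t q * g $$ (p, q)"
  by (auto simp: torth_def)

lemma torthI:
  assumes "g \<in> carrier_mat m m" "transpose_mat g * g = 1\<^sub>m m"
    "\<And>p q. p < m \<Longrightarrow> q < m \<Longrightarrow> neg_t (g $$ (p, q)) = tsgn t p * tsgn t q * g $$ (p, q)"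
  shows "g \<in> torth t m"
  using assms unfolding torth_def by blast

lemma torth_mult:
  assumes "g \<in> torth t m" "h \<in> torth t m"
  shows "g * h \<in> torth t m"
proof (rule torthI)
  have c: "g \<in> carrier_mat m m" "h \<in> carrier_mat m m"
    using assms by (auto dest: torth_carrier)
  then show "g * h \<in> carrier_mat m m" by simp
  have "transpose_mat (g * h) * (g * h) = transpose_mat h * (transpose_mat g * (g * h))"
    using c by (simp add: transpose_mult[of g m m h m] assoc_mult_mat[of _ m m _ m _ m])
  also have "\<dots> = transpose_mat h * (transpose_mat g * g * h)"
    using c by (simp add: assoc_mult_mat[of _ m m _ m _ m])
  also have "\<dots> = 1\<^sub>m m"
    unfolding torth_inverse[OF assms(1)] using c torth_inverse[OF assms(2)] by simp
  finally show "transpose_mat (g * h) * (g * h) = 1\<^sub>m m" .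
  fix p q assume pq: "p < m" "q < m"
  have "neg_t (g $$ (p, i)) * neg_t (h $$ (i, q)) = tsgn t p * tsgn t q * (g $$ (p, i) * h $$ (i, q))"
    if "i < m" for i
    using torth_neg_t[OF assms(1) pq(1) that] torth_neg_t[OF assms(2) that pq(2)]
      tsgn_cases[of t i] by auto
  then show "neg_t ((g * h) $$ (p, q)) = tsgn t p * tsgn t q * (g * h) $$ (p, q)"
    using c pq by (simp add: mult_index[of _ m m] sum_distrib_left)
qed

lemma torth_right_inverse:
  assumes "g \<in> torth t m"
  shows "g * transpose_mat g = 1\<^sub>m m"
  using torth_carrier[OF assms] by (intro mat_mult_left_right_inverse[OF _ _ torth_inverse[OF assms]]) auto

lemma torth_transpose:
  assumes "g \<in> torth t m"
  shows "transpose_mat g \<in> torth t m"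
proof (rule torthI)
  have c: "g \<in> carrier_mat m m" using assms by (rule torth_carrier)
  then show "transpose_mat g \<in> carrier_mat m m" by simp
  show "transpose_mat (transpose_mat g) * transpose_mat g = 1\<^sub>m m"
    using torth_right_inverse[OF assms] by simp
  show "neg_t (transpose_mat g $$ (p, q)) = tsgn t p * tsgn t q * transpose_mat g $$ (p, q)"
    if "p < m" "q < m" for p q
    using torth_neg_t[OF assms that(2,1)] c that by (simp add: mult.commute)
qed

lemma torth_int_torth: "g \<in> torth_int t m \<Longrightarrow> g \<in> torth t m"
  and torth_int_ord: "g \<in> torth_int t m \<Longrightarrow> p < m \<Longrightarrow> q < m \<Longrightarrow> ord_ge 0 (g $$ (p, q))"
  by (auto simp: torth_int_def)

lemma torth_intI:
  "g \<in> torth t m \<Longrightarrow> (\<And>p q. p < m \<Longrightarrow> q < m \<Longrightarrow> ord_ge 0 (g $$ (p, q))) \<Longrightarrow> g \<in> torth_int t m"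
  unfolding torth_int_def by blast

lemma torth_int_mult:
  assumes "g \<in> torth_int t m" "h \<in> torth_int t m"
  shows "g * h \<in> torth_int t m"
proof (rule torth_intI)
  show "g * h \<in> torth t m" using assms by (intro torth_mult torth_int_torth)
  show "ord_ge 0 ((g * h) $$ (p, q))" if "p < m" "q < m" for p q
    using that torth_int_ord[OF assms(1) that(1)] torth_int_ord[OF assms(2) _ that(2)]
    by (auto simp: mult_index[OF torth_int_carrier[OF assms(1)] torth_int_carrier[OF assms(2)]] intro!: ord_ge_sum)
qed

lemma torth_int_transpose:
  assumes "g \<in> torth_int t m"
  shows "transpose_mat g \<in> torth_int t m"
proof (rule torth_intI)
  show "transpose_mat g \<in> torth t m" using assms by (intro torth_transpose torth_int_torth)
  show "ord_ge 0 (transpose_mat g $$ (p, q))" if "p < m" "q < m" for p q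
    using torth_int_ord[OF assms that(2,1)] torth_int_carrier[OF assms] that by simp
qed

lemma one_torth_int [simp]: "1\<^sub>m m \<in> torth_int t m"
  by (intro torth_intI torthI) auto

section \<open>The loop groups as twisted orthogonal groups\<close>

lemma w0_carrier [simp]: "w0 l \<in> carrier_mat (2*l+2) (2*l+2)" by (simp add: w0_def)

lemma w0_conj_index:
  fixes A :: "'a::comm_ring_1 mat"
  assumes "A \<in> carrier_mat (2*l+2) (2*l+2)" "p < 2*l+2" "q < 2*l+2"
  shows "(w0 l * A * w0 l) $$ (p, q) = (if p = 0 then -1 else 1) * (if q = 0 then -1 else 1) * A $$ (p, q)"
proof -
  define s :: "nat \<Rightarrow> 'a" where "s i = (if i = 0 then -1 else 1)" for i
  have w: "w0 l $$ (i, k) = (if i = k then s i else 0)" if "i < 2*l+2" "k < 2*l+2" for i k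
    using that by (simp add: w0_def s_def)
  have "(w0 l * A * w0 l) $$ (p, q) = (\<Sum>i<2*l+2. \<Sum>k<2*l+2. w0 l $$ (p, i) * A $$ (i, k) * w0 l $$ (k, q))"
    using assms by (intro mult3_index) auto
  also have "\<dots> = (\<Sum>i<2*l+2. \<Sum>k<2*l+2. if k = q then if i = p then s p * A $$ (p, q) * s q else 0 else 0)"
    using assms(2,3) by (intro sum.cong refl) (simp add: w)
  also have "\<dots> = s p * A $$ (p, q) * s q"
    using assms(2,3) by simp
  finally show ?thesis by (simp add: s_def)
qed

lemma GK_iff: "g \<in> GK l \<longleftrightarrow> g \<in> torth True (2*l+2) \<and> det g = 1"
proof -
  have "sigma l g = g \<longleftrightarrow> (\<forall>p<2*l+2. \<forall>q<2*l+2. neg_t (g $$ (p, q)) = tsgn True p * tsgn True q * g $$ (p, q))"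
    if g: "g \<in> carrier_mat (2*l+2) (2*l+2)"
  proof -
    have c: "sigma l g \<in> carrier_mat (2*l+2) (2*l+2)"
      using mult_carrier_mat[of "w0 l * map_mat neg_t g" "2*l+2" "2*l+2" "w0 l"]
        mult_carrier_mat[of "w0 l" "2*l+2" "2*l+2" "map_mat neg_t g"] g by (simp add: sigma_def)
    have "sigma l g $$ (p, q) = tsgn True p * tsgn True q * neg_t (g $$ (p, q))" if "p < 2*l+2" "q < 2*l+2" for p q
      using that g by (simp add: sigma_def w0_conj_index tsgn_def)
    moreover have "sigma l g = g \<longleftrightarrow> (\<forall>p<2*l+2. \<forall>q<2*l+2. sigma l g $$ (p, q) = g $$ (p, q))"
      using c g by (auto intro!: eq_matI)
    moreover have "tsgn True p * tsgn True q * x = y \<longleftrightarrow> x = tsgn True p * tsgn True q * y" for p q x y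
      by (auto simp: tsgn_def)
    ultimately show ?thesis by auto
  qed
  then show ?thesis unfolding GK_def torth_def by blast
qed

lemma GO_iff: "g \<in> GO l \<longleftrightarrow> g \<in> torth_int True (2*l+2) \<and> det g = 1"
  unfolding GO_def GK_iff torth_int_def ord_ge_def by blast

lemma GOminus_iff:
  "g \<in> GOminus l \<longleftrightarrow> g \<in> torth True (2*l+2) \<and> det g = 1 \<and> (\<forall>p<2*l+2. \<forall>q<2*l+2. deg_le 0 (g $$ (p, q)))"
  unfolding GOminus_def GK_iff deg_le_def by blast

lemma GK_mult:
  assumes "g \<in> GK l" "h \<in> GK l"
  shows "g * h \<in> GK l"
proof -
  have "g \<in> torth True (2*l+2)" "h \<in> torth True (2*l+2)" "det g = 1" "det h = 1"
    using assms unfolding GK_iff by auto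
  then show ?thesis
    unfolding GK_iff by (metis det_mult mult_1 torth_carrier torth_mult)
qed

lemma GO_mult:
  assumes "g \<in> GO l" "h \<in> GO l"
  shows "g * h \<in> GO l"
proof -
  have "g \<in> torth_int True (2*l+2)" "h \<in> torth_int True (2*l+2)" "det g = 1" "det h = 1"
    using assms unfolding GO_iff by auto
  then show ?thesis
    unfolding GO_iff by (metis det_mult mult_1 torth_int_carrier torth_int_mult)
qed

lemma GO_transpose:
  assumes "g \<in> GO l"
  shows "transpose_mat g \<in> GO l"
  using assms unfolding GO_iff by (metis det_transpose torth_int_carrier torth_int_transpose)

section \<open>Cosets of the integral loops\<close>

lemma act_mult:
  assumes "g \<in> carrier_mat (2*l+2) (2*l+2)" "h \<in> carrier_mat (2*l+2) (2*l+2)"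
  shows "act g (act h (e0 l)) = act (g * h) (e0 l)"
proof -
  have "g * (h * k) = g * h * k" if "k \<in> e0 l" for k
  proof -
    have "k \<in> carrier_mat (2*l+2) (2*l+2)"
      using that torth_int_carrier unfolding e0_def GO_iff by blast
    then show ?thesis using assms assoc_mult_mat[of g "2*l+2" "2*l+2" h "2*l+2" k "2*l+2"] by simp
  qed
  then show ?thesis unfolding act_def by (auto simp: image_image)
qed

lemma act_GO:
  assumes "k \<in> GO l"
  shows "act k (e0 l) = e0 l"
proof
  show "act k (e0 l) \<subseteq> e0 l"
    using assms GO_mult by (auto simp: act_def e0_def)
  show "e0 l \<subseteq> act k (e0 l)"
  proof
    fix h assume "h \<in> e0 l"
    then have h: "h \<in> GO l" by (simp add: e0_def)
    have c: "k \<in> carrier_mat (2*l+2) (2*l+2)" "h \<in> carrier_mat (2*l+2) (2*l+2)"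
      using h assms torth_int_carrier unfolding GO_iff by blast+
    have "k * (transpose_mat k * h) = k * transpose_mat k * h"
      using c assoc_mult_mat[of k "2*l+2" "2*l+2" "transpose_mat k" "2*l+2" h "2*l+2"] by simp
    also have "\<dots> = h"
      unfolding torth_right_inverse[OF torth_int_torth[OF conjunct1[OF assms[unfolded GO_iff]]]]
      using c by simp
    finally have "h = k * (transpose_mat k * h)" by simp
    moreover have "transpose_mat k * h \<in> GO l" using assms h by (intro GO_mult GO_transpose)
    ultimately show "h \<in> act k (e0 l)" unfolding act_def e0_def by blast
  qed
qed

lemma self_in_coset:
  assumes "g \<in> carrier_mat (2*l+2) (2*l+2)"
  shows "g \<in> act g (e0 l)"
  using assms GO_one[of l] unfolding act_def e0_def by (metis image_eqI right_mult_one_mat)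

section \<open>Normalization at infinity and double cosets\<close>

lemma fls_nth_0_prod_deg_le:
  assumes "finite A" "\<And>i. i \<in> A \<Longrightarrow> deg_le 0 (f i)"
  shows "deg_le 0 (prod f A) \<and> fls_nth (prod f A) 0 = (\<Prod>i\<in>A. fls_nth (f i) 0)"
  using assms
proof (induction A)
  case (insert x F)
  then have "deg_le 0 (f x)" "deg_le 0 (prod f F)" by auto
  then show ?case using insert deg_le_mult[of 0 "f x" 0 "prod f F"] nth_mult_deg_le[of 0 "f x" 0 "prod f F"]
    by simp
qed (simp add: deg_le_def)

text \<open>Evaluation at t = infinity is multiplicative only on the subring of polynomials in t^-1,
  so the claim is checked term by term in the Leibniz formula.\<close>

lemma det_coeff_mat_0:
  assumes g: "g \<in> carrier_mat n n" and d: "\<And>p q. p < n \<Longrightarrow> q < n \<Longrightarrow> deg_le 0 (g $$ (p, q))"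
  shows "fls_nth (det g) 0 = det (coeff_mat 0 g)"
proof -
  have c: "coeff_mat 0 g \<in> carrier_mat n n" using g by (simp add: coeff_mat_def)
  have "fls_nth (signof p * (\<Prod>i = 0..<n. g $$ (i, p i))) 0
      = signof p * (\<Prod>i = 0..<n. coeff_mat 0 g $$ (i, p i))"
    if "p permutes {0..<n}" for p
  proof -
    have p: "p i < n" if "i < n" for i using permutes_in_image[OF \<open>p permutes {0..<n}\<close>, of i] that by simp
    have "fls_nth (\<Prod>i = 0..<n. g $$ (i, p i)) 0 = (\<Prod>i = 0..<n. fls_nth (g $$ (i, p i)) 0)"
      using fls_nth_0_prod_deg_le[of "{0..<n}" "\<lambda>i. g $$ (i, p i)"] d p by auto
    also have "\<dots> = (\<Prod>i = 0..<n. coeff_mat 0 g $$ (i, p i))"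
      using g p by (intro prod.cong) (auto simp: coeff_mat_def)
    finally show ?thesis by (simp add: sign_def)
  qed
  then show ?thesis
    unfolding det_def'[OF g] det_def'[OF c] fls_nth_sum by (intro sum.cong) auto
qed

lemma det_map_fls_const: "det (map_mat fls_const (A :: complex mat)) = fls_const (det A)"
proof -
  interpret comm_ring_hom "fls_const :: complex \<Rightarrow> complex fls"
    by unfold_locales (auto simp: fls_plus_const)
  show ?thesis by (rule hom_det)
qed

lemma mat_inverse_index:
  assumes "transpose_mat g * g = 1\<^sub>m m" "g \<in> carrier_mat m m" "p < m" "q < m"
  shows "(\<Sum>i<m. g $$ (i, p) * g $$ (i, q)) = (if p = q then 1 else 0)"
proof -
  have "(transpose_mat g * g) $$ (p, q) = (\<Sum>i<m. g $$ (i, p) * g $$ (i, q))"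
    using assms(2-) by (subst mult_index[of _ m m _ m]) auto
  then show ?thesis using assms by simp
qed

text \<open>Constants are fixed by \<open>neg_t\<close>, so invariance under the twist forces
  entries mixing index 0 with other indices to vanish; this is hypothesis \<open>s\<close>.\<close>

lemma const_torth_int:
  assumes R: "R \<in> carrier_mat m m" "transpose_mat R * R = 1\<^sub>m m"
    and s: "\<And>p q. p < m \<Longrightarrow> q < m \<Longrightarrow> t \<Longrightarrow> (p = 0) \<noteq> (q = 0) \<Longrightarrow> R $$ (p, q) = 0"
  shows "map_mat fls_const R \<in> torth_int t m"
proof (intro torth_intI torthI)
  show "map_mat fls_const R \<in> carrier_mat m m" using R by simp
  show "transpose_mat (map_mat fls_const R) * map_mat fls_const R = 1\<^sub>m m"
  proof -
    interpret comm_ring_hom "fls_const :: complex \<Rightarrow> complex fls"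
      by unfold_locales (auto simp: fls_plus_const)
    have "transpose_mat (map_mat fls_const R) * map_mat fls_const R = map_mat fls_const (transpose_mat R * R)"
      using mat_hom_mult[of "transpose_mat R" m m R m] R(1) by (simp add: map_mat_transpose)
    then show ?thesis using R(2) by (simp add: mat_hom_one)
  qed
  show "neg_t (map_mat fls_const R $$ (p, q)) = tsgn t p * tsgn t q * map_mat fls_const R $$ (p, q)"
    if "p < m" "q < m" for p q
    using that s[of p q] R(1) by (auto simp: tsgn_def)
  show "ord_ge 0 (map_mat fls_const R $$ (p, q))" if "p < m" "q < m" for p q
    using that R(1) by simp
qed

text \<open>Orthogonality, twist and determinant all pass to the value at infinity. Being constant,
  this value is also an integral loop and can be absorbed into the base point.\<close>

lemma GOminus_const_coeff:
  assumes "g \<in> GOminus l"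
  shows "map_mat fls_const (coeff_mat 0 g) \<in> GO l" 
    "transpose_mat (coeff_mat 0 g) * coeff_mat 0 g = 1\<^sub>m (2*l+2)"
proof -
  let ?n = "2*l+2"
  have g: "g \<in> torth True ?n" "det g = 1" "\<And>p q. p < ?n \<Longrightarrow> q < ?n \<Longrightarrow> deg_le 0 (g $$ (p, q))"
    using assms unfolding GOminus_iff by blast+
  note c = torth_carrier[OF g(1)]
  have c0: "coeff_mat 0 g \<in> carrier_mat ?n ?n" using c by (simp add: coeff_mat_def)
  show o: "transpose_mat (coeff_mat 0 g) * coeff_mat 0 g = 1\<^sub>m ?n"
  proof (rule eq_matI)
    fix p q assume "p < dim_row (1\<^sub>m ?n)" "q < dim_col (1\<^sub>m ?n)"
    then have pq: "p < ?n" "q < ?n" by auto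
    have "(transpose_mat (coeff_mat 0 g) * coeff_mat 0 g) $$ (p, q)
        = (\<Sum>i<?n. fls_nth (g $$ (i, p)) 0 * fls_nth (g $$ (i, q)) 0)"
      using c0 c pq by (subst mult_index[of _ ?n ?n _ ?n]) (auto simp: coeff_mat_def)
    also have "\<dots> = (\<Sum>i<?n. fls_nth (g $$ (i, p) * g $$ (i, q)) 0)"
      using g(3) pq nth_mult_deg_le[of 0 _ 0] by (intro sum.cong) auto
    also have "\<dots> = fls_nth (\<Sum>i<?n. g $$ (i, p) * g $$ (i, q)) 0" by (simp add: fls_nth_sum)
    also have "\<dots> = (if p = q then 1 else 0)"
      using mat_inverse_index[OF torth_inverse[OF g(1)] c pq] by simp
    finally show "(transpose_mat (coeff_mat 0 g) * coeff_mat 0 g) $$ (p, q) = 1\<^sub>m ?n $$ (p, q)"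
      using pq by simp
  qed (use c0 in auto)
  have s: "coeff_mat 0 g $$ (p, q) = 0" if pq: "p < ?n" "q < ?n" "True" "(p = 0) \<noteq> (q = 0)" for p q
  proof -
    have "fls_nth (neg_t (g $$ (p, q))) 0 = fls_nth (- (g $$ (p, q))) 0"
      using torth_neg_t[OF g(1) pq(1,2)] pq(4) by (auto simp: tsgn_def)
    then show ?thesis using pq c by (simp add: neg_t_nth coeff_mat_def)
  qed
  have "det (coeff_mat 0 g) = 1"
    using det_coeff_mat_0[OF c] g by simp
  then show "map_mat fls_const (coeff_mat 0 g) \<in> GO l"
    using const_torth_int[OF c0 o s] by (simp add: GO_iff det_map_fls_const)
qed

lemma GOminus0_carrier: "g \<in> GOminus0 l \<Longrightarrow> g \<in> carrier_mat (2*l+2) (2*l+2)"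
  unfolding GOminus0_def GOminus_iff using torth_carrier by blast

lemma GO_carrier: "g \<in> GO l \<Longrightarrow> g \<in> carrier_mat (2*l+2) (2*l+2)"
  unfolding GO_iff using torth_int_carrier by blast

text \<open>Dividing on the right by the value at infinity normalizes the loop and leaves its coset
  alone.\<close>

lemma GOminus_normalize:
  assumes "g \<in> GOminus l"
  obtains h where "h \<in> GOminus0 l" "act h (e0 l) = act g (e0 l)"
proof
  let ?n = "2*l+2"
  let ?c = "map_mat fls_const (coeff_mat 0 g)"
  let ?h = "g * transpose_mat ?c"
  have g: "g \<in> torth True ?n" "det g = 1" "\<And>p q. p < ?n \<Longrightarrow> q < ?n \<Longrightarrow> deg_le 0 (g $$ (p, q))"
    using assms unfolding GOminus_iff by blast+
  note cg = torth_carrier[OF g(1)]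
  note c = GOminus_const_coeff[OF assms]
  have cc: "coeff_mat 0 g \<in> carrier_mat ?n ?n" using cg by (simp add: coeff_mat_def)
  have cT: "transpose_mat ?c \<in> GO l" using c(1) by (rule GO_transpose)
  have "g \<in> GK l" "transpose_mat ?c \<in> GK l"
    using g cT unfolding GK_iff GO_iff by (auto dest: torth_int_torth)
  then have GK: "?h \<in> GK l" by (rule GK_mult)
  have idx: "?h $$ (p, q) = (\<Sum>i<?n. g $$ (p, i) * fls_const (coeff_mat 0 g $$ (q, i)))"
    if "p < ?n" "q < ?n" for p q
    using cg cc that by (subst mult_index[of _ ?n ?n _ ?n]) auto
  have cle: "deg_le 0 (fls_const a)" for a by (simp add: deg_le_def)
  have "deg_le 0 (?h $$ (p, q))" if "p < ?n" "q < ?n" for p q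
    unfolding idx[OF that] using g(3) that deg_le_mult[of 0 _ 0, OF _ cle] by (auto intro!: deg_le_sum)
  then have m: "?h \<in> GOminus l" using GK unfolding GOminus_iff GK_iff by blast
  have "coeff_mat 0 ?h = coeff_mat 0 g * transpose_mat (coeff_mat 0 g)"
  proof (rule eq_matI)
    fix p q assume "p < dim_row (coeff_mat 0 g * transpose_mat (coeff_mat 0 g))"
      "q < dim_col (coeff_mat 0 g * transpose_mat (coeff_mat 0 g))"
    then have pq: "p < ?n" "q < ?n" using cc by auto
    have "coeff_mat 0 ?h $$ (p, q) = fls_nth (?h $$ (p, q)) 0"
      using pq cg cc by (simp add: coeff_mat_def)
    also have "\<dots> = (\<Sum>i<?n. coeff_mat 0 g $$ (p, i) * coeff_mat 0 g $$ (q, i))"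
      unfolding idx[OF pq] fls_nth_sum using pq cg
      by (intro sum.cong) (auto simp: coeff_mat_def)
    also have "\<dots> = (coeff_mat 0 g * transpose_mat (coeff_mat 0 g)) $$ (p, q)"
      using pq cc by (subst mult_index[of _ ?n ?n _ ?n]) auto
    finally show "coeff_mat 0 ?h $$ (p, q) = (coeff_mat 0 g * transpose_mat (coeff_mat 0 g)) $$ (p, q)" .
  qed (use cc cg in \<open>auto simp: coeff_mat_def\<close>)
  also have "\<dots> = 1\<^sub>m ?n" using cc c(2) mat_mult_left_right_inverse[of "transpose_mat (coeff_mat 0 g)" ?n] by auto
  finally show "?h \<in> GOminus0 l" using m by (simp add: GOminus0_def)
  show "act ?h (e0 l) = act g (e0 l)"
    using act_mult[OF cg GO_carrier[OF cT]] act_GO[OF cT] by simp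
qed

text \<open>The bridge from the Grassmannian to matrices: the stabilizer of the base point supplies
  the right factor \<open>k'\<close>, and membership becomes a factorization with integral factors
  on both sides of the torus element.\<close>

lemma M_iff:
  assumes n: "n_pow l lam \<in> carrier_mat (2*l+2) (2*l+2)"
  shows "X \<in> M l lam \<longleftrightarrow> (\<exists>g\<in>GOminus0 l. X = act g (e0 l) \<and> (\<exists>k\<in>GO l. \<exists>k'\<in>GO l. g = k * n_pow l lam * k'))"
proof
  assume "X \<in> M l lam"
  then obtain k g where k: "k \<in> GO l" "X = act k (act (n_pow l lam) (e0 l))" 
    and g: "g \<in> GOminus l" "X = act g (e0 l)"
    by (auto simp: M_def Gr_orbit_def Gr0_minus_def)
  obtain h where h: "h \<in> GOminus0 l" "act h (e0 l) = X" using GOminus_normalize[OF g(1)] g(2) by metis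
  have "h \<in> act (k * n_pow l lam) (e0 l)"
    using self_in_coset[OF GOminus0_carrier[OF h(1)]] h(2) k act_mult[OF GO_carrier[OF k(1)] n] by simp
  then show "\<exists>g\<in>GOminus0 l. X = act g (e0 l) \<and> (\<exists>k\<in>GO l. \<exists>k'\<in>GO l. g = k * n_pow l lam * k')"
    using h k(1) unfolding act_def e0_def by blast
next
  assume "\<exists>g\<in>GOminus0 l. X = act g (e0 l) \<and> (\<exists>k\<in>GO l. \<exists>k'\<in>GO l. g = k * n_pow l lam * k')"
  then obtain g k k' where g: "g \<in> GOminus0 l" "X = act g (e0 l)" "k \<in> GO l" "k' \<in> GO l" "g = k * n_pow l lam * k'"
    by blast
  note kc = GO_carrier[OF g(3)]
  have "X = act k (act (n_pow l lam) (act k' (e0 l)))"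
    using act_mult[OF n GO_carrier[OF g(4)]] act_mult[of k l "n_pow l lam * k'"] kc n GO_carrier[OF g(4)] g(2,5)
      assoc_mult_mat[of k "2*l+2" "2*l+2" "n_pow l lam" "2*l+2" k' "2*l+2"] by simp
  then have "X = act k (act (n_pow l lam) (e0 l))" using act_GO[OF g(4)] by simp
  then show "X \<in> M l lam"
    using g unfolding M_def Gr_orbit_def Gr0_minus_def GOminus0_def by blast
qed

section \<open>The torus elements\<close>

lemma sum_planes:
  fixes f :: "nat \<Rightarrow> 'a::comm_monoid_add"
  shows "(\<Sum>i<2*m. f i) = (\<Sum>b<m. f (2*b) + f (Suc (2*b)))"
  by (induction m) (simp_all add: add.assoc add_2_eq_Suc)

definition plane_mat :: "nat \<Rightarrow> (nat \<Rightarrow> nat \<Rightarrow> nat \<Rightarrow> 'a) \<Rightarrow> 'a::comm_ring_1 mat" where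
  "plane_mat m f = mat (2*m) (2*m) (\<lambda>(p, q). if p div 2 = q div 2 then f (p div 2) (p mod 2) (q mod 2) else 0)"

lemma plane_mat_carrier [simp]: "plane_mat m f \<in> carrier_mat (2*m) (2*m)"
  by (simp add: plane_mat_def)

lemma plane_mat_index [simp]:
  "p < 2*m \<Longrightarrow> q < 2*m \<Longrightarrow> plane_mat m f $$ (p, q) = (if p div 2 = q div 2 then f (p div 2) (p mod 2) (q mod 2) else 0)"
  by (simp add: plane_mat_def)

lemma plane_mat_dim [simp]: "dim_row (plane_mat m f) = 2*m" "dim_col (plane_mat m f) = 2*m"
  by (simp_all add: plane_mat_def)

lemma plane_mat_mult:
  "plane_mat m f * plane_mat m g = plane_mat m (\<lambda>b p q. f b p 0 * g b 0 q + f b p 1 * g b 1 q)"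
proof (rule eq_matI)
  fix p q assume "p < dim_row (plane_mat m (\<lambda>b p q. f b p 0 * g b 0 q + f b p 1 * g b 1 q))"
    "q < dim_col (plane_mat m (\<lambda>b p q. f b p 0 * g b 0 q + f b p 1 * g b 1 q))"
  then have pq: "p < 2*m" "q < 2*m" by auto
  have "(plane_mat m f * plane_mat m g) $$ (p, q)
      = (\<Sum>b<m. plane_mat m f $$ (p, 2*b) * plane_mat m g $$ (2*b, q) + plane_mat m f $$ (p, Suc (2*b)) * plane_mat m g $$ (Suc (2*b), q))"
    using pq by (subst mult_index[of _ "2*m" "2*m" _ "2*m"]) (auto simp: sum_planes)
  also have "\<dots> = (\<Sum>b<m. if b = p div 2 then (if p div 2 = q div 2 then
       f (p div 2) (p mod 2) 0 * g (p div 2) 0 (q mod 2) + f (p div 2) (p mod 2) 1 * g (p div 2) 1 (q mod 2) else 0) else 0)"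
    using pq by (intro sum.cong) auto
  also have "\<dots> = plane_mat m (\<lambda>b p q. f b p 0 * g b 0 q + f b p 1 * g b 1 q) $$ (p, q)"
    using pq by auto
  finally show "(plane_mat m f * plane_mat m g) $$ (p, q) = plane_mat m (\<lambda>b p q. f b p 0 * g b 0 q + f b p 1 * g b 1 q) $$ (p, q)" .
qed auto

lemma plane_mat_cong:
  "(\<And>b p q. b < m \<Longrightarrow> p < 2 \<Longrightarrow> q < 2 \<Longrightarrow> f b p q = g b p q) \<Longrightarrow> plane_mat m f = plane_mat m g"
  by (intro eq_matI) auto

text \<open>The matrix with eigenvalue \<open>x\<close> on the isotropic line of (1, i) and
  \<open>y\<close> on that of (1, -i).\<close>

definition rot :: "complex fls \<Rightarrow> complex fls \<Rightarrow> nat \<Rightarrow> nat \<Rightarrow> complex fls" where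
  "rot x y p q = (if p = q then fls_const (1/2) * (x + y)
     else if p < q then fls_const (1/(2*\<i>)) * (x - y) else - (fls_const (1/(2*\<i>)) * (x - y)))"

text \<open>The minus signs on the planes up to \<open>j\<close> come from t * (-t) = -t^2.\<close>

definition nblock :: "nat \<Rightarrow> nat \<Rightarrow> nat \<Rightarrow> nat \<Rightarrow> complex fls" where
  "nblock j b p q = (if b = 0 then (if p = q then (-1)^j else 0)
     else if b \<le> j then rot (- fls_X_intpow 2) (- fls_X_intpow (-2)) p q
     else if p = q then 1 else 0)"

definition nmat :: "nat \<Rightarrow> nat \<Rightarrow> complex fls mat" where
  "nmat m j = plane_mat m (nblock j)"

lemma fls_const_half: "fls_const (1/2 :: complex) + fls_const (1/2) = 1"
  by (simp add: fls_plus_const)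

lemma rot_mult:
  assumes "p < 2" "q < 2"
  shows "rot x y p 0 * rot x' y' 0 q + rot x y p 1 * rot x' y' 1 q = rot (x * x') (y * y') p q"
proof -
  define h s where "h = fls_const (1/2 :: complex)" and "s = fls_const (1/(2*\<i>))"
  \<comment> \<open>The blocks are diagonal in one common basis, so eigenvalues multiply. Only these
    three relations between 1/2 and 1/(2i) enter, and keeping both constants abstract leaves pure
    ring identities.\<close>
  have hs: "s * s = - (h * h)" "h * h + h * h = h" "s * h + s * h = s"
    unfolding h_def s_def fls_const_mult_const fls_plus_const by simp_all
  have "h * (x + y) * (h * (x' + y')) - s * (x - y) * (s * (x' - y'))
      = (h * h) * ((x + y) * (x' + y')) - (s * s) * ((x - y) * (x' - y'))" by (simp only: mult_ac)
  also have "\<dots> = (h * h + h * h) * (x * x' + y * y')" unfolding hs(1) by (simp add: algebra_simps)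
  finally have 1: "h * (x + y) * (h * (x' + y')) - s * (x - y) * (s * (x' - y')) = h * (x * x' + y * y')"
    unfolding hs(2) .
  have "h * (x + y) * (s * (x' - y')) + s * (x - y) * (h * (x' + y')) = (s * h + s * h) * (x * x' - y * y')"
    by (simp add: algebra_simps)
  then have 2: "h * (x + y) * (s * (x' - y')) + s * (x - y) * (h * (x' + y')) = s * (x * x' - y * y')"
    unfolding hs(3) .
  have "p = 0 \<or> p = 1" "q = 0 \<or> q = 1" using assms by auto
  moreover have r: "rot x y 0 0 = h * (x + y)" "rot x y 1 1 = h * (x + y)"
      "rot x y 0 1 = s * (x - y)" "rot x y 1 0 = - (s * (x - y))" for x y
    by (simp_all add: rot_def h_def s_def)
  ultimately show ?thesis
    unfolding One_nat_def[symmetric]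
    using 1 2 by (elim disjE) (simp_all only: r, simp_all add: algebra_simps)
qed

lemma rot_1: "rot 1 1 p q = (if p = q then 1 else 0)" "rot (-1) (-1) p q = (if p = q then -1 else 0)"
  using fls_const_half by (auto simp: rot_def mult.commute[of _ 2])

lemma t_pow_eq:
  "t_pow l lam = plane_mat (l+1) (\<lambda>b. let m = lam (if b = 0 then l + 1 else b) in rot (fls_X_intpow m) (fls_X_intpow (-m)))"
proof (rule eq_matI)
  fix p q assume "p < dim_row (plane_mat (l+1) (\<lambda>b. let m = lam (if b = 0 then l + 1 else b) in rot (fls_X_intpow m) (fls_X_intpow (-m))))"
     "q < dim_col (plane_mat (l+1) (\<lambda>b. let m = lam (if b = 0 then l + 1 else b) in rot (fls_X_intpow m) (fls_X_intpow (-m))))"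
  then have pq: "p < 2*(l+1)" "q < 2*(l+1)" by auto
  have c: "p mod 2 = q mod 2 \<longleftrightarrow> p = q" "p mod 2 < q mod 2 \<longleftrightarrow> p < q" if "p div 2 = q div 2"
    using that mult_div_mod_eq[of 2 p] mult_div_mod_eq[of 2 q] by (metis, linarith)
  have t: "t_pow l lam $$ (p, q) = (let m = lam (if p div 2 = 0 then l + 1 else p div 2);
         c = fls_const (1/2) * (fls_X_intpow m + fls_X_intpow (-m));
         s = fls_const (1/(2*\<i>)) * (fls_X_intpow m - fls_X_intpow (-m))
     in if p div 2 \<noteq> q div 2 then 0 else if p = q then c else if p < q then s else - s)"
    unfolding t_pow_def using pq by simp
  show "t_pow l lam $$ (p, q) = plane_mat (l+1) (\<lambda>b. let m = lam (if b = 0 then l + 1 else b) in rot (fls_X_intpow m) (fls_X_intpow (-m))) $$ (p, q)"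
    unfolding t plane_mat_index[OF pq] rot_def Let_def using c by simp
qed (auto simp: t_pow_def)

lemma neg_t_rot: "neg_t (rot x y p q) = rot (neg_t x) (neg_t y) p q"
  by (simp add: rot_def)

text \<open>
  Conjugation by \<open>w0\<close> inverts the rotations of plane \<open>0\<close>. Therefore \<open>n_pow\<close> has only the sign
  \<open>(-1)^m\<close> there, whose exponent has the parity of \<open>j\<close> since \<open>lam\<close> is a cocharacter of the spin group.
\<close>

lemma rot_twist: "p < 2 \<Longrightarrow> q < 2 \<Longrightarrow>
  (if p = 0 then - 1 else 1) * (if q = 0 then - 1 else 1) * rot x y p q = rot y x p q"
  by (cases "p = 0"; cases "q = 0") (auto simp: rot_def right_diff_distrib)

lemma sigma_t_pow:
  "sigma l (t_pow l lam) = plane_mat (l+1) (\<lambda>b. let m = lam (if b = 0 then l + 1 else b) in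
     if b = 0 then rot (neg_t (fls_X_intpow (-m))) (neg_t (fls_X_intpow m))
     else rot (neg_t (fls_X_intpow m)) (neg_t (fls_X_intpow (-m))))" (is "_ = plane_mat _ ?f")
proof (rule eq_matI)
  fix p q assume "p < dim_row (plane_mat (l+1) ?f)" "q < dim_col (plane_mat (l+1) ?f)"
  then have pq: "p < 2*l+2" "q < 2*l+2" by auto
  have c: "map_mat neg_t (t_pow l lam) \<in> carrier_mat (2*l+2) (2*l+2)" by (simp add: t_pow_def)
  \<comment> \<open>Index 0 is position 0 of plane 0, so the signs of \<open>w0\<close> matter
    inside that plane only, where \<open>rot_twist\<close> applies.\<close>
  have z: "p = 0 \<longleftrightarrow> p div 2 = 0 \<and> p mod 2 = 0" "q = 0 \<longleftrightarrow> q div 2 = 0 \<and> q mod 2 = 0"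
    by presburger+
  have "sigma l (t_pow l lam) $$ (p, q)
      = (if p = 0 then -1 else 1) * (if q = 0 then -1 else 1) * neg_t (t_pow l lam $$ (p, q))"
    unfolding sigma_def w0_conj_index[OF c pq] using pq by (simp add: t_pow_def)
  also have "\<dots> = plane_mat (l+1) ?f $$ (p, q)"
    using pq rot_twist[of "p mod 2" "q mod 2"] unfolding z
    by (auto simp: t_pow_eq neg_t_rot Let_def)
  finally show "sigma l (t_pow l lam) $$ (p, q) = plane_mat (l+1) ?f $$ (p, q)" .
next
  have "w0 l * map_mat neg_t (t_pow l lam) * w0 l \<in> carrier_mat (2*l+2) (2*l+2)"
    using mult_carrier_mat[OF mult_carrier_mat[OF w0_carrier, of "map_mat neg_t (t_pow l lam)"] w0_carrier, of l]
    by (simp add: t_pow_def)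
  then show "dim_row (sigma l (t_pow l lam)) = dim_row (plane_mat (l+1) ?f)"
     "dim_col (sigma l (t_pow l lam)) = dim_col (plane_mat (l+1) ?f)"
    unfolding sigma_def by auto
qed

lemma n_pow_eq:
  assumes l: "1 \<le> l" and lam: "lam \<in> spin_cochars l" and j: "coinv_class l lam = ones j" "j \<le> l"
  shows "n_pow l lam = nmat (l+1) j"
proof -
  have v: "lam k = (if k \<le> j then 1 else 0)" if "1 \<le> k" "k \<le> l" for k
    using fun_cong[OF j(1), of k] that by (simp add: coinv_class_def ones_def)
  have "(\<Sum>k=1..l. lam k) = (\<Sum>k=1..l. if k \<in> {1..j} then 1 else 0)" using v by (intro sum.cong) auto
  also have "\<dots> = (\<Sum>k\<in>{1..l} \<inter> {1..j}. 1)" by (rule sum.inter_restrict[symmetric]) simp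
  also have "{1..l} \<inter> {1..j} = {1..j}" using j(2) by auto
  finally have s: "(\<Sum>k=1..l. lam k) = int j" by simp
  have "even (\<Sum>k=1..l+1. lam k)" using lam unfolding spin_cochars_iff[OF l] by blast
  then have par: "even (lam (l+1)) \<longleftrightarrow> even j" using s by simp
  define X :: "int \<Rightarrow> complex fls" where "X m = fls_X_intpow m" for m
  have X2: "X a * neg_t (X b) = (if even b then X (a+b) else - X (a+b))" for a b
    unfolding X_def neg_t_X_intpow by (simp add: fls_X_intpow_times_fls_X_intpow)
  have X0: "X 0 = 1" by (simp add: X_def)
  show ?thesis
    unfolding n_pow_def nmat_def sigma_t_pow[folded X_def]
    unfolding t_pow_eq[folded X_def] plane_mat_mult Let_def
  proof (rule plane_mat_cong)
    fix b p q :: nat assume b: "b < l + 1" and pq: "p < 2" "q < 2"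
    define m where "m = lam (if b = 0 then l + 1 else b)"
    show "rot (X (lam (if b = 0 then l + 1 else b))) (X (- lam (if b = 0 then l + 1 else b))) p 0 *
        (if b = 0 then rot (neg_t (X (- lam (if b = 0 then l + 1 else b)))) (neg_t (X (lam (if b = 0 then l + 1 else b))))
         else rot (neg_t (X (lam (if b = 0 then l + 1 else b)))) (neg_t (X (- lam (if b = 0 then l + 1 else b))))) 0 q +
        rot (X (lam (if b = 0 then l + 1 else b))) (X (- lam (if b = 0 then l + 1 else b))) p 1 *
        (if b = 0 then rot (neg_t (X (- lam (if b = 0 then l + 1 else b)))) (neg_t (X (lam (if b = 0 then l + 1 else b))))
         else rot (neg_t (X (lam (if b = 0 then l + 1 else b)))) (neg_t (X (- lam (if b = 0 then l + 1 else b))))) 1 q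
        = nblock j b p q"
      unfolding m_def[symmetric]
    proof (cases "b = 0")
      case True
      then have "even m \<longleftrightarrow> even j" using par by (simp add: m_def)
      then show "rot (X m) (X (- m)) p 0 * (if b = 0 then rot (neg_t (X (- m))) (neg_t (X m)) else rot (neg_t (X m)) (neg_t (X (- m)))) 0 q +
          rot (X m) (X (- m)) p 1 * (if b = 0 then rot (neg_t (X (- m))) (neg_t (X m)) else rot (neg_t (X m)) (neg_t (X (- m)))) 1 q = nblock j b p q"
        unfolding if_P[OF True] rot_mult[OF pq] X2 using True by (simp add: X0 rot_1 nblock_def)
    next
      case False
      then have "m = (if b \<le> j then 1 else 0)" using v[of b] b by (simp add: m_def)
      then show "rot (X m) (X (- m)) p 0 * (if b = 0 then rot (neg_t (X (- m))) (neg_t (X m)) else rot (neg_t (X m)) (neg_t (X (- m)))) 0 q +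
          rot (X m) (X (- m)) p 1 * (if b = 0 then rot (neg_t (X (- m))) (neg_t (X m)) else rot (neg_t (X m)) (neg_t (X (- m)))) 1 q = nblock j b p q"
        unfolding if_not_P[OF False] rot_mult[OF pq] X2 using False
        by (cases "b \<le> j") (simp_all add: X0 rot_1 nblock_def, simp add: X_def)
    qed
  qed
qed

section \<open>The shape of the loops in a double coset\<close>

definition xmat :: "nat \<Rightarrow> (nat \<Rightarrow> complex) \<Rightarrow> complex mat" where
  "xmat n v = mat n n (\<lambda>(p, q). (if p = 0 then v q else 0) - (if q = 0 then v p else 0))"

text \<open>Bilinear, without conjugation: nonzero isotropic vectors exist.\<close>

definition dot :: "nat \<Rightarrow> (nat \<Rightarrow> complex) \<Rightarrow> (nat \<Rightarrow> complex) \<Rightarrow> complex" where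
  "dot n a b = (\<Sum>i<n. a i * b i)"

lemma xmat_carrier [simp]: "xmat n v \<in> carrier_mat n n"
  and xmat_index [simp]: "p < n \<Longrightarrow> q < n \<Longrightarrow> xmat n v $$ (p, q) = (if p = 0 then v q else 0) - (if q = 0 then v p else 0)"
  by (simp_all add: xmat_def)

lemma xmat_dim [simp]: "dim_row (xmat n v) = n" "dim_col (xmat n v) = n"
  by (simp_all add: xmat_def)

lemma square_mult_index:
  assumes "A \<in> carrier_mat n n" "B \<in> carrier_mat n n" "p < n" "q < n"
  shows "(A * B) $$ (p, q) = (\<Sum>i<n. A $$ (p, i) * B $$ (i, q))"
  using assms by (rule mult_index)

lemma xmat_square:
  assumes "v 0 = 0" "p < n" "q < n"
  shows "(xmat n v * xmat n v) $$ (p, q) = (if p = 0 \<and> q = 0 then - dot n v v else - (v p * v q))"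
proof -
  have "(xmat n v * xmat n v) $$ (p, q) = (\<Sum>i<n. xmat n v $$ (p, i) * xmat n v $$ (i, q))"
    using assms(2,3) by (intro square_mult_index) simp_all
  also have "\<dots> = (\<Sum>i<n. (if p = 0 \<and> q = 0 then - (v i * v i) else 0) + (if i = 0 then - (v p * v q) else 0))"
    using assms by (intro sum.cong) auto
  also have "\<dots> = (if p = 0 \<and> q = 0 then - dot n v v else - (v p * v q))"
    using assms by (simp add: sum.distrib dot_def sum_negf)
  finally show ?thesis .
qed

text \<open>Makes every odd power of such a matrix a multiple of it by a power of -(v.v); nilpotency
  thus becomes isotropy of \<open>v\<close>.\<close>

lemma xmat_cube:
  assumes "v 0 = 0"
  shows "xmat n v * xmat n v * xmat n v = (- dot n v v) \<cdot>\<^sub>m xmat n v"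
proof (rule eq_matI)
  fix p q assume "p < dim_row ((- dot n v v) \<cdot>\<^sub>m xmat n v)" "q < dim_col ((- dot n v v) \<cdot>\<^sub>m xmat n v)"
  then have pq: "p < n" "q < n" by (auto simp: xmat_def)
  have "(xmat n v * xmat n v * xmat n v) $$ (p, q)
      = (\<Sum>i<n. (xmat n v * xmat n v) $$ (p, i) * xmat n v $$ (i, q))"
    using pq by (intro square_mult_index mult_carrier_mat[of _ n n _ n]) simp_all
  also have "\<dots> = (\<Sum>i<n. (if i = 0 then (if p = 0 then - dot n v v * v q else 0) else 0)
      + (if q = 0 then v p * (v i * v i) else 0))"
    using pq assms by (intro sum.cong) (auto simp: xmat_square)
  also have "\<dots> = (if p = 0 then - dot n v v * v q else 0) + (if q = 0 then v p * dot n v v else 0)"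
    using pq by (auto simp: sum.distrib dot_def sum_distrib_left)
  also have "\<dots> = ((- dot n v v) \<cdot>\<^sub>m xmat n v) $$ (p, q)"
    using pq by (simp add: algebra_simps)
  finally show "(xmat n v * xmat n v * xmat n v) $$ (p, q) = ((- dot n v v) \<cdot>\<^sub>m xmat n v) $$ (p, q)" .
qed (auto simp: xmat_def)

text \<open>Conjugation by \<open>w0\<close> changes the sign exactly of the entries mixing index 0
  with the others, and skewness ties column 0 to row 0. Since \<open>v 0\<close> cancels in
  \<open>xmat\<close>, setting it to zero is a normalization under which \<open>dot\<close> measures
  the remaining coordinates.\<close>

lemma p_space_iff: "x \<in> p_space l \<longleftrightarrow> (\<exists>v. v 0 = 0 \<and> x = xmat (2*l+2) v)"
proof
  let ?n = "2*l+2"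
  assume "x \<in> p_space l"
  then have x: "x \<in> carrier_mat ?n ?n" "transpose_mat x = - x" "w0 l * x * w0 l = - x"
    by (auto simp: p_space_def so_alg_def)
  have skew: "x $$ (q, p) = - x $$ (p, q)" if "p < ?n" "q < ?n" for p q
    using arg_cong[OF x(2), of "\<lambda>y. y $$ (p, q)"] that x(1) by simp
  have par: "x $$ (p, q) = 0" if "p < ?n" "q < ?n" "(p = 0) = (q = 0)" for p q
    using arg_cong[OF x(3), of "\<lambda>y. y $$ (p, q)"] that x(1) w0_conj_index[OF x(1) that(1,2)] by auto
  define v where "v q = (if q = 0 then 0 else x $$ (0, q))" for q
  have "x = xmat ?n v"
  proof (rule eq_matI)
    fix p q assume "p < dim_row (xmat ?n v)" "q < dim_col (xmat ?n v)"
    then have pq: "p < ?n" "q < ?n" by (auto simp: xmat_def)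
    then show "x $$ (p, q) = xmat ?n v $$ (p, q)"
      using par[OF pq] skew[of 0 p] by (auto simp: v_def)
  qed (use x(1) in \<open>auto simp: xmat_def\<close>)
  then show "\<exists>v. v 0 = 0 \<and> x = xmat ?n v" using v_def[of 0] by auto
next
  let ?n = "2*l+2"
  assume "\<exists>v. v 0 = 0 \<and> x = xmat ?n v"
  then obtain v where v: "v 0 = 0" "x = xmat ?n v" by blast
  have c: "w0 l * xmat ?n v * w0 l \<in> carrier_mat ?n ?n"
    by (meson mult_carrier_mat w0_carrier xmat_carrier)
  have "transpose_mat x = - x" unfolding v(2) by (rule eq_matI) (auto simp: xmat_def)
  moreover have "w0 l * x * w0 l = - x" unfolding v(2)
  proof (rule eq_matI)
    fix p q assume "p < dim_row (- xmat ?n v)" "q < dim_col (- xmat ?n v)"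
    then have pq: "p < ?n" "q < ?n" by (auto simp: xmat_def)
    then show "(w0 l * xmat ?n v * w0 l) $$ (p, q) = (- xmat ?n v) $$ (p, q)"
      unfolding w0_conj_index[OF xmat_carrier pq] using pq v(1) carrier_matD[OF xmat_carrier[of ?n v]] by auto
  qed (use carrier_matD[OF c] in \<open>simp_all add: xmat_def\<close>)
  ultimately show "x \<in> p_space l" using v(2) by (simp add: p_space_def so_alg_def)
qed

lemma nilp_p_iff: "x \<in> nilp_p l \<longleftrightarrow> (\<exists>v. v 0 = 0 \<and> dot (2*l+2) v v = 0 \<and> x = xmat (2*l+2) v)"
proof
  let ?n = "2*l+2"
  assume "x \<in> nilp_p l"
  then obtain v k where v: "v 0 = 0" "x = xmat ?n v" and k: "x ^\<^sub>m k = 0\<^sub>m ?n ?n"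
    unfolding nilp_p_def p_space_iff by blast
  let ?c = "- dot ?n v v"
  have c: "x \<in> carrier_mat ?n ?n" using v by simp
  have xx: "x ^\<^sub>m k * x * x = x ^\<^sub>m k * (x * x)" for k
    using c by (simp add: assoc_mult_mat[of _ ?n ?n _ ?n _ ?n])
  have pw: "x ^\<^sub>m (Suc (2*k)) = (?c ^ k) \<cdot>\<^sub>m x" for k
  proof (induction k)
    case 0
    show ?case using c by (intro eq_matI) auto
  next
    case (Suc k)
    have "x ^\<^sub>m (Suc (2 * Suc k)) = x ^\<^sub>m (Suc (2*k)) * x * x" by (simp add: add_2_eq_Suc)
    also have "\<dots> = (?c ^ k) \<cdot>\<^sub>m (x * x * x)"
      unfolding Suc.IH using c by (simp add: mult_smult_assoc_mat[of _ ?n ?n _ ?n])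
    also have "\<dots> = (?c ^ Suc k) \<cdot>\<^sub>m x"
      unfolding v(2) xmat_cube[of v, OF v(1)] by (rule eq_matI) (auto simp: xmat_def)
    finally show ?case .
  qed
  \<comment> \<open>Moves from the given vanishing power to an odd exponent at least as large, to
    which \<open>pw\<close> applies.\<close>
  have "x ^\<^sub>m (Suc (2*k)) = 0\<^sub>m ?n ?n"
  proof -
    have "x ^\<^sub>m (k + m) = 0\<^sub>m ?n ?n" for m
    proof (induction m)
      case (Suc m)
      then show ?case using left_mult_zero_mat[OF c, of ?n] by simp
    qed (simp add: k)
    moreover have "Suc (2*k) = k + Suc k" by simp
    ultimately show ?thesis by metis
  qed
  then have z: "(?c ^ k) \<cdot>\<^sub>m x = 0\<^sub>m ?n ?n" using pw by simp
  have "dot ?n v v = 0"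
  proof (rule ccontr)
    assume n: "dot ?n v v \<noteq> 0"
    have "v q = 0" if "q < ?n" for q
    proof -
      have "((?c ^ k) \<cdot>\<^sub>m x) $$ (0, q) = ?c ^ k * x $$ (0, q)" using c that by simp
      then have "?c ^ k * x $$ (0, q) = 0" using z that by simp
      then have "x $$ (0, q) = 0" using n by simp
      then show ?thesis using that v by (simp split: if_splits)
    qed
    then show False using n by (simp add: dot_def)
  qed
  then show "\<exists>v. v 0 = 0 \<and> dot ?n v v = 0 \<and> x = xmat ?n v" using v by blast
next
  let ?n = "2*l+2"
  assume "\<exists>v. v 0 = 0 \<and> dot ?n v v = 0 \<and> x = xmat ?n v"
  then obtain v where v: "v 0 = 0" "dot ?n v v = 0" "x = xmat ?n v" by blast
  have "x * x * x = 0\<^sub>m ?n ?n" unfolding v(3) xmat_cube[of v, OF v(1)] v(2) by (intro eq_matI) auto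
  then have "x ^\<^sub>m 3 = 0\<^sub>m ?n ?n"
    using v(3) by (simp add: numeral_3_eq_3 del: assoc_mult_mat)
  moreover have "x \<in> p_space l" using v unfolding p_space_iff by blast
  ultimately show "x \<in> nilp_p l" unfolding nilp_p_def by blast
qed

section \<open>The coefficients of a loop 1 + x t^-1 + y t^-2\<close>

lemma nth_mult_short:
  fixes f g :: "complex fls"
  assumes "\<And>k. k < -2 \<or> k > 0 \<Longrightarrow> fls_nth f k = 0"
  shows "fls_nth (f * g) k = fls_nth f 0 * fls_nth g k + fls_nth f (-1) * fls_nth g (k+1) + fls_nth f (-2) * fls_nth g (k+2)"
proof -
  have "f = fls_const (fls_nth f 0) + fls_const (fls_nth f (-1)) * fls_X_intpow (-1) + fls_const (fls_nth f (-2)) * fls_X_intpow (-2)"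
  proof (rule fls_eqI)
    fix m :: int
    consider "m = 0" | "m = -1" | "m = -2" | "m < -2 \<or> m > 0" by linarith
    then show "fls_nth f m = fls_nth (fls_const (fls_nth f 0) + fls_const (fls_nth f (-1)) * fls_X_intpow (-1) + fls_const (fls_nth f (-2)) * fls_X_intpow (-2)) m"
      using assms[of m] by cases (auto simp: fls_X_intpow_times_conv_shift)
  qed
  then have "f * g = fls_const (fls_nth f 0) * g + fls_const (fls_nth f (-1)) * (fls_X_intpow (-1) * g) + fls_const (fls_nth f (-2)) * (fls_X_intpow (-2) * g)"
    by (metis (no_types, lifting) distrib_right mult.assoc)
  then show ?thesis
    using fls_X_intpow_times_conv_shift(1)[of "-1" g] fls_X_intpow_times_conv_shift(1)[of "-2" g] by simp
qed

text \<open>The coefficients of t^-1, t^-2 and t^-4 in \<open>transpose g * g = 1\<close> give, in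
  this order, that x is skew, that y + y^T equals -x^T x, and that y has zero entry at (0,
  0).\<close>

lemma short_loop_coeffs:
  assumes g: "g \<in> GOminus0 l" and s: "\<And>p q. p < 2*l+2 \<Longrightarrow> q < 2*l+2 \<Longrightarrow> ord_ge (-2) (g $$ (p, q))"
  obtains v where "v 0 = 0" "dot (2*l+2) v v = 0" "coeff_mat (-1) g = xmat (2*l+2) v"
    "\<And>p q. p < 2*l+2 \<Longrightarrow> q < 2*l+2 \<Longrightarrow>
      coeff_mat (-2) g $$ (p, q) + coeff_mat (-2) g $$ (q, p) = - (v p * v q)"
proof -
  let ?n = "2*l+2"
  let ?x = "\<lambda>p q. fls_nth (g $$ (p, q)) (-1)" and ?y = "\<lambda>p q. fls_nth (g $$ (p, q)) (-2)"
  have t: "g \<in> torth True ?n" and d: "\<And>p q. p < ?n \<Longrightarrow> q < ?n \<Longrightarrow> deg_le 0 (g $$ (p, q))"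
    using g unfolding GOminus0_def GOminus_iff by auto
  note c = torth_carrier[OF t]
  have short: "fls_nth (g $$ (p, q)) k = 0" if "p < ?n" "q < ?n" "k < -2 \<or> k > 0" for p q k
    using s[OF that(1,2)] d[OF that(1,2)] that(3) unfolding ord_ge_def deg_le_def by auto
  have g0: "fls_nth (g $$ (p, q)) 0 = (if p = q then 1 else 0)" if "p < ?n" "q < ?n" for p q
  proof -
    have "coeff_mat 0 g $$ (p, q) = 1\<^sub>m ?n $$ (p, q)" using g by (simp add: GOminus0_def)
    then show ?thesis using that c by (simp add: coeff_mat_def)
  qed
  have par: "fls_nth (g $$ (p, q)) k = 0" if "p < ?n" "q < ?n" "((p = 0) = (q = 0)) \<noteq> even k" for p q k
  proof -
    have "neg_t (g $$ (p, q)) = (if (p = 0) = (q = 0) then g $$ (p, q) else - (g $$ (p, q)))"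
      unfolding torth_neg_t[OF t that(1,2)] by (simp add: tsgn_def)
    from arg_cong[OF this, of "\<lambda>f. fls_nth f k"] show ?thesis
      using that(3) by (auto simp: neg_t_nth)
  qed
  have prod: "(\<Sum>i<?n. fls_nth (g $$ (i, p) * g $$ (i, q)) k) = (if p = q \<and> k = 0 then 1 else 0)"
    if "p < ?n" "q < ?n" for p q k
  proof -
    have "(\<Sum>i<?n. fls_nth (g $$ (i, p) * g $$ (i, q)) k) = fls_nth (\<Sum>i<?n. g $$ (i, p) * g $$ (i, q)) k"
      by (rule fls_nth_sum[symmetric])
    also have "\<dots> = (if p = q \<and> k = 0 then 1 else 0)"
      unfolding mat_inverse_index[OF torth_inverse[OF t] c that] by simp
    finally show ?thesis .
  qed
  have prod': "(\<Sum>i<?n. (if i = p then fls_nth (g $$ (p, q)) k else 0) + ?x i p * fls_nth (g $$ (i, q)) (k+1)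
      + ?y i p * fls_nth (g $$ (i, q)) (k+2)) = (if p = q \<and> k = 0 then 1 else 0)"
    if pq: "p < ?n" "q < ?n" for p q k
    unfolding prod[OF pq, symmetric]
  proof (intro sum.cong refl)
    fix i assume "i \<in> {..<?n}"
    then have i: "i < ?n" by simp
    show "(if i = p then fls_nth (g $$ (p, q)) k else 0) + ?x i p * fls_nth (g $$ (i, q)) (k+1)
      + ?y i p * fls_nth (g $$ (i, q)) (k+2) = fls_nth (g $$ (i, p) * g $$ (i, q)) k"
      using nth_mult_short[of "g $$ (i, p)" "g $$ (i, q)" k, OF short[OF i pq(1)]] g0[OF i pq(1)] by simp
  qed
  have skew: "?x p q + ?x q p = 0" if pq: "p < ?n" "q < ?n" for p q
  proof -
    have "?x p q + ?x q p = (\<Sum>i<?n. (if i = p then ?x p q else 0) + (if i = q then ?x q p else 0))"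
      using pq by (simp add: sum.distrib)
    also have "\<dots> = (\<Sum>i<?n. (if i = p then ?x p q else 0) + ?x i p * fls_nth (g $$ (i, q)) (-1+1)
      + ?y i p * fls_nth (g $$ (i, q)) (-1+2))"
      using pq short[OF _ pq(2), of _ 1] g0[OF _ pq(2)] by (intro sum.cong) auto
    also have "\<dots> = 0" using prod'[OF pq, of "-1"] by simp
    finally show ?thesis .
  qed
  have ysym: "?y p q + ?y q p = - (\<Sum>i<?n. ?x i p * ?x i q)" if pq: "p < ?n" "q < ?n" for p q
  proof -
    have "?y p q + (\<Sum>i<?n. ?x i p * ?x i q) + ?y q p
       = (\<Sum>i<?n. (if i = p then ?y p q else 0) + ?x i p * ?x i q + (if i = q then ?y q p else 0))"
      using pq by (simp add: sum.distrib)
    also have "\<dots> = (\<Sum>i<?n. (if i = p then ?y p q else 0) + ?x i p * fls_nth (g $$ (i, q)) (-2+1)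
      + ?y i p * fls_nth (g $$ (i, q)) (-2+2))"
      using pq g0[OF _ pq(2)] by (intro sum.cong) auto
    also have "\<dots> = 0" using prod'[OF pq, of "-2"] by simp
    finally show ?thesis by (simp add: algebra_simps eq_neg_iff_add_eq_0)
  qed
  \<comment> \<open>By parity column 0 of y has no entry outside row 0, and no coefficient lies
    below t^-2; so the t^-4 coefficient at (0, 0) is the square of y_00. Then \<open>ysym\<close> at
    (0, 0) yields v.v = 0.\<close>
  have "(\<Sum>i<?n. if i = 0 then ?y 0 0 * ?y 0 0 else 0)
      = (\<Sum>i<?n. (if i = 0 then fls_nth (g $$ (0, 0)) (-4) else 0) + ?x i 0 * fls_nth (g $$ (i, 0)) (-4+1)
      + ?y i 0 * fls_nth (g $$ (i, 0)) (-4+2))"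
    using short[of _ 0 "-3"] short[of _ 0 "-4"] par[of _ 0 "-2"] by (intro sum.cong) auto
  also have "\<dots> = 0" using prod'[of 0 0 "-4"] by simp
  finally have y00: "?y 0 0 = 0" by simp
  define v where "v q = (if q = 0 then 0 else ?x 0 q)" for q
  have v0: "v 0 = 0" by (simp add: v_def)
  have x: "?x p q = (if p = 0 then v q else 0) - (if q = 0 then v p else 0)" if pq: "p < ?n" "q < ?n" for p q
    using par[OF pq, of "-1"] skew[OF pq] by (auto simp: v_def eq_neg_iff_add_eq_0 add.commute)
  have xx: "(\<Sum>i<?n. ?x i p * ?x i q) = (if p = 0 \<and> q = 0 then dot ?n v v else v p * v q)"
    if pq: "p < ?n" "q < ?n" for p q
  proof -
    have "(\<Sum>i<?n. ?x i p * ?x i q) = (\<Sum>i<?n. (if p = 0 \<and> q = 0 then v i * v i else 0) + (if i = 0 then v p * v q else 0))"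
      using pq v0 x by (intro sum.cong) auto
    then show ?thesis using v0 by (simp add: sum.distrib dot_def)
  qed
  show thesis
  proof
    show "v 0 = 0" by (rule v0)
    show dv: "dot ?n v v = 0" using ysym[of 0 0] xx[of 0 0] y00 by simp
    show "coeff_mat (-1) g = xmat ?n v"
      using c x by (intro eq_matI) (auto simp: coeff_mat_def xmat_def)
    show "coeff_mat (-2) g $$ (p, q) + coeff_mat (-2) g $$ (q, p) = - (v p * v q)" if pq: "p < ?n" "q < ?n" for p q
      using ysym[OF pq] xx[OF pq] dv v0 pq c by (auto simp: coeff_mat_def)
  qed
qed

text \<open>
  The square matrix \<open>V * transpose U'\<close> of size \<open>j\<close> is skew and has the inverse \<open>transpose U * V'\<close>.
\<close>

lemma skew_factorization_even:
  fixes U V :: "complex mat"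
  assumes U: "U \<in> carrier_mat n j" and V: "V \<in> carrier_mat j n"
    and U': "U' \<in> carrier_mat j n" "U' * U = 1\<^sub>m j" and V': "V' \<in> carrier_mat n j" "V * V' = 1\<^sub>m j"
    and skew: "transpose_mat (U * V) = - (U * V)"
  shows "even j"
proof (rule ccontr)
  assume odd: "odd j"
  define B C where "B = V * transpose_mat U'" and "C = transpose_mat U * V'"
  note c = U V U'(1) V'(1)
  have cT: "transpose_mat U \<in> carrier_mat j n" "transpose_mat U' \<in> carrier_mat n j" "transpose_mat V \<in> carrier_mat n j"
    using c by simp_all
  have B: "B \<in> carrier_mat j j" and C: "C \<in> carrier_mat j j"
    unfolding B_def C_def by (rule mult_carrier_mat[OF V cT(2)], rule mult_carrier_mat[OF cT(1) V'(1)])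
  define W where "W = transpose_mat V * transpose_mat U"
  have W: "W \<in> carrier_mat n n" unfolding W_def by (rule mult_carrier_mat[OF cT(3,1)])
  have BT: "transpose_mat B = U' * transpose_mat V"
    unfolding B_def transpose_mult[OF V cT(2)] by simp
  \<comment> \<open>Skewness turns V = U' (U V) into -B^T U^T. Multiplying this on the right by U'^T
    shows that B is skew, and multiplying by V' that it is invertible.\<close>
  have "V = U' * U * V" unfolding U'(2) using V by simp
  also have "\<dots> = U' * (U * V)" by (rule assoc_mult_mat[OF U'(1) U V])
  also have "U * V = - W" unfolding W_def transpose_mult[OF U V, symmetric] skew by simp
  also have "U' * (- W) = - (U' * W)" using c W by simp
  also have "U' * W = transpose_mat B * transpose_mat U"
    unfolding W_def BT by (rule assoc_mult_mat[OF U'(1) cT(3,1), symmetric])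
  finally have V2: "V = - (transpose_mat B * transpose_mat U)" .
  have BtU: "transpose_mat B * transpose_mat U \<in> carrier_mat j n" using B cT by (intro mult_carrier_mat) auto
  have "V * transpose_mat U' = - (transpose_mat B * transpose_mat U) * transpose_mat U'"
    by (rule arg_cong[OF V2, of "\<lambda>X. X * transpose_mat U'"])
  then have "B = - (transpose_mat B * transpose_mat U) * transpose_mat U'"
    unfolding B_def[symmetric] .
  also have "\<dots> = - (transpose_mat B * transpose_mat U * transpose_mat U')" using BtU cT by simp
  also have "transpose_mat B * transpose_mat U * transpose_mat U' = transpose_mat B * (transpose_mat U * transpose_mat U')"
    using B cT by (intro assoc_mult_mat) auto
  also have "transpose_mat U * transpose_mat U' = 1\<^sub>m j"
    unfolding transpose_mult[OF U'(1) U, symmetric] U'(2) by simp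
  finally have BB: "B = - transpose_mat B" using B by simp
  have "1\<^sub>m j = - (transpose_mat B * transpose_mat U) * V'"
    using arg_cong[OF V2, of "\<lambda>X. X * V'"] unfolding V'(2) .
  also have "\<dots> = - (transpose_mat B * transpose_mat U * V')" using BtU c by simp
  also have "transpose_mat B * transpose_mat U * V' = transpose_mat B * C"
    unfolding C_def using B cT c by (intro assoc_mult_mat) auto
  also have "- (transpose_mat B * C) = - transpose_mat B * C" using B C by simp
  also have "- transpose_mat B * C = B * C" by (rule arg_cong[OF BB[symmetric], of "\<lambda>X. X * C"])
  finally have "det B * det C = 1" using det_mult[OF B C] by (metis det_one)
  \<comment> \<open>A skew matrix of odd size has determinant zero.\<close>
  moreover have "det B = (-1) ^ j * det B"
  proof -
    have "- transpose_mat B = (-1) \<cdot>\<^sub>m transpose_mat B" by (intro eq_matI) auto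
    then have "det B = det ((-1) \<cdot>\<^sub>m transpose_mat B)" using BB by simp
    then show ?thesis using det_transpose[OF B] B by simp
  qed
  ultimately show False using odd by simp
qed

section \<open>The leading polar coefficient in a double coset\<close>

lemma ord_mult3:
  assumes "ord_ge 0 a" "ord_ge (-2) b" "ord_ge 0 c"
  shows "ord_ge (-2) (a * b * c)" "fls_nth (a * b * c) (-2) = fls_nth a 0 * fls_nth b (-2) * fls_nth c 0"
proof -
  have ab: "ord_ge (-2) (a * b)" using ord_ge_mult[OF assms(1,2)] by simp
  show "ord_ge (-2) (a * b * c)" using ord_ge_mult[OF ab assms(3)] by simp
  have "fls_nth (a * b * c) (-2 + 0) = fls_nth (a * b) (-2) * fls_nth c 0"
    by (rule nth_mult_ord_ge[OF ab assms(3)])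
  moreover have "fls_nth (a * b) (0 + -2) = fls_nth a 0 * fls_nth b (-2)"
    by (rule nth_mult_ord_ge[OF assms(1,2)])
  ultimately show "fls_nth (a * b * c) (-2) = fls_nth a 0 * fls_nth b (-2) * fls_nth c 0" by simp
qed

lemma neg_one_power_fls: "(-1) ^ j = (fls_const ((-1) ^ j) :: complex fls)"
  by (cases "even j") (auto simp: fls_const_uminus)

lemma nblock_ord: "ord_ge (-2) (nblock j b p q)"
  by (auto simp: ord_ge_def nblock_def rot_def neg_one_power_fls)

text \<open>Only the eigenvalue -t^-2 contributes, so the coefficient is minus the projector onto
  the line of (1, -i) along (1, i): the column (1, -i) times the row -(1, i)/2.\<close>

lemma nblock_nth:
  assumes "p < 2" "q < 2"
  shows "fls_nth (nblock j b p q) (-2) = (if 1 \<le> b \<and> b \<le> j then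
     (if p = 0 then 1 else -\<i>) * (-1/2 * (if q = 0 then 1 else \<i>)) else 0)"
proof -
  have "p = 0 \<or> p = 1" "q = 0 \<or> q = 1" using assms by auto
  then show ?thesis by (elim disjE; simp add: nblock_def rot_def neg_one_power_fls)
qed

text \<open>The shift from column b to plane b + 1 skips plane 0, on which the torus element is a
  sign without a pole.\<close>

definition iso_frame :: "nat \<Rightarrow> nat \<Rightarrow> complex \<Rightarrow> complex \<Rightarrow> complex mat" where
  "iso_frame m j x y = mat (2*m) j (\<lambda>(p, b). if p div 2 = b + 1 then (if even p then x else y) else 0)"

lemma iso_frame_carrier [simp]: "iso_frame m j x y \<in> carrier_mat (2*m) j"
  by (simp add: iso_frame_def)

lemma iso_frame_dual:
  assumes "j < m" "x * x' + y * y' = 1"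
  shows "transpose_mat (iso_frame m j x y) * iso_frame m j x' y' = 1\<^sub>m j"
proof (rule eq_matI)
  fix b c assume "b < dim_row (1\<^sub>m j)" "c < dim_col (1\<^sub>m j)"
  then have bc: "b < j" "c < j" by auto
  have "(transpose_mat (iso_frame m j x y) * iso_frame m j x' y') $$ (b, c)
      = (\<Sum>i<2*m. iso_frame m j x y $$ (i, b) * iso_frame m j x' y' $$ (i, c))"
    using bc mult_index[of "transpose_mat (iso_frame m j x y)" j "2*m" "iso_frame m j x' y'" j b c]
    by (simp add: iso_frame_def)
  also have "\<dots> = (\<Sum>d<m. if d = b + 1 then (if b = c then 1 else 0) else 0)"
    unfolding sum_planes using bc assms(2) by (intro sum.cong) (auto simp: iso_frame_def)
  also have "\<dots> = 1\<^sub>m j $$ (b, c)" using bc assms(1) by simp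
  finally show "(transpose_mat (iso_frame m j x y) * iso_frame m j x' y') $$ (b, c) = 1\<^sub>m j $$ (b, c)" .
qed (auto simp: iso_frame_def)

lemma nmat_polar_part:
  assumes "j < m"
  shows "coeff_mat (-2) (nmat m j) = iso_frame m j 1 (-\<i>) * transpose_mat (iso_frame m j (-1/2) (-\<i>/2))"
proof (rule eq_matI)
  fix p q assume "p < dim_row (iso_frame m j 1 (-\<i>) * transpose_mat (iso_frame m j (-1/2) (-\<i>/2)))"
    "q < dim_col (iso_frame m j 1 (-\<i>) * transpose_mat (iso_frame m j (-1/2) (-\<i>/2)))"
  then have pq: "p < 2*m" "q < 2*m" by (auto simp: iso_frame_def)
  have "(iso_frame m j 1 (-\<i>) * transpose_mat (iso_frame m j (-1/2) (-\<i>/2))) $$ (p, q)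
      = (\<Sum>b<j. iso_frame m j 1 (-\<i>) $$ (p, b) * iso_frame m j (-1/2) (-\<i>/2) $$ (q, b))"
    using pq mult_index[of "iso_frame m j 1 (-\<i>)" "2*m" j "transpose_mat (iso_frame m j (-1/2) (-\<i>/2))" "2*m" p q]
    by (simp add: iso_frame_def)
  \<comment> \<open>The subtraction truncates on plane 0, where it would wrongly select b = 0; the
    condition \<open>p div 2 \<noteq> 0\<close> excludes this.\<close>
  also have "\<dots> = (\<Sum>b<j. if b = p div 2 - 1 then (if p div 2 = q div 2 \<and> p div 2 \<noteq> 0 then
      (if even p then 1 else -\<i>) * (-1/2 * (if even q then 1 else \<i>)) else 0) else 0)"
    using pq by (intro sum.cong) (auto simp: iso_frame_def)
  also have "\<dots> = (if 1 \<le> p div 2 \<and> p div 2 \<le> j \<and> p div 2 = q div 2 then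
      (if even p then 1 else -\<i>) * (-1/2 * (if even q then 1 else \<i>)) else 0)"
    by auto
  finally have eq: "(iso_frame m j 1 (-\<i>) * transpose_mat (iso_frame m j (-1/2) (-\<i>/2))) $$ (p, q)
      = (if 1 \<le> p div 2 \<and> p div 2 \<le> j \<and> p div 2 = q div 2 then
      (if even p then 1 else -\<i>) * (-1/2 * (if even q then 1 else \<i>)) else 0)" .
  have if_conj: "(if 1 \<le> a \<and> a \<le> j \<and> a = b then X else 0) = (if a = b then if 1 \<le> a \<and> a \<le> j then X else 0 else 0)"
    for a b :: nat and X :: complex by simp
  note eq
  also have "(if 1 \<le> p div 2 \<and> p div 2 \<le> j \<and> p div 2 = q div 2 then
      (if even p then 1 else -\<i>) * (-1/2 * (if even q then 1 else \<i>)) else 0)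
       = (if p div 2 = q div 2 then fls_nth (nblock j (p div 2) (p mod 2) (q mod 2)) (-2) else 0)"
    unfolding nblock_nth[OF mod_less_divisor[OF pos2] mod_less_divisor[OF pos2]] even_iff_mod_2_eq_zero
    by (rule if_conj)
  also have "\<dots> = coeff_mat (-2) (nmat m j) $$ (p, q)"
    using pq by (cases "p div 2 = q div 2") (simp_all add: coeff_mat_def nmat_def)
  finally show "coeff_mat (-2) (nmat m j) $$ (p, q)
      = (iso_frame m j 1 (-\<i>) * transpose_mat (iso_frame m j (-1/2) (-\<i>/2))) $$ (p, q)" by simp
qed (auto simp: coeff_mat_def nmat_def iso_frame_def)

lemma torth_int_coeff_0:
  assumes "k \<in> torth_int t m"
  shows "coeff_mat 0 k \<in> carrier_mat m m" "transpose_mat (coeff_mat 0 k) * coeff_mat 0 k = 1\<^sub>m m"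
    "coeff_mat 0 k * transpose_mat (coeff_mat 0 k) = 1\<^sub>m m"
proof -
  note c = torth_int_carrier[OF assms]
  show c0: "coeff_mat 0 k \<in> carrier_mat m m" using c by (simp add: coeff_mat_def)
  show o: "transpose_mat (coeff_mat 0 k) * coeff_mat 0 k = 1\<^sub>m m"
  proof (rule eq_matI)
    fix p q assume "p < dim_row (1\<^sub>m m)" "q < dim_col (1\<^sub>m m)"
    then have pq: "p < m" "q < m" by auto
    have "(transpose_mat (coeff_mat 0 k) * coeff_mat 0 k) $$ (p, q)
        = (\<Sum>i<m. fls_nth (k $$ (i, p)) 0 * fls_nth (k $$ (i, q)) 0)"
      using c0 c pq square_mult_index[of "transpose_mat (coeff_mat 0 k)" m "coeff_mat 0 k" p q]
      by (simp add: coeff_mat_def)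
    also have "\<dots> = (\<Sum>i<m. fls_nth (k $$ (i, p) * k $$ (i, q)) 0)"
      using torth_int_ord[OF assms] pq nth_mult_ord_ge[of 0 _ 0] by (intro sum.cong) auto
    also have "\<dots> = fls_nth (\<Sum>i<m. k $$ (i, p) * k $$ (i, q)) 0" by (simp add: fls_nth_sum)
    also have "\<dots> = (if p = q then 1 else 0)"
      using mat_inverse_index[OF torth_inverse[OF torth_int_torth[OF assms]] c pq] by simp
    finally show "(transpose_mat (coeff_mat 0 k) * coeff_mat 0 k) $$ (p, q) = 1\<^sub>m m $$ (p, q)"
      using pq by simp
  qed (use c0 in auto)
  show "coeff_mat 0 k * transpose_mat (coeff_mat 0 k) = 1\<^sub>m m"
    using c0 o by (intro mat_mult_left_right_inverse[of "transpose_mat (coeff_mat 0 k)"]) auto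
qed

lemma nmat_carrier [simp]: "nmat m j \<in> carrier_mat (2*m) (2*m)"
  by (simp add: nmat_def)

text \<open>Integral factors cannot raise the pole order, and the extreme coefficient sees only
  their values at t = 0.\<close>

lemma double_coset_ord:
  assumes k: "k \<in> torth_int t (2*m)" and k': "k' \<in> torth_int t (2*m)" and pq: "p < 2*m" "q < 2*m"
  shows "ord_ge (-2) ((k * nmat m j * k') $$ (p, q))"
    "fls_nth ((k * nmat m j * k') $$ (p, q)) (-2)
      = (coeff_mat 0 k * coeff_mat (-2) (nmat m j) * coeff_mat 0 k') $$ (p, q)"
proof -
  note c = torth_int_carrier[OF k] torth_int_carrier[OF k']
  have n: "ord_ge (-2) (nmat m j $$ (i, i'))" if "i < 2*m" "i' < 2*m" for i i'
    using that nblock_ord by (simp add: nmat_def ord_ge_def)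
  have e: "(k * nmat m j * k') $$ (p, q) = (\<Sum>i<2*m. \<Sum>i'<2*m. k $$ (p, i) * nmat m j $$ (i, i') * k' $$ (i', q))"
    using c pq by (intro mult3_index[of _ "2*m" "2*m"]) simp_all
  note o = ord_mult3[OF torth_int_ord[OF k pq(1)] n torth_int_ord[OF k' _ pq(2)]]
  show "ord_ge (-2) ((k * nmat m j * k') $$ (p, q))"
    unfolding e by (intro ord_ge_sum o(1)) auto
  have "(coeff_mat 0 k * coeff_mat (-2) (nmat m j) * coeff_mat 0 k') $$ (p, q)
     = (\<Sum>i<2*m. \<Sum>i'<2*m. coeff_mat 0 k $$ (p, i) * coeff_mat (-2) (nmat m j) $$ (i, i') * coeff_mat 0 k' $$ (i', q))"
    using c pq nmat_carrier[of m j] by (intro mult3_index[of _ "2*m" "2*m"]) (simp_all add: coeff_mat_def)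
  also have "\<dots> = (\<Sum>i<2*m. \<Sum>i'<2*m. fls_nth (k $$ (p, i) * nmat m j $$ (i, i') * k' $$ (i', q)) (-2))"
    using c pq carrier_matD[OF nmat_carrier[of m j]] o(2) by (intro sum.cong refl) (simp add: coeff_mat_def)
  also have "\<dots> = fls_nth ((k * nmat m j * k') $$ (p, q)) (-2)"
    unfolding e by (simp add: fls_nth_sum)
  finally show "fls_nth ((k * nmat m j * k') $$ (p, q)) (-2)
      = (coeff_mat 0 k * coeff_mat (-2) (nmat m j) * coeff_mat 0 k') $$ (p, q)" by simp
qed

text \<open>The one-sided inverses \<open>U'\<close> and \<open>V'\<close> certify rank
  \<open>j\<close> in the form in which \<open>skew_factorization_even\<close> consumes it.\<close>

lemma double_coset_polar_part:
  assumes k: "k \<in> torth_int t (2*m)" and k': "k' \<in> torth_int t (2*m)" and j: "j < m"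
  obtains U V U' V' where "U \<in> carrier_mat (2*m) j" "V \<in> carrier_mat j (2*m)"
    "U' \<in> carrier_mat j (2*m)" "U' * U = 1\<^sub>m j" "V' \<in> carrier_mat (2*m) j" "V * V' = 1\<^sub>m j"
    "coeff_mat (-2) (k * nmat m j * k') = U * V"
proof -
  let ?n = "2*m"
  define A B where "A = iso_frame m j 1 (-\<i>)" and "B = iso_frame m j (-1/2) (-\<i>/2)"
  \<comment> \<open>Dual frames, normalized by 1/2 + (-i)(i/2) = 1 and (-1/2)(-1) + (-i/2) i =
    1.\<close>
  define A' B' where "A' = iso_frame m j (1/2) (\<i>/2)" and "B' = iso_frame m j (-1) \<i>"
  define h h' where "h = coeff_mat 0 k" and "h' = coeff_mat 0 k'"
  have c: "A \<in> carrier_mat ?n j" "B \<in> carrier_mat ?n j" "A' \<in> carrier_mat ?n j" "B' \<in> carrier_mat ?n j"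
    "h \<in> carrier_mat ?n ?n" "h' \<in> carrier_mat ?n ?n"
    unfolding A_def B_def A'_def B'_def h_def h'_def
    using torth_int_coeff_0(1)[OF k] torth_int_coeff_0(1)[OF k'] by simp_all
  have o: "transpose_mat h * h = 1\<^sub>m ?n" "h' * transpose_mat h' = 1\<^sub>m ?n"
    unfolding h_def h'_def using torth_int_coeff_0(2)[OF k] torth_int_coeff_0(3)[OF k'] by simp_all
  have d: "transpose_mat A' * A = 1\<^sub>m j" "transpose_mat B * B' = 1\<^sub>m j"
    unfolding A_def B_def A'_def B'_def using j by (simp_all add: iso_frame_dual)
  have cT: "transpose_mat A' \<in> carrier_mat j ?n" "transpose_mat B \<in> carrier_mat j ?n"
    "transpose_mat h \<in> carrier_mat ?n ?n" "transpose_mat h' \<in> carrier_mat ?n ?n" using c by simp_all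
  show thesis
  proof
    show "h * A \<in> carrier_mat ?n j" "transpose_mat B * h' \<in> carrier_mat j ?n"
      "transpose_mat A' * transpose_mat h \<in> carrier_mat j ?n" "transpose_mat h' * B' \<in> carrier_mat ?n j"
      using c cT by (auto intro: mult_carrier_mat)
    have "transpose_mat A' * transpose_mat h * (h * A) = transpose_mat A' * (transpose_mat h * (h * A))"
      using c cT by (simp add: assoc_mult_mat[of _ j ?n _ ?n _ j])
    also have "transpose_mat h * (h * A) = transpose_mat h * h * A"
      using c cT by (simp add: assoc_mult_mat[of _ ?n ?n _ ?n _ j])
    also have "\<dots> = A" unfolding o using c by simp
    finally show "transpose_mat A' * transpose_mat h * (h * A) = 1\<^sub>m j" unfolding d .
    have "transpose_mat B * h' * (transpose_mat h' * B') = transpose_mat B * (h' * (transpose_mat h' * B'))"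
      using c cT by (simp add: assoc_mult_mat[of _ j ?n _ ?n _ j])
    also have "h' * (transpose_mat h' * B') = h' * transpose_mat h' * B'"
      using c cT by (simp add: assoc_mult_mat[of _ ?n ?n _ ?n _ j])
    also have "\<dots> = B'" unfolding o using c by simp
    finally show "transpose_mat B * h' * (transpose_mat h' * B') = 1\<^sub>m j" unfolding d .
    have "coeff_mat (-2) (k * nmat m j * k') = h * coeff_mat (-2) (nmat m j) * h'"
    proof (rule eq_matI)
      show "coeff_mat (-2) (k * nmat m j * k') $$ (p, q) = (h * coeff_mat (-2) (nmat m j) * h') $$ (p, q)"
        if "p < dim_row (h * coeff_mat (-2) (nmat m j) * h')" "q < dim_col (h * coeff_mat (-2) (nmat m j) * h')" for p q
        using that c torth_int_carrier[OF k] torth_int_carrier[OF k'] double_coset_ord(2)[OF k k', of p q j]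
        by (simp add: coeff_mat_def[of "-2" "k * nmat m j * k'"] h_def h'_def)
    qed (use c torth_int_carrier[OF k] torth_int_carrier[OF k'] in \<open>simp_all add: coeff_mat_def\<close>)
    also have "\<dots> = h * (A * transpose_mat B) * h'"
      unfolding nmat_polar_part[OF j] A_def B_def ..
    also have "\<dots> = h * A * (transpose_mat B * h')"
      using c cT by (simp add: assoc_mult_mat[of _ ?n ?n _ ?n _ ?n] assoc_mult_mat[of _ ?n ?n _ j _ ?n] assoc_mult_mat[of _ ?n j _ ?n _ ?n])
    finally show "coeff_mat (-2) (k * nmat m j * k') = h * A * (transpose_mat B * h')" .
  qed
qed

section \<open>Restrictions on the loops in a double coset\<close>

lemma quad_loop_index:
  assumes "x \<in> carrier_mat (2*l+2) (2*l+2)" "p < 2*l+2" "q < 2*l+2"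
  shows "fls_nth (quad_loop l x $$ (p, q)) k =
    (if k = 0 then if p = q then 1 else 0 else if k = -1 then x $$ (p, q) else if k = -2 then (x * x) $$ (p, q) / 2 else 0)"
proof -
  have "quad_loop l x $$ (p, q) = (if p = q then 1 else 0) + fls_X_intpow (-1) * fls_const (x $$ (p, q))
      + fls_X_intpow (-2) * fls_const ((x * x) $$ (p, q) / 2)"
    unfolding quad_loop_def using assms carrier_matD[OF assms(1)] by simp
  then show ?thesis unfolding fls_X_intpow_times_conv_shift by auto
qed

lemma double_coset_conclusion:
  assumes g: "g \<in> GOminus0 l" "g = k * nmat (l+1) j * k'"
    and k: "k \<in> torth_int True (2*l+2)" "k' \<in> torth_int True (2*l+2)" and j: "j \<le> l"
  shows "coeff_mat (-1) g \<in> nilp_p l"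
    and "odd j \<Longrightarrow> coeff_mat (-1) g \<noteq> 0\<^sub>m (2*l+2) (2*l+2)"
    and "j = 1 \<Longrightarrow> g = quad_loop l (coeff_mat (-1) g)"
proof -
  let ?n = "2*l+2"
  have k2: "k \<in> torth_int True (2*(l+1))" "k' \<in> torth_int True (2*(l+1))" using k by (simp_all add: add.commute)
  have j2: "j < l + 1" and two: "2 * (l + 1) = 2 * l + 2" using j by simp_all
  have "ord_ge (-2) (g $$ (p, q))" if "p < ?n" "q < ?n" for p q
    using double_coset_ord(1)[OF k2, of p q j] that unfolding g(2) by simp
  from short_loop_coeffs[OF g(1) this]
  obtain v where v: "v 0 = 0" "dot ?n v v = 0" "coeff_mat (-1) g = xmat ?n v"
    "\<And>p q. p < ?n \<Longrightarrow> q < ?n \<Longrightarrow> coeff_mat (-2) g $$ (p, q) + coeff_mat (-2) g $$ (q, p) = - (v p * v q)"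
    by blast
  show "coeff_mat (-1) g \<in> nilp_p l" using v nilp_p_iff by blast
  obtain U V U' V' where U: "U \<in> carrier_mat ?n j" "V \<in> carrier_mat j ?n"
    "U' \<in> carrier_mat j ?n" "U' * U = 1\<^sub>m j" "V' \<in> carrier_mat ?n j" "V * V' = 1\<^sub>m j"
    "coeff_mat (-2) g = U * V"
    by (rule double_coset_polar_part[OF k2 j2, unfolded two, folded g(2)]) (rule that)
  have cg: "g \<in> carrier_mat ?n ?n" using g(1) by (rule GOminus0_carrier)
  show nz: "coeff_mat (-1) g \<noteq> 0\<^sub>m ?n ?n" if odd: "odd j"
  proof
    assume z: "coeff_mat (-1) g = 0\<^sub>m ?n ?n"
    have v0: "v q = 0" if "q < ?n" for q
    proof (cases "q = 0")
      case False
      then show ?thesis using arg_cong[OF v(3)[unfolded z], of "\<lambda>y. y $$ (0, q)"] that by simp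
    qed (simp add: v)
    have "transpose_mat (U * V) = - (U * V)"
    proof (rule eq_matI)
      fix p q assume "p < dim_row (- (U * V))" "q < dim_col (- (U * V))"
      then have pq: "p < ?n" "q < ?n" using U by auto
      then have "(U * V) $$ (q, p) + (U * V) $$ (p, q) = 0" using v(4)[of q p] v0 unfolding U(7) by simp
      then show "transpose_mat (U * V) $$ (p, q) = (- (U * V)) $$ (p, q)"
        using pq U(1,2) by (simp add: eq_neg_iff_add_eq_0)
    qed (use U in auto)
    from skew_factorization_even[OF U(1-6) this] odd show False by simp
  qed
  show "g = quad_loop l (coeff_mat (-1) g)" if j1: "j = 1"
  proof -
    \<comment> \<open>For \<open>j = 1\<close> the two factors are a column and a row, so y is the
      product of the vectors \<open>a\<close> and \<open>b\<close>.\<close>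
    define a b where "a p = U $$ (p, 0)" and "b q = V $$ (0, q)" for p q
    have y: "coeff_mat (-2) g $$ (p, q) = a p * b q" if "p < ?n" "q < ?n" for p q
      using mult_index[OF U(1,2) that] unfolding U(7) j1 a_def b_def by simp
    have s: "a p * b q + a q * b p = - (v p * v q)" if "p < ?n" "q < ?n" for p q
      using v(4)[OF that] y[OF that] y[OF that(2,1)] by simp
    have "\<exists>r<?n. v r \<noteq> 0"
    proof (rule ccontr)
      assume "\<not> (\<exists>r<?n. v r \<noteq> 0)"
      then have "xmat ?n v = 0\<^sub>m ?n ?n" by (intro eq_matI) auto
      then show False using nz j1 v(3) by simp
    qed
    then obtain r where r: "r < ?n" "v r \<noteq> 0" by blast
    have half: "z = w / 2" if "z + z = w" for z w :: complex using that by (simp add: field_simps)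
    have rr: "a p * b p = - (v p * v p) / 2" if "p < ?n" for p by (rule half[OF s[OF that that]])
    have e: "a p * b r = - (v p * v r) / 2" "a r * b p = - (v p * v r) / 2" if p: "p < ?n" for p
    proof -
      \<comment> \<open>The discriminant of the quadratic with roots \<open>a p * b r\<close> and
        \<open>a r * b p\<close>. Sum and product of the roots are known from \<open>s\<close> and
        \<open>rr\<close>, and the discriminant vanishes, so the roots coincide.\<close>
      have "(a p * b r - a r * b p)^2 = (a p * b r + a r * b p)^2 - 4 * (a p * b p) * (a r * b r)"
        by (simp add: power2_eq_square algebra_simps)
      also have "\<dots> = 0" unfolding s[OF p r(1)] rr[OF p] rr[OF r(1)] by (simp add: power2_eq_square algebra_simps)
      finally have eq: "a p * b r = a r * b p" by simp
      then show "a p * b r = - (v p * v r) / 2" using s[OF p r(1)] by (intro half) simp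
      then show "a r * b p = - (v p * v r) / 2" unfolding eq .
    qed
    have y2: "a p * b q = - (v p * v q) / 2" if pq: "p < ?n" "q < ?n" for p q
    proof -
      \<comment> \<open>Rank one lets every entry be compared with row and column \<open>r\<close>,
        and \<open>v r \<noteq> 0\<close> allows cancelling the pivot.\<close>
      have "(a p * b q) * (a r * b r) = (a p * b r) * (a r * b q)" by (simp add: mult_ac)
      also have "\<dots> = (- (v p * v q) / 2) * (a r * b r)" unfolding e[OF pq(1)] e[OF pq(2)] rr[OF r(1)] by simp
      finally have "(a p * b q) * (a r * b r) = (- (v p * v q) / 2) * (a r * b r)" .
      moreover have "a r * b r \<noteq> 0" unfolding rr[OF r(1)] using r(2) by simp
      ultimately show ?thesis using mult_right_cancel by blast
    qed
    have t: "g \<in> torth True ?n" and d: "\<And>p q. p < ?n \<Longrightarrow> q < ?n \<Longrightarrow> deg_le 0 (g $$ (p, q))"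
      using g(1) unfolding GOminus0_def GOminus_iff by auto
    show ?thesis
    proof (rule eq_matI)
      fix p q assume "p < dim_row (quad_loop l (coeff_mat (-1) g))" "q < dim_col (quad_loop l (coeff_mat (-1) g))"
      then have pq: "p < ?n" "q < ?n" using cg by (simp_all add: quad_loop_def coeff_mat_def)
      have cx: "coeff_mat (-1) g \<in> carrier_mat ?n ?n" using cg by (simp add: coeff_mat_def)
      have "fls_nth (g $$ (p, q)) i = fls_nth (quad_loop l (coeff_mat (-1) g) $$ (p, q)) i" for i
      proof -
        consider "i = 0" | "i = -1" | "i = -2" | "i < -2" | "i > 0" by linarith
        then show ?thesis
        proof cases
          case 1
          have "coeff_mat 0 g $$ (p, q) = 1\<^sub>m ?n $$ (p, q)" using g(1) by (simp add: GOminus0_def)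
          then show ?thesis unfolding quad_loop_index[OF cx pq] using 1 pq cg by (simp add: coeff_mat_def)
        next
          case 2
          then show ?thesis unfolding quad_loop_index[OF cx pq] using pq cg by (simp add: coeff_mat_def)
        next
          case 3
          have "(coeff_mat (-1) g * coeff_mat (-1) g) $$ (p, q) = - (v p * v q)"
            unfolding v(3) xmat_square[of v, OF v(1) pq] using v by simp
          moreover have "fls_nth (g $$ (p, q)) (-2) = - (v p * v q) / 2"
            using y[OF pq] y2[OF pq] pq cg by (simp add: coeff_mat_def)
          ultimately show ?thesis unfolding quad_loop_index[OF cx pq] using 3 by simp
        next
          case 4
          have "ord_ge (-2) (g $$ (p, q))"
            using double_coset_ord(1)[OF k2, of p q j] pq unfolding g(2) by simp
          then show ?thesis unfolding quad_loop_index[OF cx pq] using 4 by (simp add: ord_ge_def)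
        next
          case 5
          then show ?thesis unfolding quad_loop_index[OF cx pq] using d[OF pq] by (simp add: deg_le_def)
        qed
      qed
      then show "g $$ (p, q) = quad_loop l (coeff_mat (-1) g) $$ (p, q)" by (intro fls_eqI)
    qed (use cg in \<open>simp_all add: quad_loop_def coeff_mat_def\<close>)
  qed
qed

section \<open>Construction of loops by blocks\<close>

definition dcoset :: "bool \<Rightarrow> nat \<Rightarrow> complex fls mat \<Rightarrow> complex fls mat \<Rightarrow> bool" where
  "dcoset t m N G \<longleftrightarrow> (\<exists>K\<in>torth_int t m. \<exists>K'\<in>torth_int t m. G = K * N * K')"

text \<open>The property carried through all constructions. Size and flag are parameters, so that it
  can be proved for blocks and then added up.\<close>

definition hits :: "bool \<Rightarrow> nat \<Rightarrow> complex fls mat \<Rightarrow> complex mat \<Rightarrow> bool" where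
  "hits t m N x \<longleftrightarrow> (\<exists>G\<in>carrier_mat m m. dcoset t m N G \<and> (\<forall>p<m. \<forall>q<m. deg_le 0 (G $$ (p, q))) \<and>
     coeff_mat 0 G = 1\<^sub>m m \<and> coeff_mat (-1) G = x)"

definition dsum :: "nat \<Rightarrow> nat \<Rightarrow> 'a::zero mat \<Rightarrow> 'a mat \<Rightarrow> 'a mat" where
  "dsum a b A B = four_block_mat A (0\<^sub>m a b) (0\<^sub>m b a) B"

lemma dsum_carrier [simp]: "A \<in> carrier_mat a a \<Longrightarrow> B \<in> carrier_mat b b \<Longrightarrow> dsum a b A B \<in> carrier_mat (a+b) (a+b)"
  by (simp add: dsum_def)

lemma dsum_index:
  assumes "A \<in> carrier_mat a a" "B \<in> carrier_mat b b" "p < a + b" "q < a + b"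
  shows "dsum a b A B $$ (p, q) = (if p < a \<and> q < a then A $$ (p, q) else if p \<ge> a \<and> q \<ge> a then B $$ (p - a, q - a) else 0)"
  using assms by (auto simp: dsum_def)

lemma dsum_mult:
  fixes A :: "'a::semiring_0 mat"
  assumes "A \<in> carrier_mat a a" "B \<in> carrier_mat b b" "A' \<in> carrier_mat a a" "B' \<in> carrier_mat b b"
  shows "dsum a b A B * dsum a b A' B' = dsum a b (A * A') (B * B')"
  unfolding dsum_def using assms
  by (subst mult_four_block_mat[of A a a _ b _ b B A' a _ b]) auto

lemma dsum_transpose:
  assumes "A \<in> carrier_mat a a" "B \<in> carrier_mat b b"
  shows "transpose_mat (dsum a b A B) = dsum a b (transpose_mat A) (transpose_mat B)"
  unfolding dsum_def using assms by (subst transpose_four_block_mat[of A a a _ b _ b]) auto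

lemma dsum_one: "dsum a b (1\<^sub>m a) (1\<^sub>m b) = 1\<^sub>m (a + b)"
  by (simp add: dsum_def)

lemma dsum_coeff:
  assumes "A \<in> carrier_mat a a" "B \<in> carrier_mat b b"
  shows "coeff_mat k (dsum a b A B) = dsum a b (coeff_mat k A) (coeff_mat k B)"
  unfolding dsum_def coeff_mat_def using assms
  by (subst map_four_block_mat[of A a a _ b _ b]) (auto intro!: arg_cong2[of _ _ _ _ "\<lambda>X Y. four_block_mat _ X Y _"])

text \<open>As \<open>0 < a\<close>, the index negated by \<open>w0\<close> lies in the first block,
  so the second one must be invariant without signs: its flag is \<open>False\<close>.\<close>

lemma dsum_torth_int:
  assumes A: "A \<in> torth_int t a" and B: "B \<in> torth_int False b" and a: "0 < a"
  shows "dsum a b A B \<in> torth_int t (a + b)"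
proof (intro torth_intI torthI)
  note c = torth_int_carrier[OF A] torth_int_carrier[OF B]
  show "dsum a b A B \<in> carrier_mat (a + b) (a + b)" using c by simp
  show "transpose_mat (dsum a b A B) * dsum a b A B = 1\<^sub>m (a + b)"
    using c torth_inverse[OF torth_int_torth[OF A]] torth_inverse[OF torth_int_torth[OF B]]
    by (simp add: dsum_transpose dsum_mult dsum_one)
  fix p q assume pq: "p < a + b" "q < a + b"
  show "neg_t (dsum a b A B $$ (p, q)) = tsgn t p * tsgn t q * dsum a b A B $$ (p, q)"
    unfolding dsum_index[OF c pq]
    using torth_neg_t[OF torth_int_torth[OF A], of p q] torth_neg_t[OF torth_int_torth[OF B], of "p - a" "q - a"] pq a
    by (auto simp: tsgn_def)
  show "ord_ge 0 (dsum a b A B $$ (p, q))"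
    unfolding dsum_index[OF c pq]
    using torth_int_ord[OF A, of p q] torth_int_ord[OF B, of "p - a" "q - a"] pq by auto
qed

lemma dcoset_dsum:
  assumes "dcoset t a N G" "dcoset False b N' G'" "0 < a" and N: "N \<in> carrier_mat a a" "N' \<in> carrier_mat b b"
  shows "dcoset t (a + b) (dsum a b N N') (dsum a b G G')"
proof -
  obtain K K' L L' where K: "K \<in> torth_int t a" "K' \<in> torth_int t a" "G = K * N * K'"
    and L: "L \<in> torth_int False b" "L' \<in> torth_int False b" "G' = L * N' * L'"
    using assms(1,2) unfolding dcoset_def by blast
  note c = K(1,2)[THEN torth_int_carrier] L(1,2)[THEN torth_int_carrier] N
  have "dsum a b G G' = dsum a b K L * dsum a b N N' * dsum a b K' L'"
    unfolding K(3) L(3) using c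
      mult_carrier_mat[OF c(1,5)] mult_carrier_mat[OF c(3,6)] by (simp only: dsum_mult)
  then show ?thesis unfolding dcoset_def using dsum_torth_int K(1,2) L(1,2) assms(3) by blast
qed

lemma dcoset_mult:
  assumes "dcoset t m N G" "k \<in> torth_int t m" "k' \<in> torth_int t m" "N \<in> carrier_mat m m"
  shows "dcoset t m N (k * G * k')"
proof -
  obtain K K' where K: "K \<in> torth_int t m" "K' \<in> torth_int t m" "G = K * N * K'"
    using assms(1) unfolding dcoset_def by blast
  note c = K(1,2)[THEN torth_int_carrier] assms(2,3)[THEN torth_int_carrier] assms(4)
  have "k * (K * N * K') = k * (K * N) * K'"
    using c by (intro assoc_mult_mat[of _ m m _ m _ m, symmetric]) (auto intro: mult_carrier_mat)
  also have "k * (K * N) = k * K * N"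
    using c by (intro assoc_mult_mat[of _ m m _ m _ m, symmetric]) auto
  also have "k * K * N * K' * k' = k * K * N * (K' * k')"
    using c by (intro assoc_mult_mat[of _ m m _ m _ m]) (auto intro: mult_carrier_mat)
  finally have "k * G * k' = k * K * N * (K' * k')" unfolding K(3) by simp
  then show ?thesis unfolding dcoset_def using torth_int_mult K assms by blast
qed

text \<open>With \<open>K'\<close> moved to the other side as its transpose, an explicit
  factorization becomes an equality between products of only two matrices.\<close>

lemma dcosetI:
  assumes "K \<in> torth_int t m" "K' \<in> torth_int t m" "N \<in> carrier_mat m m" "G \<in> carrier_mat m m"
    and e: "K * N = G * transpose_mat K'"
  shows "dcoset t m N G"
proof -
  note c = assms(1,2)[THEN torth_int_carrier]
  have "K * N * K' = G * (transpose_mat K' * K')"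
    unfolding e using c assms(4) by (intro assoc_mult_mat[of _ m m _ m _ m]) auto
  also have "\<dots> = G" unfolding torth_inverse[OF torth_int_torth[OF assms(2)]] using assms(4) by simp
  finally show ?thesis unfolding dcoset_def using assms(1,2) by metis
qed

lemma hits_dsum:
  assumes "hits t a N x" "hits False b N' x'" "0 < a" and N: "N \<in> carrier_mat a a" "N' \<in> carrier_mat b b"
  shows "hits t (a + b) (dsum a b N N') (dsum a b x x')"
proof -
  obtain G G' where G: "G \<in> carrier_mat a a" "dcoset t a N G" "\<And>p q. p < a \<Longrightarrow> q < a \<Longrightarrow> deg_le 0 (G $$ (p, q))"
      "coeff_mat 0 G = 1\<^sub>m a" "coeff_mat (-1) G = x"
    and G': "G' \<in> carrier_mat b b" "dcoset False b N' G'" "\<And>p q. p < b \<Longrightarrow> q < b \<Longrightarrow> deg_le 0 (G' $$ (p, q))"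
      "coeff_mat 0 G' = 1\<^sub>m b" "coeff_mat (-1) G' = x'"
    using assms(1,2) unfolding hits_def by blast
  have "deg_le 0 (dsum a b G G' $$ (p, q))" if pq: "p < a + b" "q < a + b" for p q
    unfolding dsum_index[OF G(1) G'(1) pq] using G(3)[of p q] G'(3)[of "p - a" "q - a"] pq
    by (auto simp: deg_le_def)
  moreover have "coeff_mat 0 (dsum a b G G') = 1\<^sub>m (a + b)" "coeff_mat (-1) (dsum a b G G') = dsum a b x x'"
    unfolding dsum_coeff[OF G(1) G'(1)] G G' dsum_one by simp_all
  ultimately show ?thesis
    unfolding hits_def using dcoset_dsum[OF G(2) G'(2) assms(3) N] dsum_carrier[OF G(1) G'(1)] by blast
qed

lemma hits_one: "hits t m (1\<^sub>m m) (0\<^sub>m m m)"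
  unfolding hits_def
proof (intro bexI conjI allI impI)
  have "(1\<^sub>m m :: complex fls mat) = 1\<^sub>m m * 1\<^sub>m m * 1\<^sub>m m" by simp
  then show "dcoset t m (1\<^sub>m m) (1\<^sub>m m)" unfolding dcoset_def using one_torth_int by blast
  show "deg_le 0 (1\<^sub>m m $$ (p, q))" if "p < m" "q < m" for p q using that by (simp add: deg_le_def)
  show "coeff_mat 0 (1\<^sub>m m) = 1\<^sub>m m" "coeff_mat (-1) (1\<^sub>m m) = 0\<^sub>m m m"
    by (auto simp: coeff_mat_def intro!: eq_matI)
qed simp

text \<open>A constant orthogonal matrix is integral and also polynomial in t^-1, so conjugating by
  it respects the double coset as well as the normalized form.\<close>

lemma hits_conj:
  assumes h: "hits t m N x" and N: "N \<in> carrier_mat m m" and R: "R \<in> carrier_mat m m" "transpose_mat R * R = 1\<^sub>m m"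
    and s: "\<And>p q. p < m \<Longrightarrow> q < m \<Longrightarrow> t \<Longrightarrow> (p = 0) \<noteq> (q = 0) \<Longrightarrow> R $$ (p, q) = 0"
  shows "hits t m N (R * x * transpose_mat R)"
proof -
  obtain G where G: "G \<in> carrier_mat m m" "dcoset t m N G" "\<And>p q. p < m \<Longrightarrow> q < m \<Longrightarrow> deg_le 0 (G $$ (p, q))"
      "coeff_mat 0 G = 1\<^sub>m m" "coeff_mat (-1) G = x"
    using h unfolding hits_def by blast
  let ?R = "map_mat fls_const R"
  have Ri: "?R \<in> torth_int t m" using const_torth_int[OF R s] by blast
  let ?G = "?R * G * transpose_mat ?R"
  have cR: "?R \<in> carrier_mat m m" "transpose_mat ?R \<in> carrier_mat m m" using R by simp_all
  have cG: "?G \<in> carrier_mat m m" using mult_carrier_mat[OF mult_carrier_mat[OF cR(1) G(1)] cR(2)] .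
  have e: "?G $$ (p, q) = (\<Sum>i<m. \<Sum>k<m. fls_const (R $$ (p, i)) * G $$ (i, k) * fls_const (R $$ (q, k)))"
    if "p < m" "q < m" for p q
    using mult3_index[OF cR(1) G(1) cR(2) that] R that by simp
  have d: "deg_le 0 (?G $$ (p, q))" if pq: "p < m" "q < m" for p q
    unfolding e[OF pq] using G(3)
    by (intro deg_le_sum) (auto simp: deg_le_def)
  have cf: "coeff_mat k ?G = R * coeff_mat k G * transpose_mat R" for k
  proof (rule eq_matI)
    have ck: "coeff_mat k G \<in> carrier_mat m m" using G(1) by (simp add: coeff_mat_def)
    have cRT: "transpose_mat R \<in> carrier_mat m m" using R by simp
    fix p q assume "p < dim_row (R * coeff_mat k G * transpose_mat R)" "q < dim_col (R * coeff_mat k G * transpose_mat R)"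
    then have pq: "p < m" "q < m" using R by auto
    have "coeff_mat k ?G $$ (p, q) = fls_nth (?G $$ (p, q)) k" using G(1) R pq by (simp add: coeff_mat_def)
    also have "\<dots> = (\<Sum>i<m. \<Sum>i'<m. R $$ (p, i) * coeff_mat k G $$ (i, i') * transpose_mat R $$ (i', q))"
      unfolding e[OF pq] fls_nth_sum using G(1) R pq by (intro sum.cong) (auto simp: coeff_mat_def)
    also have "\<dots> = (R * coeff_mat k G * transpose_mat R) $$ (p, q)"
      by (rule mult3_index[OF R(1) ck cRT pq, symmetric])
    finally show "coeff_mat k ?G $$ (p, q) = (R * coeff_mat k G * transpose_mat R) $$ (p, q)" .
  qed (use R cG in \<open>auto simp: coeff_mat_def\<close>)
  have "R * 1\<^sub>m m * transpose_mat R = 1\<^sub>m m"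
    using R mat_mult_left_right_inverse[of "transpose_mat R" m R] by simp
  then have "coeff_mat 0 ?G = 1\<^sub>m m" "coeff_mat (-1) ?G = R * x * transpose_mat R" unfolding cf G(4,5) by auto
  then show ?thesis
    unfolding hits_def using cG d dcoset_mult[OF G(2) Ri torth_int_transpose[OF Ri] N] by blast
qed

section \<open>Block decomposition and determinant of the torus element\<close>

lemma plane_mat_dsum: "plane_mat (a + b) f = dsum (2*a) (2*b) (plane_mat a f) (plane_mat b (\<lambda>i. f (a + i)))"
proof (rule eq_matI)
  fix p q assume "p < dim_row (dsum (2*a) (2*b) (plane_mat a f) (plane_mat b (\<lambda>i. f (a + i))))"
    "q < dim_col (dsum (2*a) (2*b) (plane_mat a f) (plane_mat b (\<lambda>i. f (a + i))))"
  then have pq: "p < 2*a + 2*b" "q < 2*a + 2*b" by (auto simp: dsum_def)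
  have div: "a + (r - 2*a) div 2 = r div 2" "(r - 2*a) mod 2 = r mod 2" if r: "2*a \<le> r" for r :: nat
  proof -
    obtain s where "r = 2*a + s" using r le_Suc_ex by blast
    then show "a + (r - 2*a) div 2 = r div 2" "(r - 2*a) mod 2 = r mod 2" by simp_all
  qed
  have "plane_mat (a + b) f $$ (p, q) = (if p div 2 = q div 2 then f (p div 2) (p mod 2) (q mod 2) else 0)"
    using pq by simp
  also have "\<dots> = dsum (2*a) (2*b) (plane_mat a f) (plane_mat b (\<lambda>i. f (a + i))) $$ (p, q)"
  proof (cases "p < 2*a"; cases "q < 2*a")
    assume "p < 2*a" "q < 2*a"
    then show ?thesis by (simp add: dsum_index[OF plane_mat_carrier plane_mat_carrier pq])
  next
    assume "p < 2*a" "\<not> q < 2*a"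
    moreover from this have "p div 2 \<noteq> q div 2" by presburger
    ultimately show ?thesis by (simp add: dsum_index[OF plane_mat_carrier plane_mat_carrier pq])
  next
    assume "\<not> p < 2*a" "q < 2*a"
    moreover from this have "p div 2 \<noteq> q div 2" by presburger
    ultimately show ?thesis by (simp add: dsum_index[OF plane_mat_carrier plane_mat_carrier pq])
  next
    assume g: "\<not> p < 2*a" "\<not> q < 2*a"
    then have "p - 2*a < 2*b" "q - 2*a < 2*b" using pq by auto
    moreover have "(p - 2*a) div 2 = (q - 2*a) div 2 \<longleftrightarrow> p div 2 = q div 2"
      using g div(1)[of p] div(1)[of q] by linarith
    ultimately show ?thesis
      using g by (simp add: dsum_index[OF plane_mat_carrier plane_mat_carrier pq] div)
  qed
  finally show "plane_mat (a + b) f $$ (p, q) = dsum (2*a) (2*b) (plane_mat a f) (plane_mat b (\<lambda>i. f (a + i))) $$ (p, q)" .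
qed (auto simp: dsum_def)

lemma xmat_dsum:
  assumes "\<And>q. a \<le> q \<Longrightarrow> v q = 0" "0 < a"
  shows "xmat (a + b) v = dsum a b (xmat a v) (0\<^sub>m b b)"
  using assms by (intro eq_matI) (auto simp: dsum_def)

lemma nmat_torth: "nmat m j \<in> torth True (2*m)"
proof (rule torthI)
  have "transpose_mat (plane_mat m (nblock j)) = plane_mat m (\<lambda>b p q. nblock j b q p)"
    by (intro eq_matI) (auto simp: plane_mat_def)
  then have "transpose_mat (nmat m j) * nmat m j
      = plane_mat m (\<lambda>b p q. nblock j b 0 p * nblock j b 0 q + nblock j b 1 p * nblock j b 1 q)"
    unfolding nmat_def by (simp add: plane_mat_mult)
  also have "\<dots> = plane_mat m (\<lambda>b p q. if p = q then 1 else 0)"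
  proof (rule plane_mat_cong)
    fix b p q :: nat assume pq: "p < 2" "q < 2"
    \<comment> \<open>Transposing a rotation block exchanges its eigenvalues;
      \<open>rot_mult\<close> then multiplies -t^2 with -t^-2.\<close>
    have sw: "rot x y q p = rot y x p q" for x y p q by (auto simp: rot_def algebra_simps)
    have X: "- fls_X_intpow (-2) * - fls_X_intpow 2 = (1 :: complex fls)" "- fls_X_intpow 2 * - fls_X_intpow (-2) = (1 :: complex fls)"
      by (simp_all only: minus_mult_minus fls_X_intpow_times_fls_X_intpow) simp_all
    have z: "((-1) ^ j * (-1) ^ j :: complex fls) = 1" by (simp flip: power_mult_distrib)
    consider "b = 0" | "b \<noteq> 0" "b \<le> j" | "b \<noteq> 0" "\<not> b \<le> j" by blast
    then show "nblock j b 0 p * nblock j b 0 q + nblock j b 1 p * nblock j b 1 q = (if p = q then 1 else 0)"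
    proof cases
      case 1
      then show ?thesis using pq z by (auto simp: nblock_def less_2_cases_iff)
    next
      case 2
      then have "nblock j b 0 p * nblock j b 0 q + nblock j b 1 p * nblock j b 1 q
        = rot (- fls_X_intpow (-2)) (- fls_X_intpow 2) p 0 * rot (- fls_X_intpow 2) (- fls_X_intpow (-2)) 0 q
        + rot (- fls_X_intpow (-2)) (- fls_X_intpow 2) p 1 * rot (- fls_X_intpow 2) (- fls_X_intpow (-2)) 1 q"
        by (simp only: nblock_def if_True if_False sw[of _ _ _ p])
      then show ?thesis unfolding rot_mult[OF pq] X rot_1 .
    next
      case 3
      then show ?thesis using pq by (auto simp: nblock_def less_2_cases_iff)
    qed
  qed
  also have "\<dots> = 1\<^sub>m (2*m)"
  proof (rule eq_matI)
    fix p q assume "p < dim_row (1\<^sub>m (2*m))" "q < dim_col (1\<^sub>m (2*m))"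
    then have pq: "p < 2*m" "q < 2*m" by auto
    have "p div 2 = q div 2 \<and> p mod 2 = q mod 2 \<longleftrightarrow> p = q"
      by (metis mult_div_mod_eq)
    then show "plane_mat m (\<lambda>b p q. if p = q then 1 else 0) $$ (p, q) = 1\<^sub>m (2*m) $$ (p, q)"
      using pq by auto
  qed auto
  finally show "transpose_mat (nmat m j) * nmat m j = 1\<^sub>m (2*m)" .
  fix p q assume pq: "p < 2*m" "q < 2*m"
  have nb: "neg_t (nblock j b p q) = nblock j b p q" for b p q
    using neg_t_X_intpow[of "-2"] by (auto simp: nblock_def rot_def)
  have z: "(p = 0 \<longleftrightarrow> q = 0) \<or> nmat m j $$ (p, q) = 0"
  proof (cases "p div 2 = q div 2 \<and> p div 2 = 0")
    case True
    then show ?thesis using pq by (auto simp: nmat_def nblock_def)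
  next
    case False
    then show ?thesis using pq by (auto simp: nmat_def)
  qed
  show "neg_t (nmat m j $$ (p, q)) = tsgn True p * tsgn True q * nmat m j $$ (p, q)"
  proof -
    have "neg_t (nmat m j $$ (p, q)) = nmat m j $$ (p, q)" using pq nb by (simp add: nmat_def)
    then show ?thesis using z by (auto simp: tsgn_def)
  qed
qed simp

lemma dsum_det:
  fixes A :: "'a::idom mat"
  assumes "A \<in> carrier_mat a a" "B \<in> carrier_mat b b"
  shows "det (dsum a b A B) = det A * det B"
  unfolding dsum_def using assms by (intro det_four_block_mat_upper_right_zero) auto

lemma det_plane_mat_1: "det (plane_mat 1 f) = f 0 0 0 * f 0 1 1 - f 0 0 1 * (f 0 1 0 :: 'a::idom)"
proof -
  let ?m = "\<lambda>x. mat 1 1 (\<lambda>_. x) :: 'a mat"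
  have 1: "plane_mat 1 f = four_block_mat (?m (f 0 0 0)) (?m (f 0 0 1)) (?m (f 0 1 0)) (?m (f 0 1 1))"
  proof (rule eq_matI)
    fix p q assume "p < dim_row (four_block_mat (?m (f 0 0 0)) (?m (f 0 0 1)) (?m (f 0 1 0)) (?m (f 0 1 1)))"
      "q < dim_col (four_block_mat (?m (f 0 0 0)) (?m (f 0 0 1)) (?m (f 0 1 0)) (?m (f 0 1 1)))"
    then have "p = 0 \<or> p = 1" "q = 0 \<or> q = 1" by auto
    then show "plane_mat 1 f $$ (p, q) = four_block_mat (?m (f 0 0 0)) (?m (f 0 0 1)) (?m (f 0 1 0)) (?m (f 0 1 1)) $$ (p, q)"
      by (elim disjE) (simp_all add: plane_mat_def)
  qed simp_all
  have "det (plane_mat 1 f) = det (?m (f 0 0 0) * ?m (f 0 1 1) - ?m (f 0 0 1) * ?m (f 0 1 0))"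
    unfolding 1 by (rule det_four_block_mat[of _ 1]) (auto intro!: eq_matI simp: scalar_prod_def index_mult_mat(1))
  also have "?m (f 0 0 0) * ?m (f 0 1 1) - ?m (f 0 0 1) * ?m (f 0 1 0) = ?m (f 0 0 0 * f 0 1 1 - f 0 0 1 * f 0 1 0)"
    by (auto intro!: eq_matI simp: scalar_prod_def index_mult_mat(1))
  also have "det \<dots> = f 0 0 0 * f 0 1 1 - f 0 0 1 * f 0 1 0"
    by (subst det_single) auto
  finally show ?thesis .
qed

lemma det_plane_mat: "det (plane_mat m f) = (\<Prod>b<m. f b 0 0 * f b 1 1 - f b 0 1 * (f b 1 0 :: 'a::idom))"
proof (induction m)
  case 0
  then show ?case by (simp add: plane_mat_def)
next
  case (Suc m)
  have "det (plane_mat (m + 1) f) = det (plane_mat m f) * det (plane_mat 1 (\<lambda>i. f (m + i)))"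
    unfolding plane_mat_dsum by (rule dsum_det) (rule plane_mat_carrier)+
  then show ?case using Suc det_plane_mat_1[of "\<lambda>i. f (m + i)"] by simp
qed

lemma det_nmat: "det (nmat m j) = 1"
proof -
  have "nblock j b 0 0 * nblock j b 1 1 - nblock j b 0 1 * nblock j b 1 0 = 1" for b
  proof -
    have sw: "nblock j b 1 1 = nblock j b 0 0" "nblock j b 1 0 = - nblock j b 0 1"
      by (simp_all add: nblock_def rot_def)
    \<comment> \<open>The determinant of block b is the squared length of its first column. It is
      read off from orthogonality for b + 1 planes, the least number containing plane b.\<close>
    have "transpose_mat (nmat (b+1) j) * nmat (b+1) j = 1\<^sub>m (2*(b+1))" by (rule torth_inverse[OF nmat_torth])
    from mat_inverse_index[OF this nmat_carrier, of "2*b" "2*b"]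
    have "(\<Sum>i<2*(b+1). nmat (b+1) j $$ (i, 2*b) * nmat (b+1) j $$ (i, 2*b)) = 1" by simp
    also have "(\<Sum>i<2*(b+1). nmat (b+1) j $$ (i, 2*b) * nmat (b+1) j $$ (i, 2*b))
       = (\<Sum>c<b+1. if c = b then nblock j b 0 0 * nblock j b 0 0 + nblock j b 1 0 * nblock j b 1 0 else 0)"
      unfolding sum_planes by (intro sum.cong) (auto simp: nmat_def)
    also have "\<dots> = nblock j b 0 0 * nblock j b 0 0 + nblock j b 1 0 * nblock j b 1 0" by simp
    finally show ?thesis unfolding sw by simp
  qed
  then show ?thesis unfolding nmat_def det_plane_mat by simp
qed

text \<open>
  Here \<open>T\<close> is \<open>t\<close>, \<open>S\<close> is \<open>t^-1\<close> and \<open>I\<close> is the imaginary unit. Let \<open>w\<^sub>b = (1, -i)\<close> and \<open>u\<^sub>b = (1, i)\<close> be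
  the isotropic vectors in the planes \<open>b = 1, 2\<close> on which the torus block is a rotation. The pair blocks
  come from the identity \<open>[[1,a],[0,1]] = [[1,0],[1/a,1]] * diag(a,1/a) * [[1/a,1],[-1,0]]\<close> with
  \<open>a = t^-2\<close> on the span of \<open>w\<^sub>1, u\<^sub>2\<close> and with \<open>a = - t^-2\<close> on the span of \<open>w\<^sub>2, u\<^sub>1\<close>. The single blocks
  are the analogue in the adjoint representation, on the span of \<open>w\<^sub>1, e\<^sub>0, u\<^sub>1\<close>, with \<open>a\<close> proportional
  to \<open>t^-1\<close>. Multiplying the pair loop on the left by \<open>mixed_left = exp (t x)\<close>, where \<open>x\<close> is the element of
  \<open>p_space\<close> belonging to \<open>u\<^sub>2\<close>, and on the right by the integral loop \<open>mixed_right\<close> gives the mixed loop,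
  whose coefficient of \<open>t^-1\<close> is not zero.
\<close>

definition pair_left :: "'a \<Rightarrow> 'a \<Rightarrow> nat \<Rightarrow> nat \<Rightarrow> 'a::field" where
  "pair_left T I p q = [
    [1, 0, - (T^2/2), - (I*T^2/2)],
    [0, 1, - (I*T^2/2), T^2/2],
    [T^2/2, I*T^2/2, 1, 0],
    [I*T^2/2, - (T^2/2), 0, 1]] ! p ! q"

definition pair_right :: "'a \<Rightarrow> 'a \<Rightarrow> nat \<Rightarrow> nat \<Rightarrow> 'a::field" where
  "pair_right T I p q = [
    [- (T^2/2), - (I*T^2/2), -1, 0],
    [I*T^2/2, - (T^2/2), 0, 1],
    [1, 0, - (T^2/2), - (I*T^2/2)],
    [0, -1, I*T^2/2, - (T^2/2)]] ! p ! q"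

definition pair_torus :: "'a \<Rightarrow> 'a \<Rightarrow> 'a \<Rightarrow> nat \<Rightarrow> nat \<Rightarrow> 'a::field" where
  "pair_torus S T I p q = [
    [- (S^2/2) - T^2/2, - (I*S^2/2) + I*T^2/2, 0, 0],
    [I*S^2/2 - I*T^2/2, - (S^2/2) - T^2/2, 0, 0],
    [0, 0, - (S^2/2) - T^2/2, - (I*S^2/2) + I*T^2/2],
    [0, 0, I*S^2/2 - I*T^2/2, - (S^2/2) - T^2/2]] ! p ! q"

definition pair_loop :: "'a \<Rightarrow> 'a \<Rightarrow> nat \<Rightarrow> nat \<Rightarrow> 'a::field" where
  "pair_loop S I p q = [
    [1, 0, S^2/2, - (I*S^2/2)],
    [0, 1, - (I*S^2/2), - (S^2/2)],
    [- (S^2/2), I*S^2/2, 1, 0],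
    [I*S^2/2, S^2/2, 0, 1]] ! p ! q"

definition sing_left :: "'a \<Rightarrow> 'a \<Rightarrow> nat \<Rightarrow> nat \<Rightarrow> 'a::field" where
  "sing_left T I p q = [
    [1, 0, -T, - (I*T)],
    [0, 1, 0, 0],
    [T, 0, 1 - T^2/2, - (I*T^2/2)],
    [I*T, 0, - (I*T^2/2), 1 + T^2/2]] ! p ! q"

definition sing_right :: "'a \<Rightarrow> 'a \<Rightarrow> nat \<Rightarrow> nat \<Rightarrow> 'a::field" where
  "sing_right T I p q = [
    [1, 0, -T, - (I*T)],
    [0, -1, 0, 0],
    [T, 0, 1 - T^2/2, - (I*T^2/2)],
    [- (I*T), 0, I*T^2/2, -1 - T^2/2]] ! p ! q"

definition sing_torus :: "'a \<Rightarrow> 'a \<Rightarrow> 'a \<Rightarrow> nat \<Rightarrow> nat \<Rightarrow> 'a::field" where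
  "sing_torus S T I p q = [
    [-1, 0, 0, 0],
    [0, -1, 0, 0],
    [0, 0, - (S^2/2) - T^2/2, - (I*S^2/2) + I*T^2/2],
    [0, 0, I*S^2/2 - I*T^2/2, - (S^2/2) - T^2/2]] ! p ! q"

definition sing_loop :: "'a \<Rightarrow> 'a \<Rightarrow> nat \<Rightarrow> nat \<Rightarrow> 'a::field" where
  "sing_loop S I p q = [
    [1, 0, S, - (I*S)],
    [0, 1, 0, 0],
    [-S, 0, - (S^2/2) + 1, I*S^2/2],
    [I*S, 0, I*S^2/2, S^2/2 + 1]] ! p ! q"

definition mixed_left :: "'a \<Rightarrow> 'a \<Rightarrow> nat \<Rightarrow> nat \<Rightarrow> 'a::field" where
  "mixed_left T I p q = [
    [1, 0, 0, 0, T, I*T],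
    [0, 1, 0, 0, 0, 0],
    [0, 0, 1, 0, 0, 0],
    [0, 0, 0, 1, 0, 0],
    [-T, 0, 0, 0, 1 - T^2/2, - (I*T^2/2)],
    [- (I*T), 0, 0, 0, - (I*T^2/2), 1 + T^2/2]] ! p ! q"

definition mixed_right :: "'a \<Rightarrow> 'a \<Rightarrow> nat \<Rightarrow> nat \<Rightarrow> 'a::field" where
  "mixed_right T I p q = [
    [1, 0, 0, 0, -T, - (I*T)],
    [0, 1, 0, 0, 0, 0],
    [0, 0, 1, 0, 1/2, I/2],
    [0, 0, 0, 1, - (I/2), 1/2],
    [T, 0, - (1/2), I/2, 1 - T^2/2, - (I*T^2/2)],
    [I*T, 0, - (I/2), - (1/2), - (I*T^2/2), 1 + T^2/2]] ! p ! q"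

definition mixed_pair :: "'a \<Rightarrow> 'a \<Rightarrow> nat \<Rightarrow> nat \<Rightarrow> 'a::field" where
  "mixed_pair S I p q = [
    [1, 0, 0, 0, 0, 0],
    [0, 1, 0, 0, 0, 0],
    [0, 0, 1, 0, S^2/2, - (I*S^2/2)],
    [0, 0, 0, 1, - (I*S^2/2), - (S^2/2)],
    [0, 0, - (S^2/2), I*S^2/2, 1, 0],
    [0, 0, I*S^2/2, S^2/2, 0, 1]] ! p ! q"

definition mixed_loop :: "'a \<Rightarrow> 'a \<Rightarrow> nat \<Rightarrow> nat \<Rightarrow> 'a::field" where
  "mixed_loop S I p q = [
    [1, 0, -S, I*S, 0, 0],
    [0, 1, 0, 0, 0, 0],
    [S, 0, - (S^2/2) + 1, I*S^2/2, S^2/2, - (I*S^2/2)],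
    [- (I*S), 0, I*S^2/2, S^2/2 + 1, - (I*S^2/2), - (S^2/2)],
    [0, 0, - (S^2/2), I*S^2/2, 1, 0],
    [0, 0, I*S^2/2, S^2/2, 0, 1]] ! p ! q"

section \<open>Verification of the explicit block identities\<close>

lemma sum_lessThan_4: "(\<Sum>i<4::nat. f i) = f 0 + f 1 + f 2 + (f 3 :: 'a::comm_monoid_add)"
  by (simp add: eval_nat_numeral)

lemma sum_lessThan_6: "(\<Sum>i<6::nat. f i) = f 0 + f 1 + f 2 + f 3 + f 4 + (f 5 :: 'a::comm_monoid_add)"
  by (simp add: eval_nat_numeral)

lemma all_less_4: "(\<forall>p<4. P p) \<longleftrightarrow> P 0 \<and> P 1 \<and> P 2 \<and> P (3::nat)"
  by (simp add: numeral_eq_Suc All_less_Suc conj_ac)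

lemma all_less_6: "(\<forall>p<6. P p) \<longleftrightarrow> P 0 \<and> P 1 \<and> P 2 \<and> P 3 \<and> P 4 \<and> P (5::nat)"
  by (simp add: numeral_eq_Suc All_less_Suc conj_ac)

text \<open>Replacing Laurent series by symbols subject to T S = 1 and I^2 = -1 leaves identities in
  a field, which rewriting with these relations decides.\<close>

context
  fixes T S I :: "'a::field_char_0"
  assumes TS: "T * S = 1" and I: "I * I = -1"
begin

lemma I_I: "I * (I * x) = - x"
  using I by (simp add: mult.assoc[symmetric])

lemma T_S: "T * (S * x) = x" "S * T = 1" "S * (T * x) = x"
  using TS by (simp_all add: mult.assoc[symmetric] mult.commute)

lemma pair_orth:
  "\<forall>p<4. \<forall>q<4. (\<Sum>i<4. pair_left T I i p * pair_left T I i q) = (if p = q then 1 else 0)"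
  "\<forall>p<4. \<forall>q<4. (\<Sum>i<4. pair_right T I i p * pair_right T I i q) = (if p = q then 1 else 0)"
  unfolding all_less_4 sum_lessThan_4 pair_left_def pair_right_def
  by (simp_all add: power2_eq_square field_simps I I_I)

lemma pair_identity:
  "\<forall>p<4. \<forall>q<4. (\<Sum>i<4. pair_left T I p i * pair_torus S T I i q) = (\<Sum>i<4. pair_loop S I p i * pair_right T I q i)"
  unfolding all_less_4 sum_lessThan_4 pair_left_def pair_right_def pair_torus_def pair_loop_def
  by (simp add: power2_eq_square field_simps I I_I TS T_S)

lemma sing_orth:
  "\<forall>p<4. \<forall>q<4. (\<Sum>i<4. sing_left T I i p * sing_left T I i q) = (if p = q then 1 else 0)"
  "\<forall>p<4. \<forall>q<4. (\<Sum>i<4. sing_right T I i p * sing_right T I i q) = (if p = q then 1 else 0)"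
  unfolding all_less_4 sum_lessThan_4 sing_left_def sing_right_def
  by (simp_all add: power2_eq_square field_simps I I_I)

lemma sing_identity:
  "\<forall>p<4. \<forall>q<4. (\<Sum>i<4. sing_left T I p i * sing_torus S T I i q) = (\<Sum>i<4. sing_loop S I p i * sing_right T I q i)"
  unfolding all_less_4 sum_lessThan_4 sing_left_def sing_right_def sing_torus_def sing_loop_def
  by (simp add: power2_eq_square field_simps I I_I TS T_S)

lemma mixed_orth:
  "\<forall>p<6. \<forall>q<6. (\<Sum>i<6. mixed_left T I i p * mixed_left T I i q) = (if p = q then 1 else 0)"
  "\<forall>p<6. \<forall>q<6. (\<Sum>i<6. mixed_right T I i p * mixed_right T I i q) = (if p = q then 1 else 0)"
  unfolding all_less_6 sum_lessThan_6 mixed_left_def mixed_right_def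
  by (simp_all add: power2_eq_square field_simps I I_I)

lemma mixed_identity:
  "\<forall>p<6. \<forall>q<6. (\<Sum>i<6. mixed_left T I p i * mixed_pair S I i q) = (\<Sum>i<6. mixed_loop S I p i * mixed_right T I q i)"
  unfolding all_less_6 sum_lessThan_6 mixed_left_def mixed_right_def mixed_pair_def mixed_loop_def
  by (simp add: power2_eq_square field_simps I I_I TS T_S)

end

section \<open>The explicit blocks as loops\<close>

lemma neg_t_numeral [simp]: "neg_t (numeral n) = numeral n"
  by (metis fls_const_numeral neg_t_const)

lemma neg_t_half [simp]: "neg_t (f / 2) = neg_t f / 2"
proof -
  have "neg_t (f / 2) * 2 = neg_t (f / 2 * 2)" unfolding neg_t_mult by simp
  then show ?thesis by (simp add: field_simps)
qed

lemma fls_nth_half: "fls_nth (f / 2) k = fls_nth f k / (2 :: complex)"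
proof -
  have "fls_nth (2 * (f / 2)) k = 2 * fls_nth (f / 2) k"
    by (simp only: fls_const_numeral[symmetric] fls_mult_const_nth)
  then show ?thesis by simp
qed

lemma ord_ge_0_half [simp, intro]: "ord_ge 0 f \<Longrightarrow> ord_ge 0 (f / 2)"
  by (simp add: ord_ge_def fls_nth_half)

abbreviation fls_ii :: "complex fls" where "fls_ii \<equiv> fls_const \<i>"

lemma fls_ii_square: "fls_ii * fls_ii = -1"
  by (simp add: fls_const_uminus)

lemma X_inverse: "(fls_X :: complex fls) * fls_X_inv = 1"
  by (rule fls_eqI) (simp add: fls_X_times_conv_shift)

abbreviation fmat :: "nat \<Rightarrow> (nat \<Rightarrow> nat \<Rightarrow> 'a) \<Rightarrow> 'a mat" where
  "fmat m f \<equiv> mat m m (\<lambda>(p, q). f p q)"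

lemma fmat_torth_int:
  assumes "\<forall>p<m. \<forall>q<m. (\<Sum>i<m. f i p * f i q) = (if p = q then 1 else 0)"
    and "\<forall>p<m. \<forall>q<m. neg_t (f p q) = tsgn t p * tsgn t q * f p q"
    and "\<forall>p<m. \<forall>q<m. ord_ge 0 (f p q)"
  shows "fmat m f \<in> torth_int t m"
proof (intro torth_intI torthI)
  show "transpose_mat (fmat m f) * fmat m f = 1\<^sub>m m"
  proof (rule eq_matI)
    fix p q assume "p < dim_row (1\<^sub>m m)" "q < dim_col (1\<^sub>m m)"
    then have pq: "p < m" "q < m" by auto
    have "(transpose_mat (fmat m f) * fmat m f) $$ (p, q) = (\<Sum>i<m. transpose_mat (fmat m f) $$ (p, i) * fmat m f $$ (i, q))"
      using pq by (intro square_mult_index) auto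
    also have "\<dots> = (\<Sum>i<m. f i p * f i q)" using pq by (intro sum.cong) auto
    finally show "(transpose_mat (fmat m f) * fmat m f) $$ (p, q) = 1\<^sub>m m $$ (p, q)"
      using assms(1) pq by simp
  qed auto
qed (use assms in auto)

lemma fmat_mult_eq:
  assumes "\<forall>p<m. \<forall>q<m. (\<Sum>i<m. a p i * b i q) = (\<Sum>i<m. c p i * d q i)"
  shows "fmat m a * fmat m b = fmat m c * transpose_mat (fmat m d)"
proof (rule eq_matI)
  fix p q assume "p < dim_row (fmat m c * transpose_mat (fmat m d))" "q < dim_col (fmat m c * transpose_mat (fmat m d))"
  then have pq: "p < m" "q < m" by auto
  have "(fmat m a * fmat m b) $$ (p, q) = (\<Sum>i<m. fmat m a $$ (p, i) * fmat m b $$ (i, q))"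
    using pq by (intro square_mult_index) auto
  also have "\<dots> = (\<Sum>i<m. fmat m c $$ (p, i) * transpose_mat (fmat m d) $$ (i, q))"
    using assms pq by simp
  also have "\<dots> = (fmat m c * transpose_mat (fmat m d)) $$ (p, q)"
    using pq by (intro square_mult_index[symmetric]) auto
  finally show "(fmat m a * fmat m b) $$ (p, q) = (fmat m c * transpose_mat (fmat m d)) $$ (p, q)" .
qed auto

text \<open>The isotropic vector w_1 of plane 1, which up to sign is row 0 of the t^-1 coefficient
  of both \<open>sing_loop\<close> and \<open>mixed_loop\<close>.\<close>

definition pair_vec :: "nat \<Rightarrow> complex" where
  "pair_vec q = (if q = 2 then 1 else if q = 3 then - \<i> else 0)"

lemma rot_torus:
  "rot (- fls_X_intpow 2) (- fls_X_intpow (-2)) 0 0 = - (fls_X_inv^2/2) - fls_X^2/2"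
  "rot (- fls_X_intpow 2) (- fls_X_intpow (-2)) 1 1 = - (fls_X_inv^2/2) - fls_X^2/2"
  "rot (- fls_X_intpow 2) (- fls_X_intpow (-2)) 0 1 = - (fls_ii * fls_X_inv^2/2) + fls_ii * fls_X^2/2"
  "rot (- fls_X_intpow 2) (- fls_X_intpow (-2)) 1 0 = fls_ii * fls_X_inv^2/2 - fls_ii * fls_X^2/2"
proof -
  have X: "fls_X_intpow 2 = (fls_X^2 :: complex fls)" "fls_X_intpow (-2) = (fls_X_inv^2 :: complex fls)"
    by (simp_all add: fls_X_power_conv_shift_1 fls_X_inv_power_conv_shift_1)
  have h: "fls_const (1/2) * f = f / (2 :: complex fls)" for f
    using fls_const_half by (simp add: field_simps)
  have "fls_const (1/(2*\<i>)) = - (fls_ii * fls_const (1/2))"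
    by (simp add: fls_const_uminus[symmetric] del: fls_const_uminus)
  then have i: "fls_const (1/(2*\<i>)) * f = - (fls_ii * f / 2)" for f
    using h[of "fls_ii * f"] by (simp add: mult_ac)
  show "rot (- fls_X_intpow 2) (- fls_X_intpow (-2)) 0 0 = - (fls_X_inv^2/2) - fls_X^2/2"
    "rot (- fls_X_intpow 2) (- fls_X_intpow (-2)) 1 1 = - (fls_X_inv^2/2) - fls_X^2/2"
    "rot (- fls_X_intpow 2) (- fls_X_intpow (-2)) 0 1 = - (fls_ii * fls_X_inv^2/2) + fls_ii * fls_X^2/2"
    "rot (- fls_X_intpow 2) (- fls_X_intpow (-2)) 1 0 = fls_ii * fls_X_inv^2/2 - fls_ii * fls_X^2/2"
    unfolding rot_def h i X by (simp_all add: field_simps)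
qed

text \<open>What remains of the torus element after a leading group of planes that contains plane
  0.\<close>

definition rest_mat :: "nat \<Rightarrow> nat \<Rightarrow> complex fls mat" where
  "rest_mat m c = plane_mat m (\<lambda>b. if b < c then rot (- fls_X_intpow 2) (- fls_X_intpow (-2)) else (\<lambda>p q. if p = q then 1 else 0))"

lemma rest_mat_carrier [simp]: "rest_mat m c \<in> carrier_mat (2*m) (2*m)"
  by (simp add: rest_mat_def)

lemma rest_mat_4: "rest_mat 2 2 = fmat 4 (pair_torus fls_X_inv fls_X fls_ii)"
proof -
  have "\<forall>p<4. \<forall>q<4. rest_mat 2 2 $$ (p, q) = pair_torus fls_X_inv fls_X fls_ii p q"
    unfolding all_less_4 rest_mat_def pair_torus_def
    using rot_torus by (simp add: numeral_3_eq_3)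
  then show ?thesis by (intro eq_matI) (auto simp: rest_mat_def)
qed

lemma nmat_2_1: "nmat 2 1 = fmat 4 (sing_torus fls_X_inv fls_X fls_ii)"
proof -
  have "\<forall>p<4. \<forall>q<4. nmat 2 1 $$ (p, q) = sing_torus fls_X_inv fls_X fls_ii p q"
    unfolding all_less_4 nmat_def sing_torus_def
    using rot_torus by (simp add: nblock_def)
  then show ?thesis by (intro eq_matI) (auto simp: nmat_def)
qed

lemma pair_dcoset: "dcoset False 4 (rest_mat 2 2) (fmat 4 (pair_loop fls_X_inv fls_ii))"
  unfolding rest_mat_4
proof (rule dcosetI)
  note o = pair_orth[OF X_inverse fls_ii_square]
  show "fmat 4 (pair_left fls_X fls_ii) \<in> torth_int False 4"
    by (rule fmat_torth_int[OF o(1)]; unfold all_less_4 pair_left_def) (simp_all add: tsgn_def)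
  show "fmat 4 (pair_right fls_X fls_ii) \<in> torth_int False 4"
    by (rule fmat_torth_int[OF o(2)]; unfold all_less_4 pair_right_def) (simp_all add: tsgn_def)
  show "fmat 4 (pair_left fls_X fls_ii) * fmat 4 (pair_torus fls_X_inv fls_X fls_ii)
      = fmat 4 (pair_loop fls_X_inv fls_ii) * transpose_mat (fmat 4 (pair_right fls_X fls_ii))"
    by (rule fmat_mult_eq[OF pair_identity[OF X_inverse fls_ii_square]])
qed auto

lemma hits_explicit:
  assumes "dcoset t m N (fmat m f)" "\<forall>p<m. \<forall>q<m. deg_le 0 (f p q)"
    "\<forall>p<m. \<forall>q<m. fls_nth (f p q) 0 = (if p = q then 1 else 0)"
    "\<forall>p<m. \<forall>q<m. fls_nth (f p q) (-1) = x $$ (p, q)" "x \<in> carrier_mat m m"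
  shows "hits t m N x"
  unfolding hits_def using assms by (intro bexI[of _ "fmat m f"]) (auto simp: coeff_mat_def intro!: eq_matI)

text \<open>All nonconstant entries of the pair loop are multiples of t^-2, so a pair adds nothing
  to x.\<close>

lemma hits_pair: "hits False 4 (rest_mat 2 2) (0\<^sub>m 4 4)"
  by (rule hits_explicit[OF pair_dcoset]; (unfold all_less_4 pair_loop_def)?)
    (simp_all add: deg_le_def fls_nth_half)

lemma hits_sing: "hits True 4 (nmat 2 1) (xmat 4 pair_vec)"
proof (rule hits_explicit)
  show "dcoset True 4 (nmat 2 1) (fmat 4 (sing_loop fls_X_inv fls_ii))"
    unfolding nmat_2_1
  proof (rule dcosetI)
    note o = sing_orth[OF X_inverse fls_ii_square]
    show "fmat 4 (sing_left fls_X fls_ii) \<in> torth_int True 4"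
      by (rule fmat_torth_int[OF o(1)]; unfold all_less_4 sing_left_def) (simp_all add: tsgn_def)
    show "fmat 4 (sing_right fls_X fls_ii) \<in> torth_int True 4"
      by (rule fmat_torth_int[OF o(2)]; unfold all_less_4 sing_right_def) (simp_all add: tsgn_def)
    show "fmat 4 (sing_left fls_X fls_ii) * fmat 4 (sing_torus fls_X_inv fls_X fls_ii)
        = fmat 4 (sing_loop fls_X_inv fls_ii) * transpose_mat (fmat 4 (sing_right fls_X fls_ii))"
      by (rule fmat_mult_eq[OF sing_identity[OF X_inverse fls_ii_square]])
  qed auto
qed (unfold all_less_4 sing_loop_def, simp_all add: deg_le_def fls_nth_half pair_vec_def)

text \<open>The torus matrix here is \<open>nmat 3 2\<close>, the smallest case in which an even
  \<open>j\<close> allows a nonzero x.\<close>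

lemma hits_mixed: "hits True 6 (dsum 2 4 (1\<^sub>m 2) (rest_mat 2 2)) (xmat 6 (\<lambda>q. - pair_vec q))"
proof (rule hits_explicit)
  note o = mixed_orth[OF X_inverse fls_ii_square]
  have l: "fmat 6 (mixed_left fls_X fls_ii) \<in> torth_int True 6"
    by (rule fmat_torth_int[OF o(1)]; unfold all_less_6 mixed_left_def) (simp_all add: tsgn_def)
  have r: "fmat 6 (mixed_right fls_X fls_ii) \<in> torth_int True 6"
    by (rule fmat_torth_int[OF o(2)]; unfold all_less_6 mixed_right_def) (simp_all add: tsgn_def)
  have c: "rest_mat 2 2 \<in> carrier_mat 4 4" unfolding rest_mat_4 by simp
  have "(1\<^sub>m 2 :: complex fls mat) = 1\<^sub>m 2 * 1\<^sub>m 2 * 1\<^sub>m 2" by simp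
  then have "dcoset True 2 (1\<^sub>m 2) (1\<^sub>m 2)" unfolding dcoset_def using one_torth_int by blast
  from dcoset_dsum[OF this pair_dcoset _ _ c]
  have d: "dcoset True 6 (dsum 2 4 (1\<^sub>m 2) (rest_mat 2 2)) (dsum 2 4 (1\<^sub>m 2) (fmat 4 (pair_loop fls_X_inv fls_ii)))"
    by simp
  have "\<forall>p<6. \<forall>q<6. dsum 2 4 (1\<^sub>m 2) (fmat 4 (pair_loop fls_X_inv fls_ii)) $$ (p, q) = mixed_pair fls_X_inv fls_ii p q"
    unfolding all_less_6 mixed_pair_def pair_loop_def dsum_def by simp
  then have e: "dsum 2 4 (1\<^sub>m 2) (fmat 4 (pair_loop fls_X_inv fls_ii)) = fmat 6 (mixed_pair fls_X_inv fls_ii)"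
    by (intro eq_matI) (auto simp: dsum_def)
  have "fmat 6 (mixed_left fls_X fls_ii) * fmat 6 (mixed_pair fls_X_inv fls_ii) * fmat 6 (mixed_right fls_X fls_ii)
    = fmat 6 (mixed_loop fls_X_inv fls_ii) * (transpose_mat (fmat 6 (mixed_right fls_X fls_ii)) * fmat 6 (mixed_right fls_X fls_ii))"
    unfolding fmat_mult_eq[OF mixed_identity[OF X_inverse fls_ii_square]]
    by (rule assoc_mult_mat[of _ 6 6 _ 6 _ 6]) auto
  also have "\<dots> = fmat 6 (mixed_loop fls_X_inv fls_ii)"
    unfolding torth_inverse[OF torth_int_torth[OF r]] by (rule right_mult_one_mat[of _ 6]) auto
  finally have "fmat 6 (mixed_loop fls_X_inv fls_ii)
    = fmat 6 (mixed_left fls_X fls_ii) * dsum 2 4 (1\<^sub>m 2) (fmat 4 (pair_loop fls_X_inv fls_ii)) * fmat 6 (mixed_right fls_X fls_ii)"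
    unfolding e by simp
  then show "dcoset True 6 (dsum 2 4 (1\<^sub>m 2) (rest_mat 2 2)) (fmat 6 (mixed_loop fls_X_inv fls_ii))"
    using dcoset_mult[OF d l r] dsum_carrier[OF one_carrier_mat[of 2] c] by simp
qed (unfold all_less_6 mixed_loop_def, simp_all add: deg_le_def fls_nth_half pair_vec_def)

section \<open>Assembling the blocks\<close>

lemma rest_mat_0: "rest_mat m 0 = 1\<^sub>m (2*m)"
proof (rule eq_matI)
  fix p q assume "p < dim_row (1\<^sub>m (2*m))" "q < dim_col (1\<^sub>m (2*m))"
  then have pq: "p < 2*m" "q < 2*m" by auto
  have "p div 2 = q div 2 \<and> p mod 2 = q mod 2 \<longleftrightarrow> p = q"
    by (metis mult_div_mod_eq)
  then show "rest_mat m 0 $$ (p, q) = 1\<^sub>m (2*m) $$ (p, q)"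
    using pq by (auto simp: rest_mat_def)
qed (auto simp: rest_mat_def)

lemma rest_mat_step:
  "rest_mat (2 + m) (2 + c) = dsum 4 (2*m) (rest_mat 2 2) (rest_mat m c)"
proof -
  have "plane_mat 2 (\<lambda>b. if b < 2 + c then rot (- fls_X_intpow 2) (- fls_X_intpow (-2)) else (\<lambda>p q. if p = q then 1 else 0)) = rest_mat 2 2"
    unfolding rest_mat_def by (rule plane_mat_cong) simp
  moreover have "plane_mat m (\<lambda>b. if 2 + b < 2 + c then rot (- fls_X_intpow 2) (- fls_X_intpow (-2)) else (\<lambda>p q. if p = q then 1 else 0)) = rest_mat m c"
    unfolding rest_mat_def by (rule plane_mat_cong) simp
  ultimately show ?thesis unfolding rest_mat_def[of "2+m" "2+c"] plane_mat_dsum by simp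
qed

lemma dsum_zero: "dsum a b (0\<^sub>m a a) (0\<^sub>m b b) = 0\<^sub>m (a + b) (a + b)"
  by (simp add: dsum_def)

text \<open>An even number of rotation planes is split into pairs, each with zero t^-1
  coefficient.\<close>

lemma hits_rest:
  assumes "2 * c \<le> m"
  shows "hits False (2*m) (rest_mat m (2*c)) (0\<^sub>m (2*m) (2*m))"
  using assms
proof (induction c arbitrary: m)
  case 0
  then show ?case using hits_one by (simp add: rest_mat_0)
next
  case (Suc c)
  then obtain m' where m: "m = 2 + m'" using le_Suc_ex[of 2 m] by auto
  have c: "rest_mat 2 2 \<in> carrier_mat 4 4" unfolding rest_mat_4 by simp
  have "hits False (4 + 2*m') (dsum 4 (2*m') (rest_mat 2 2) (rest_mat m' (2*c))) (dsum 4 (2*m') (0\<^sub>m 4 4) (0\<^sub>m (2*m') (2*m')))"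
    using Suc m by (intro hits_dsum hits_pair c) auto
  then show ?case using m by (simp add: rest_mat_step dsum_zero)
qed

text \<open>The first \<open>a\<close> planes include plane 0 and hence a - 1 rotations, which
  leaves j + 1 - a; the bound on \<open>a\<close> makes the subtraction exact.\<close>

lemma nmat_dsum:
  assumes "1 \<le> a" "a \<le> j + 1"
  shows "nmat (a + m) j = dsum (2*a) (2*m) (nmat a j) (rest_mat m (j + 1 - a))"
proof -
  have "plane_mat m (\<lambda>i. nblock j (a + i)) = rest_mat m (j + 1 - a)"
    unfolding rest_mat_def using assms by (intro plane_mat_cong) (auto simp: nblock_def)
  then show ?thesis unfolding nmat_def plane_mat_dsum by simp
qed

text \<open>Once every plane other than 0 is a rotation, the exponent is visible only in the sign on
  plane 0.\<close>

lemma nmat_sign: "even i = even j \<Longrightarrow> m \<le> Suc i \<Longrightarrow> m \<le> Suc j \<Longrightarrow> nmat m i = nmat m j"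
  unfolding nmat_def by (rule plane_mat_cong) (auto simp: nblock_def)

lemma nmat_1_even: "even j \<Longrightarrow> nmat 1 j = 1\<^sub>m 2"
  unfolding nmat_def by (intro eq_matI) (auto simp: nblock_def less_2_cases_iff)

text \<open>The single block takes planes 0 and 1; the other j - 1 rotations are grouped in
  pairs.\<close>

lemma hits_odd:
  assumes "odd j" "j \<le> l"
  shows "hits True (2*l+2) (nmat (l+1) j) (xmat (2*l+2) pair_vec)"
proof -
  obtain c where c: "j = 2*c + 1" using assms(1) by (elim oddE)
  obtain m where m: "l = m + 1" using assms(2) c by (cases l) auto
  have "nmat (2 + m) j = dsum 4 (2*m) (nmat 2 j) (rest_mat m (2*c))"
    using nmat_dsum[of 2 j m] c by simp
  also have "nmat 2 j = nmat 2 1" using c by (intro nmat_sign) auto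
  finally have n: "nmat (2 + m) j = dsum 4 (2*m) (nmat 2 1) (rest_mat m (2*c))" .
  have "hits True (4 + 2*m) (dsum 4 (2*m) (nmat 2 1) (rest_mat m (2*c))) (dsum 4 (2*m) (xmat 4 pair_vec) (0\<^sub>m (2*m) (2*m)))"
    using assms(2) c m nmat_carrier[of 2 1] by (intro hits_dsum hits_sing hits_rest) auto
  moreover have "dsum 4 (2*m) (xmat 4 pair_vec) (0\<^sub>m (2*m) (2*m)) = xmat (4 + 2*m) pair_vec"
    by (rule xmat_dsum[symmetric]) (auto simp: pair_vec_def)
  moreover have "2*l+2 = 4 + 2*m" "l + 1 = 2 + m" using m by auto
  ultimately show ?thesis unfolding n[symmetric] by metis
qed

lemma hits_even_zero:
  assumes "even j" "j \<le> l"
  shows "hits True (2*l+2) (nmat (l+1) j) (0\<^sub>m (2*l+2) (2*l+2))"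
proof -
  obtain c where c: "j = 2*c" using assms(1) by (elim evenE)
  have n: "nmat (1 + l) j = dsum 2 (2*l) (1\<^sub>m 2) (rest_mat l (2*c))"
    using nmat_dsum[of 1 j l] nmat_1_even[OF assms(1)] c by simp
  have "hits True (2 + 2*l) (dsum 2 (2*l) (1\<^sub>m 2) (rest_mat l (2*c))) (dsum 2 (2*l) (0\<^sub>m 2 2) (0\<^sub>m (2*l) (2*l)))"
    using assms(2) c by (intro hits_dsum hits_one hits_rest) auto
  then show ?thesis unfolding n[symmetric] dsum_zero by (simp add: add.commute)
qed

text \<open>The mixed block takes planes 0, 1 and 2; the other j - 2 rotations are grouped in
  pairs.\<close>

lemma hits_even:
  assumes "even j" "2 \<le> j" "j \<le> l"
  shows "hits True (2*l+2) (nmat (l+1) j) (xmat (2*l+2) (\<lambda>q. - pair_vec q))"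
proof -
  obtain d where d: "j = 2*d" using assms(1) by (elim evenE)
  define c where "c = d - 1"
  have c: "j = 2*c + 2" using d assms(2) by (simp add: c_def)
  obtain m where m: "l = m + 2" using assms(2,3) le_Suc_ex[of 2 l] by auto
  have "nmat 3 j = dsum 2 4 (nmat 1 j) (rest_mat 2 j)" using nmat_dsum[of 1 j 2] assms(2) by simp
  also have "rest_mat 2 j = rest_mat 2 2" unfolding rest_mat_def using assms(2) by (intro plane_mat_cong) auto
  finally have n3: "nmat 3 j = dsum 2 4 (1\<^sub>m 2) (rest_mat 2 2)" unfolding nmat_1_even[OF assms(1)] .
  have n: "nmat (3 + m) j = dsum 6 (2*m) (nmat 3 j) (rest_mat m (2*c))"
    using nmat_dsum[of 3 j m] c by simp
  have "hits True (6 + 2*m) (dsum 6 (2*m) (nmat 3 j) (rest_mat m (2*c))) (dsum 6 (2*m) (xmat 6 (\<lambda>q. - pair_vec q)) (0\<^sub>m (2*m) (2*m)))"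
    using assms(3) c m nmat_carrier[of 3 j] hits_mixed[folded n3] by (intro hits_dsum hits_rest) auto
  moreover have "dsum 6 (2*m) (xmat 6 (\<lambda>q. - pair_vec q)) (0\<^sub>m (2*m) (2*m)) = xmat (6 + 2*m) (\<lambda>q. - pair_vec q)"
    by (rule xmat_dsum[symmetric]) (auto simp: pair_vec_def)
  moreover have "2*l+2 = 6 + 2*m" "l + 1 = 3 + m" using m by auto
  ultimately show ?thesis unfolding n[symmetric] by metis
qed

section \<open>Transitivity on isotropic vectors\<close>

definition reflect :: "nat \<Rightarrow> (nat \<Rightarrow> complex) \<Rightarrow> (nat \<Rightarrow> complex) \<Rightarrow> nat \<Rightarrow> complex" where
  "reflect n a v = (\<lambda>p. v p - 2 * dot n a v / dot n a a * a p)"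

definition reflect_mat :: "nat \<Rightarrow> (nat \<Rightarrow> complex) \<Rightarrow> complex mat" where
  "reflect_mat n a = mat n n (\<lambda>(p, q). (if p = q then 1 else 0) - 2 / dot n a a * (a p * a q))"

lemma dot_commute: "dot n a b = dot n b a"
  by (simp add: dot_def mult.commute)

lemma dot_add: "dot n a (\<lambda>i. b i + c i) = dot n a b + dot n a c"
  and dot_diff: "dot n a (\<lambda>i. b i - c i) = dot n a b - dot n a c"
  and dot_scale: "dot n a (\<lambda>i. r * b i) = r * dot n a b"
  by (simp_all add: dot_def distrib_left right_diff_distrib sum.distrib sum_subtractf sum_distrib_left mult.left_commute)

text \<open>Because \<open>a 0 = 0\<close>, the reflection R fixes e_0, so conjugating e_0 v^T - v
  e_0^T by R only replaces v by R v.\<close>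

lemma hits_reflect:
  assumes h: "hits True m N (xmat m v)" and N: "N \<in> carrier_mat m m" and a: "a 0 = 0" "dot m a a \<noteq> 0" and v: "v 0 = 0"
  shows "hits True m N (xmat m (reflect m a v))"
proof -
  let ?R = "reflect_mat m a"
  define c where "c = 2 / dot m a a"
  have c2: "c * dot m a a = 2" using a(2) by (simp add: c_def)
  have R: "?R \<in> carrier_mat m m" by (simp add: reflect_mat_def)
  have Ri: "?R $$ (p, q) = (if p = q then 1 else 0) - c * (a p * a q)" if "p < m" "q < m" for p q
    using that by (simp add: reflect_mat_def c_def)
  have RT: "transpose_mat ?R \<in> carrier_mat m m" using R by simp
  have o: "transpose_mat ?R * ?R = 1\<^sub>m m"
  proof (rule eq_matI)
    fix p q assume "p < dim_row (1\<^sub>m m)" "q < dim_col (1\<^sub>m m)"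
    then have pq: "p < m" "q < m" by auto
    have "(transpose_mat ?R * ?R) $$ (p, q) = (\<Sum>i<m. ?R $$ (i, p) * ?R $$ (i, q))"
      using R pq square_mult_index[of "transpose_mat ?R" m ?R p q] by simp
    also have "\<dots> = (\<Sum>i<m. (if i = p then (if p = q then 1 else 0) - c * (a p * a q) else 0)
        - (if i = q then c * (a p * a q) else 0) + c * c * (a p * a q) * (a i * a i))"
      using pq by (intro sum.cong refl) (auto simp: Ri algebra_simps)
    also have "\<dots> = (if p = q then 1 else 0) - c * (a p * a q) - c * (a p * a q) + c * c * (a p * a q) * dot m a a"
      using pq by (simp add: sum.distrib sum_subtractf dot_def sum_distrib_left)
    also have "c * c * (a p * a q) * dot m a a = c * (a p * a q) * (c * dot m a a)" by (simp only: mult_ac)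
    also have "(if p = q then 1 else 0) - c * (a p * a q) - c * (a p * a q) + c * (a p * a q) * (c * dot m a a) = (if p = q then 1 else 0)"
      unfolding c2 by simp
    finally show "(transpose_mat ?R * ?R) $$ (p, q) = 1\<^sub>m m $$ (p, q)" using pq by simp
  qed (use R in auto)
  have "?R * xmat m v * transpose_mat ?R = xmat m (reflect m a v)"
  proof (rule eq_matI)
    fix p q assume "p < dim_row (xmat m (reflect m a v))" "q < dim_col (xmat m (reflect m a v))"
    then have pq: "p < m" "q < m" by auto
    have Rv: "(\<Sum>i<m. ?R $$ (p, i) * v i) = reflect m a v p" if p: "p < m" for p
    proof -
      have "(\<Sum>i<m. ?R $$ (p, i) * v i) = (\<Sum>i<m. (if i = p then v p else 0) - c * a p * (a i * v i))"
        using p by (intro sum.cong refl) (auto simp: Ri algebra_simps)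
      also have "\<dots> = reflect m a v p"
        unfolding sum_subtractf sum_distrib_left[symmetric] dot_def[symmetric]
        using p by (simp add: reflect_def c_def)
      finally show ?thesis .
    qed
    have R0: "?R $$ (p, 0) = (if p = 0 then 1 else 0)" if "p < m" for p
      using that a(1) by (simp add: Ri)
    have "(?R * xmat m v * transpose_mat ?R) $$ (p, q) = (\<Sum>i<m. \<Sum>k<m. ?R $$ (p, i) * xmat m v $$ (i, k) * transpose_mat ?R $$ (k, q))"
      by (rule mult3_index[OF R xmat_carrier RT pq])
    also have "\<dots> = (\<Sum>i<m. \<Sum>k<m. ?R $$ (p, i) * xmat m v $$ (i, k) * ?R $$ (q, k))"
      using R pq by (intro sum.cong refl) simp
    also have "\<dots> = (\<Sum>i<m. (if i = 0 then ?R $$ (p, 0) * (\<Sum>k<m. ?R $$ (q, k) * v k) else 0) - ?R $$ (p, i) * v i * ?R $$ (q, 0))"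
    proof (rule sum.cong[OF refl])
      fix i assume "i \<in> {..<m}"
      then have i: "i < m" by simp
      have "(\<Sum>k<m. ?R $$ (p, i) * xmat m v $$ (i, k) * ?R $$ (q, k))
        = (\<Sum>k<m. (if i = 0 then ?R $$ (p, 0) * (?R $$ (q, k) * v k) else 0) - (if k = 0 then ?R $$ (p, i) * v i * ?R $$ (q, 0) else 0))"
        using i by (intro sum.cong refl) (auto simp: algebra_simps)
      also have "\<dots> = (if i = 0 then ?R $$ (p, 0) * (\<Sum>k<m. ?R $$ (q, k) * v k) else 0) - ?R $$ (p, i) * v i * ?R $$ (q, 0)"
        using i by (simp add: sum_subtractf sum_distrib_left)
      finally show "(\<Sum>k<m. ?R $$ (p, i) * xmat m v $$ (i, k) * ?R $$ (q, k))
        = (if i = 0 then ?R $$ (p, 0) * (\<Sum>k<m. ?R $$ (q, k) * v k) else 0) - ?R $$ (p, i) * v i * ?R $$ (q, 0)" .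
    qed
    also have "\<dots> = ?R $$ (p, 0) * (\<Sum>k<m. ?R $$ (q, k) * v k) - (\<Sum>i<m. ?R $$ (p, i) * v i) * ?R $$ (q, 0)"
      using pq by (simp add: sum_subtractf sum_distrib_right)
    also have "\<dots> = xmat m (reflect m a v) $$ (p, q)"
      unfolding Rv[OF pq(1)] Rv[OF pq(2)] R0[OF pq(1)] R0[OF pq(2)] using pq by simp
    finally show "(?R * xmat m v * transpose_mat ?R) $$ (p, q) = xmat m (reflect m a v) $$ (p, q)" .
  qed (use R in auto)
  moreover have "?R $$ (p, q) = 0" if "p < m" "q < m" "(p = 0) \<noteq> (q = 0)" for p q
    using that a(1) by (auto simp: Ri)
  ultimately show ?thesis using hits_conj[OF h N R o] by simp
qed

text \<open>The difference of two isotropic vectors has square -2 (v.w), so it defines a reflection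
  as soon as v.w is nonzero.\<close>

lemma reflect_isotropic:
  assumes "dot n v v = 0" "dot n w w = 0" "dot n v w \<noteq> 0"
  shows "reflect n (\<lambda>i. w i - v i) v = w" "dot n (\<lambda>i. w i - v i) (\<lambda>i. w i - v i) \<noteq> 0"
proof -
  have wv: "dot n w v = dot n v w" by (rule dot_commute)
  have d: "dot n (\<lambda>i. w i - v i) v = dot n v w" "dot n (\<lambda>i. w i - v i) w = - dot n v w"
    unfolding dot_commute[of n "\<lambda>i. w i - v i"] dot_diff assms wv by simp_all
  have dd: "dot n (\<lambda>i. w i - v i) (\<lambda>i. w i - v i) = - 2 * dot n v w"
    unfolding dot_diff[of n _ w v] d by simp
  show "dot n (\<lambda>i. w i - v i) (\<lambda>i. w i - v i) \<noteq> 0" unfolding dd using assms(3) by simp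
  show "reflect n (\<lambda>i. w i - v i) v = w"
    unfolding reflect_def d dd using assms(3) by (intro ext) simp
qed

lemma isotropic_partner:
  assumes "v 0 = 0" "dot n v v = 0" "\<exists>q<n. v q \<noteq> 0"
  obtains a where "a 0 = 0" "dot n a a = 0" "dot n a v = 1"
proof -
  obtain r where r: "r < n" "v r \<noteq> 0" using assms(3) by blast
  then have r0: "r \<noteq> 0" using assms(1) by metis
  define b where "b = (\<lambda>i. if i = r then 1 / v r else 0)"
  have bv: "dot n v b = 1"
  proof -
    have "dot n v b = (\<Sum>i<n. if i = r then 1 else 0)"
      unfolding dot_def b_def using r by (intro sum.cong) auto
    then show ?thesis using r by simp
  qed
  \<comment> \<open>Since b.v = 1 and v is isotropic, subtracting half of b.b times v removes the
    square of b and keeps the pairing with v.\<close>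
  define a where "a = (\<lambda>i. b i - dot n b b / 2 * v i)"
  have va: "dot n v a = 1" unfolding a_def dot_diff dot_scale bv assms by simp
  have "dot n b a = dot n b b / 2" unfolding a_def dot_diff dot_scale dot_commute[of n b v] bv by simp
  moreover have "dot n a a = dot n a b - dot n b b / 2 * dot n a v"
    unfolding a_def dot_diff[of n "\<lambda>i. b i - dot n b b / 2 * v i"] dot_scale ..
  ultimately have "dot n a a = 0" using va dot_commute[of n a b] dot_commute[of n a v] by simp
  moreover have "a 0 = 0" using r0 assms(1) by (simp add: a_def b_def)
  ultimately show thesis using that va dot_commute[of n a v] by metis
qed

text \<open>One reflection is enough if v.w is nonzero. Otherwise two are used, through an isotropic
  z that pairs nontrivially with both vectors.\<close>

lemma hits_isotropic:
  assumes h: "hits True m N (xmat m v)" and N: "N \<in> carrier_mat m m"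
    and v: "v 0 = 0" "dot m v v = 0" "\<exists>q<m. v q \<noteq> 0"
    and w: "w 0 = 0" "dot m w w = 0" "\<exists>q<m. w q \<noteq> 0"
  shows "hits True m N (xmat m w)"
proof -
  have step: "hits True m N (xmat m z')"
    if "hits True m N (xmat m z)" "z 0 = 0" "z' 0 = 0" "dot m z z = 0" "dot m z' z' = 0" "dot m z z' \<noteq> 0" for z z'
    using hits_reflect[OF that(1) N, of "\<lambda>i. z' i - z i"] reflect_isotropic[OF that(4,5,6)] that(2,3) by simp
  obtain a where a: "a 0 = 0" "dot m a a = 0" "dot m a v = 1" using isotropic_partner[OF v] by blast
  obtain b where b: "b 0 = 0" "dot m b b = 0" "dot m b w = 1" using isotropic_partner[OF w] by blast
  have sym: "dot m v a = 1" using a dot_commute by metis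
  consider "dot m v w \<noteq> 0" | "dot m a w \<noteq> 0" | "dot m b v \<noteq> 0"
    | "dot m v w = 0" "dot m a w = 0" "dot m b v = 0" by blast
  then have "\<exists>z. z 0 = 0 \<and> dot m z z = 0 \<and> dot m v z \<noteq> 0 \<and> dot m z w \<noteq> 0 \<or> dot m v w \<noteq> 0"
  proof cases
    case 1
    then show ?thesis by blast
  next
    case 2
    then show ?thesis using a sym by (intro exI[of _ a]) simp
  next
    case 3
    then show ?thesis using b dot_commute[of m v b] by (intro exI[of _ b]) simp
  next
    case 4
    define c where "c = dot m a b"
    \<comment> \<open>In this case a + b pairs to 1 with v and with w but has square 2c. Subtracting
      c v cancels the square and changes neither pairing, as v.v = v.w = 0.\<close>
    define z where "z = (\<lambda>i. (a i + b i) - c * v i)"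
    have dz: "dot m y z = dot m y a + dot m y b - c * dot m y v" for y
      unfolding z_def dot_diff dot_scale dot_add ..
    have za: "dot m a z = 0" unfolding dz using a by (simp add: c_def)
    have zb: "dot m b z = c" unfolding dz using b 4 dot_commute[of m b a] by (simp add: c_def)
    have zv: "dot m v z = 1" unfolding dz using 4 sym v dot_commute[of m v b] by simp
    have zw: "dot m w z = 1" unfolding dz using 4 b dot_commute[of m w a] dot_commute[of m w b] dot_commute[of m w v] by simp
    have "dot m z z = dot m z a + dot m z b - c * dot m z v" by (rule dz)
    then have "dot m z z = 0" using za zb zv dot_commute[of m z a] dot_commute[of m z b] dot_commute[of m z v] by simp
    moreover have "z 0 = 0" using a b v by (simp add: z_def)
    ultimately show ?thesis using zv zw dot_commute[of m z w] by (intro exI[of _ z]) simp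
  qed
  then obtain z where "z 0 = 0 \<and> dot m z z = 0 \<and> dot m v z \<noteq> 0 \<and> dot m z w \<noteq> 0 \<or> dot m v w \<noteq> 0" by blast
  then show ?thesis using step h v w by metis
qed

lemma pair_vec_props:
  assumes "4 \<le> n"
  shows "pair_vec 0 = 0" "dot n pair_vec pair_vec = 0" "\<exists>q<n. pair_vec q \<noteq> 0"
proof -
  obtain k where n: "n = 4 + k" using assms le_Suc_ex by blast
  have "dot n pair_vec pair_vec = (\<Sum>i<4. pair_vec i * pair_vec i) + (\<Sum>i\<in>{4..<4+k}. pair_vec i * pair_vec i)"
    unfolding dot_def n lessThan_atLeast0 by (rule sum.atLeastLessThan_concat[symmetric]) simp_all
  also have "(\<Sum>i\<in>{4..<4+k}. pair_vec i * pair_vec i) = 0" by (intro sum.neutral) (auto simp: pair_vec_def)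
  also have "(\<Sum>i<4. pair_vec i * pair_vec i) = 0" unfolding sum_lessThan_4 by (simp add: pair_vec_def)
  finally show "dot n pair_vec pair_vec = 0" by simp
  show "\<exists>q<n. pair_vec q \<noteq> 0" using assms by (intro exI[of _ 2]) (simp add: pair_vec_def)
qed (simp add: pair_vec_def)

lemma hits_nilp:
  assumes l: "1 \<le> l" and j: "1 \<le> j" "j \<le> l" and x: "x \<in> nilp_p l" and odd: "odd j \<Longrightarrow> x \<noteq> 0\<^sub>m (2*l+2) (2*l+2)"
  shows "hits True (2*l+2) (nmat (l+1) j) x"
proof (cases "x = 0\<^sub>m (2*l+2) (2*l+2)")
  case True
  then show ?thesis using hits_even_zero odd j by blast
next
  case False
  let ?n = "2*l+2"
  obtain v where v: "v 0 = 0" "dot ?n v v = 0" "x = xmat ?n v" using x unfolding nilp_p_iff by blast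
  have nz: "\<exists>q<?n. v q \<noteq> 0"
  proof (rule ccontr)
    assume "\<not> (\<exists>q<?n. v q \<noteq> 0)"
    then have "xmat ?n v = 0\<^sub>m ?n ?n" by (intro eq_matI) auto
    then show False using False v(3) by simp
  qed
  have N: "nmat (l+1) j \<in> carrier_mat ?n ?n" using nmat_carrier[of "l+1" j] by (simp add: add.commute)
  have n4: "4 \<le> ?n" using l by simp
  note pv = pair_vec_props[OF n4]
  show ?thesis
  proof (cases "odd j")
    case True
    then show ?thesis unfolding v(3)
      using hits_isotropic[OF hits_odd[OF True j(2)] N pv v(1,2) nz] by simp
  next
    case False
    then have "2 \<le> j" using j(1) by (cases "j = 1") auto
    have d: "dot ?n (\<lambda>q. - pair_vec q) (\<lambda>q. - pair_vec q) = 0" using pv(2) by (simp add: dot_def)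
    show ?thesis unfolding v(3)
      using False \<open>2 \<le> j\<close> j(2) pv d by (intro hits_isotropic[OF hits_even N _ d _ v(1,2) nz]) auto
  qed
qed

section \<open>The intersections with the opposite cell\<close>

text \<open>
  This reflection commutes with the torus elements, so the determinants of both outer factors of a
  double coset decomposition can be corrected at the same time.
\<close>

definition orient :: "nat \<Rightarrow> complex fls mat" where
  "orient n = mat n n (\<lambda>(p, q). if p = q then if p = 1 then -1 else 1 else 0)"

lemma orient_mult_index:
  assumes "A \<in> carrier_mat n n" "p < n" "q < n"
  shows "(orient n * A) $$ (p, q) = (if p = 1 then - A $$ (p, q) else A $$ (p, q))"
    "(A * orient n) $$ (p, q) = (if q = 1 then - A $$ (p, q) else A $$ (p, q))"
proof -
  have c: "orient n \<in> carrier_mat n n" by (simp add: orient_def)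
  have "(orient n * A) $$ (p, q) = (\<Sum>i<n. if i = p then (if p = 1 then - A $$ (p, q) else A $$ (p, q)) else 0)"
    unfolding square_mult_index[OF c assms] using assms by (intro sum.cong) (auto simp: orient_def)
  then show "(orient n * A) $$ (p, q) = (if p = 1 then - A $$ (p, q) else A $$ (p, q))" using assms by simp
  have "(A * orient n) $$ (p, q) = (\<Sum>i<n. if i = q then (if q = 1 then - A $$ (p, q) else A $$ (p, q)) else 0)"
    unfolding square_mult_index[OF assms(1) c assms(2,3)] using assms by (intro sum.cong) (auto simp: orient_def)
  then show "(A * orient n) $$ (p, q) = (if q = 1 then - A $$ (p, q) else A $$ (p, q))" using assms by simp
qed

lemma orient_square: "orient n * orient n = 1\<^sub>m n"
proof (rule eq_matI)
  have c: "orient n \<in> carrier_mat n n" by (simp add: orient_def)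
  fix p q assume "p < dim_row (1\<^sub>m n)" "q < dim_col (1\<^sub>m n)"
  then have pq: "p < n" "q < n" by auto
  show "(orient n * orient n) $$ (p, q) = 1\<^sub>m n $$ (p, q)"
    unfolding orient_mult_index(1)[OF c pq] using pq by (auto simp: orient_def)
qed (auto simp: orient_def)

lemma orient_torth_int: "orient n \<in> torth_int t n"
proof (intro torth_intI torthI)
  have "transpose_mat (orient n) = orient n" by (intro eq_matI) (auto simp: orient_def)
  then show "transpose_mat (orient n) * orient n = 1\<^sub>m n" by (simp add: orient_square)
qed (auto simp: orient_def)

lemma det_orient:
  assumes "2 \<le> n"
  shows "det (orient n) = -1"
proof -
  have "det (orient n) = prod_list (diag_mat (orient n))"
    by (rule det_upper_triangular[of _ n]) (auto simp: orient_def)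
  also have "\<dots> = (\<Prod>i<n. orient n $$ (i, i))"
    by (simp add: prod_list_diag_prod lessThan_atLeast0 orient_def)
  also have "\<dots> = (\<Prod>i<n. if i = 1 then -1 else 1)"
    by (intro prod.cong) (auto simp: orient_def)
  also have "\<dots> = -1" using assms by (simp add: prod.delta)
  finally show ?thesis .
qed

text \<open>The torus element is scalar on plane 0, and no other plane involves index 1.\<close>

lemma nmat_orient: "nmat m j * orient (2*m) = orient (2*m) * nmat m j"
proof (rule eq_matI)
  fix p q assume "p < dim_row (orient (2*m) * nmat m j)" "q < dim_col (orient (2*m) * nmat m j)"
  then have pq: "p < 2*m" "q < 2*m" by (auto simp: orient_def nmat_def)
  have "nmat m j $$ (p, q) = 0" if "(p = 1) \<noteq> (q = 1)"
  proof (cases "p div 2 = q div 2 \<and> p div 2 = 0")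
    case True
    then show ?thesis using pq that by (auto simp: nmat_def nblock_def)
  next
    case False
    then show ?thesis using pq that by (auto simp: nmat_def)
  qed
  then show "(nmat m j * orient (2*m)) $$ (p, q) = (orient (2*m) * nmat m j) $$ (p, q)"
    unfolding orient_mult_index[OF nmat_carrier pq] by auto
qed (auto simp: orient_def nmat_def)

lemma torth_det: "k \<in> torth t m \<Longrightarrow> det k = 1 \<or> det k = -1"
proof -
  assume k: "k \<in> torth t m"
  note c = torth_carrier[OF k]
  have "det (transpose_mat k) * det k = 1"
    using det_mult[of "transpose_mat k" m k] c torth_inverse[OF k] by simp
  then have "det k * det k = 1" unfolding det_transpose[OF c] .
  then show ?thesis by (simp add: square_eq_1_iff)
qed

text \<open>The determinants of the outer factors multiply to 1, so they are both 1 or both -1; in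
  the second case \<open>orient\<close> is inserted on both sides of the torus element.\<close>

lemma hits_GO:
  assumes h: "hits True (2*l+2) (nmat (l+1) j) x"
  obtains g k k' where "g \<in> GOminus0 l" "k \<in> GO l" "k' \<in> GO l" "g = k * nmat (l+1) j * k'" "coeff_mat (-1) g = x"
proof -
  let ?n = "2*l+2"
  let ?N = "nmat (l+1) j"
  obtain G where G: "G \<in> carrier_mat ?n ?n" "dcoset True ?n ?N G" "\<And>p q. p < ?n \<Longrightarrow> q < ?n \<Longrightarrow> deg_le 0 (G $$ (p, q))"
      "coeff_mat 0 G = 1\<^sub>m ?n" "coeff_mat (-1) G = x"
    using h unfolding hits_def by blast
  obtain K K' where K: "K \<in> torth_int True ?n" "K' \<in> torth_int True ?n" "G = K * ?N * K'"
    using G(2) unfolding dcoset_def by blast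
  have n2: "2 * (l + 1) = ?n" by simp
  have N: "?N \<in> torth True ?n" using nmat_torth[of "l+1" j] unfolding n2 .
  note c = K(1,2)[THEN torth_int_carrier] torth_carrier[OF N]
  \<comment> \<open>An orthogonal loop has determinant 1 or -1, and the sign is decided at infinity,
    where \<open>G\<close> is the identity.\<close>
  have "fls_nth (det G) 0 = det (coeff_mat 0 G)" using det_coeff_mat_0[OF G(1,3)] .
  then have d0: "fls_nth (det G) 0 = 1" unfolding G(4) by simp
  have dG: "det G = det K * det K'"
    unfolding K(3) using det_mult[OF mult_carrier_mat[OF c(1,3)] c(2)] det_mult[OF c(1,3)] det_nmat[of "l+1" j] by simp
  have T: "G \<in> torth True ?n" unfolding K(3) 
    by (intro torth_mult torth_int_torth[OF K(1)] torth_int_torth[OF K(2)] N)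
  then have "det G = 1" using torth_det[OF T] d0 by auto
  then have "G \<in> GOminus0 l" using T G unfolding GOminus0_def GOminus_iff by auto
  moreover have "\<exists>k\<in>GO l. \<exists>k'\<in>GO l. G = k * ?N * k'"
  proof (cases "det K = 1")
    case True
    then have "det K' = 1" using dG \<open>det G = 1\<close> by simp
    then have "K \<in> GO l" "K' \<in> GO l" unfolding GO_iff using True K(1,2) by auto
    then show ?thesis using K(3) by blast
  next
    case False
    then have dK: "det K = -1" using torth_det[OF torth_int_torth[OF K(1)]] by blast
    then have "- det K' = 1" using dG \<open>det G = 1\<close> by simp
    then have dK': "det K' = -1" by (metis minus_minus)
    let ?r = "orient ?n"
    have r: "?r \<in> torth_int True ?n" by (rule orient_torth_int)
    note rc = torth_int_carrier[OF r]
    have dr: "det ?r = -1" by (rule det_orient) simp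
    have "det (K * ?r) = 1" "det (?r * K') = 1"
      using det_mult[OF c(1) rc] det_mult[OF rc c(2)] dK dK' dr by simp_all
    then have go: "K * ?r \<in> GO l" "?r * K' \<in> GO l"
      unfolding GO_iff using torth_int_mult[OF K(1) r] torth_int_mult[OF r K(2)] by auto
    have "K * ?r * ?N * (?r * K') = K * (?r * ?N) * (?r * K')"
      using c rc by (simp only: assoc_mult_mat[OF c(1) rc c(3)])
    also have "?r * ?N = ?N * ?r" using nmat_orient[of "l+1" j] unfolding n2 by simp
    also have "K * (?N * ?r) = K * ?N * ?r" by (rule assoc_mult_mat[OF c(1,3) rc, symmetric])
    also have "K * ?N * ?r * (?r * K') = K * ?N * (?r * (?r * K'))"
      by (rule assoc_mult_mat[OF mult_carrier_mat[OF c(1,3)] rc mult_carrier_mat[OF rc c(2)]])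
    also have "?r * (?r * K') = ?r * ?r * K'" by (rule assoc_mult_mat[OF rc rc c(2), symmetric])
    also have "\<dots> = K'" unfolding orient_square using c(2) by simp
    finally show ?thesis using go K(3) by metis
  qed
  ultimately show thesis using that G(5) by blast
qed

section \<open>Morphisms given by polynomials\<close>

lemma poly_funs_sum: "(\<And>i. i \<in> A \<Longrightarrow> f i \<in> poly_funs C) \<Longrightarrow> (\<lambda>z. \<Sum>i\<in>A. f i z) \<in> poly_funs C"
proof (induction A rule: infinite_finite_induct)
  case (insert i A)
  then show ?case using poly_funs.add[of "f i" C "\<lambda>z. \<Sum>i\<in>A. f i z"] by simp
qed (simp_all add: poly_funs.const)

lemma poly_funs_pullback:
  assumes "\<And>f. f \<in> D \<Longrightarrow> \<exists>f'\<in>poly_funs C. \<forall>z\<in>Z. f (\<phi> z) = f' z" and "f \<in> poly_funs D"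
  shows "\<exists>f'\<in>poly_funs C. \<forall>z\<in>Z. f (\<phi> z) = f' z"
  using assms(2)
proof induction
  case (const a)
  then show ?case using poly_funs.const[of a C] by (intro bexI[of _ "\<lambda>_. a"]) auto
next
  case (coord f)
  then show ?case by (rule assms(1))
next
  case (add f g)
  then obtain f' g' where "f' \<in> poly_funs C" "g' \<in> poly_funs C" "\<forall>z\<in>Z. f (\<phi> z) = f' z" "\<forall>z\<in>Z. g (\<phi> z) = g' z"
    by blast
  then show ?case using poly_funs.add[of f' C g'] by (intro bexI[of _ "\<lambda>z. f' z + g' z"]) auto
next
  case (mult f g)
  then obtain f' g' where "f' \<in> poly_funs C" "g' \<in> poly_funs C" "\<forall>z\<in>Z. f (\<phi> z) = f' z" "\<forall>z\<in>Z. g (\<phi> z) = g' z"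
    by blast
  then show ?case using poly_funs.mult[of f' C g'] by (intro bexI[of _ "\<lambda>z. f' z * g' z"]) auto
qed

text \<open>Substitution carries defining polynomials and local fractions back along the map, so it
  suffices to express the target coordinates by polynomials. They need to agree only on
  \<open>Z\<close>, which allows using the shape of its points.\<close>

lemma variety_morphismI:
  assumes im: "\<phi> ` Z \<subseteq> W" and D: "\<And>f. f \<in> D \<Longrightarrow> \<exists>f'\<in>poly_funs C. \<forall>z\<in>Z. f (\<phi> z) = f' z"
  shows "variety_morphism C Z D W \<phi>"
proof -
  have pull: "\<exists>f'\<in>poly_funs C. \<forall>z\<in>Z. f (\<phi> z) = f' z" if "f \<in> poly_funs D" for f
    using D that by (rule poly_funs_pullback)
  have "zariski_open_in C Z {z \<in> Z. \<phi> z \<in> U}" if U: "zariski_open_in D W U" for U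
  proof -
    obtain F where F: "F \<subseteq> poly_funs D" "U = {w \<in> W. \<exists>f\<in>F. f w \<noteq> 0}"
      using U unfolding zariski_open_in_def by blast
    \<comment> \<open>Collects all polynomials that represent some pullback, so that none has to be
      chosen.\<close>
    define F' where "F' = {f' \<in> poly_funs C. \<exists>f\<in>F. \<forall>z\<in>Z. f (\<phi> z) = f' z}"
    have "(\<exists>f\<in>F. f (\<phi> z) \<noteq> 0) \<longleftrightarrow> (\<exists>f'\<in>F'. f' z \<noteq> 0)" if z: "z \<in> Z" for z
    proof
      assume "\<exists>f\<in>F. f (\<phi> z) \<noteq> 0"
      then obtain f where f: "f \<in> F" "f (\<phi> z) \<noteq> 0" by blast
      then obtain f' where "f' \<in> poly_funs C" "\<forall>z\<in>Z. f (\<phi> z) = f' z" using pull F(1) by blast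
      then show "\<exists>f'\<in>F'. f' z \<noteq> 0" using f z unfolding F'_def by auto
    next
      assume "\<exists>f'\<in>F'. f' z \<noteq> 0"
      then obtain f f' where "f \<in> F" "f' z \<noteq> 0" "f (\<phi> z) = f' z" using z unfolding F'_def by blast
      then show "\<exists>f\<in>F. f (\<phi> z) \<noteq> 0" by (intro bexI[of _ f]) simp_all
    qed
    then have "{z \<in> Z. \<phi> z \<in> U} = {z \<in> Z. \<exists>f'\<in>F'. f' z \<noteq> 0}" using im F(2) by auto
    moreover have "F' \<subseteq> poly_funs C" unfolding F'_def by blast
    ultimately show ?thesis unfolding zariski_open_in_def by blast
  qed
  moreover have "regular_on C {z \<in> Z. \<phi> z \<in> U} (f \<circ> \<phi>)" if f: "regular_on D U f" for U f
    unfolding regular_on_def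
  proof
    fix z assume z: "z \<in> {z \<in> Z. \<phi> z \<in> U}"
    then obtain g h where gh: "g \<in> poly_funs D" "h \<in> poly_funs D" "h (\<phi> z) \<noteq> 0"
      "\<And>w. w \<in> U \<Longrightarrow> h w \<noteq> 0 \<Longrightarrow> f w = g w / h w"
      using f unfolding regular_on_def by blast
    obtain g' h' where "g' \<in> poly_funs C" "\<forall>z\<in>Z. g (\<phi> z) = g' z" "h' \<in> poly_funs C" "\<forall>z\<in>Z. h (\<phi> z) = h' z"
      using pull[OF gh(1)] pull[OF gh(2)] by blast
    then show "\<exists>g\<in>poly_funs C. \<exists>h\<in>poly_funs C. h z \<noteq> 0 \<and>
        (\<forall>w\<in>{z \<in> Z. \<phi> z \<in> U}. h w \<noteq> 0 \<longrightarrow> (f \<circ> \<phi>) w = g w / h w)"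
      using gh z by (intro bexI[of _ g'] bexI[of _ h'] conjI ballI impI) auto
  qed
  ultimately show ?thesis unfolding variety_morphism_def using im by blast
qed

section \<open>Images and isomorphism\<close>

lemma proj_act: "g \<in> GOminus0 l \<Longrightarrow> proj l (act g (e0 l)) = coeff_mat (-1) g"
  by (simp add: proj_def rep_act)

lemma one_GOminus0: "1\<^sub>m (2*l+2) \<in> GOminus0 l"
proof -
  have "1\<^sub>m (2*l+2) \<in> GO l" by (rule GO_one)
  moreover have "coeff_mat 0 (1\<^sub>m (2*l+2)) = 1\<^sub>m (2*l+2)" by (auto simp: coeff_mat_def intro!: eq_matI)
  moreover have "deg_le 0 (1\<^sub>m (2*l+2) $$ (p, q))" if "p < 2*l+2" "q < 2*l+2" for p q
    using that by (simp add: deg_le_def)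
  ultimately show ?thesis unfolding GOminus0_def GOminus_iff GO_iff
    using torth_int_torth[OF one_torth_int, of "2*l+2" True] by blast
qed

text \<open>For positive \<open>j\<close>, \<open>double_coset_conclusion\<close> bounds the image
  from above, and \<open>hits_nilp\<close> with \<open>hits_GO\<close> fills it.\<close>

lemma proj_M:
  assumes l: "1 \<le> l" and j: "j \<le> l" and lam: "lam \<in> spin_cochars l" "coinv_class l lam = ones j"
  shows "proj l ` M l lam = (if odd j then nilp_p l - {0\<^sub>m (2*l+2) (2*l+2)}
      else if j = 0 then {0\<^sub>m (2*l+2) (2*l+2)} else nilp_p l)"
proof -
  let ?n = "2*l+2"
  have n: "n_pow l lam = nmat (l+1) j" by (rule n_pow_eq[OF l lam j])
  have nc: "n_pow l lam \<in> carrier_mat ?n ?n" using nmat_carrier[of "l+1" j] unfolding n by (simp add: add.commute)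
  have P: "proj l ` M l lam = {coeff_mat (-1) g | g. g \<in> GOminus0 l \<and> (\<exists>k\<in>GO l. \<exists>k'\<in>GO l. g = k * nmat (l+1) j * k')}"
    (is "_ = ?P")
  proof (intro equalityI subsetI)
    fix x assume "x \<in> proj l ` M l lam"
    then obtain X where X: "x = proj l X" "X \<in> M l lam" by (rule imageE)
    obtain g where g: "g \<in> GOminus0 l" "X = act g (e0 l)" "\<exists>k\<in>GO l. \<exists>k'\<in>GO l. g = k * nmat (l+1) j * k'"
      using iffD1[OF M_iff[OF nc] X(2)] unfolding n by blast
    then have "x = coeff_mat (-1) g" using X(1) proj_act[OF g(1)] by simp
    then show "x \<in> ?P" using g(1,3) by blast
  next
    fix x assume "x \<in> ?P"
    then obtain g where g: "g \<in> GOminus0 l" "x = coeff_mat (-1) g" "\<exists>k\<in>GO l. \<exists>k'\<in>GO l. g = k * nmat (l+1) j * k'"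
      by blast
    then have "act g (e0 l) \<in> M l lam" unfolding M_iff[OF nc] n by blast
    then show "x \<in> proj l ` M l lam" using proj_act[OF g(1)] g(2) by force
  qed
  show ?thesis
  proof (cases "j = 0")
    case True
    have N1: "nmat (l+1) 0 = 1\<^sub>m ?n"
    proof -
      have "nmat (1 + l) 0 = dsum 2 (2*l) (1\<^sub>m 2) (rest_mat l 0)"
        using nmat_dsum[of 1 0 l] nmat_1_even[of 0] by simp
      then show ?thesis unfolding rest_mat_0 dsum_one by (simp add: add.commute)
    qed
    \<comment> \<open>For \<open>j = 0\<close> the double coset is \<open>GO\<close> itself, where
      no negative powers occur.\<close>
    have "coeff_mat (-1) g = 0\<^sub>m ?n ?n" if g: "g \<in> GOminus0 l" "k \<in> GO l" "k' \<in> GO l" "g = k * nmat (l+1) 0 * k'" for g k k'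
    proof -
      have "g = k * k'" using g(4) GO_carrier[OF g(2)] unfolding N1 by simp
      then have "g \<in> GO l" using GO_mult g by simp
      then show ?thesis using GO_carrier[of g l] unfolding GO_def coeff_mat_def by (intro eq_matI) auto
    qed
    moreover have "\<exists>g. 0\<^sub>m ?n ?n = coeff_mat (-1) g \<and> g \<in> GOminus0 l \<and> (\<exists>k\<in>GO l. \<exists>k'\<in>GO l. g = k * nmat (l+1) 0 * k')"
    proof (intro exI conjI bexI)
      show "0\<^sub>m ?n ?n = coeff_mat (-1) (1\<^sub>m ?n)" by (auto simp: coeff_mat_def intro!: eq_matI)
      show "(1\<^sub>m ?n :: complex fls mat) = 1\<^sub>m ?n * nmat (l+1) 0 * 1\<^sub>m ?n" unfolding N1 by simp
    qed (rule one_GOminus0 GO_one)+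
    ultimately show ?thesis unfolding P True by auto
  next
    case False
    have 1: "coeff_mat (-1) g \<in> (if odd j then nilp_p l - {0\<^sub>m ?n ?n} else nilp_p l)"
      if g: "g \<in> GOminus0 l" "k \<in> GO l" "k' \<in> GO l" "g = k * nmat (l+1) j * k'" for g k k'
      using double_coset_conclusion(1,2)[OF g(1,4) _ _ j] g(2,3) unfolding GO_iff by auto
    have 2: "\<exists>g. x = coeff_mat (-1) g \<and> g \<in> GOminus0 l \<and> (\<exists>k\<in>GO l. \<exists>k'\<in>GO l. g = k * nmat (l+1) j * k')"
      if x: "x \<in> (if odd j then nilp_p l - {0\<^sub>m ?n ?n} else nilp_p l)" for x
    proof -
      have "hits True ?n (nmat (l+1) j) x" using x False by (intro hits_nilp l j) (auto split: if_splits)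
      then show ?thesis using hits_GO by metis
    qed
    show ?thesis unfolding P using 1 2 False by (auto split: if_splits)
  qed
qed

lemma M_ones_1:
  assumes l: "1 \<le> l" and lam: "lam \<in> spin_cochars l" "coinv_class l lam = ones 1"
  shows "M l lam = {act (quad_loop l x) (e0 l) | x. x \<in> nilp_p l - {0\<^sub>m (2*l+2) (2*l+2)}}"
    and "x \<in> nilp_p l - {0\<^sub>m (2*l+2) (2*l+2)} \<Longrightarrow> quad_loop l x \<in> GOminus0 l"
proof -
  let ?n = "2*l+2"
  have n: "n_pow l lam = nmat (l+1) 1" by (rule n_pow_eq[OF l lam l])
  have nc: "n_pow l lam \<in> carrier_mat ?n ?n" using nmat_carrier[of "l+1" 1] unfolding n by (simp add: add.commute)
  have A: "coeff_mat (-1) g \<in> nilp_p l - {0\<^sub>m ?n ?n} \<and> g = quad_loop l (coeff_mat (-1) g)"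
    if g: "g \<in> GOminus0 l" "k \<in> GO l" "k' \<in> GO l" "g = k * nmat (l+1) 1 * k'" for g k k'
    using double_coset_conclusion[OF g(1,4) _ _ l] g(2,3) unfolding GO_iff by auto
  \<comment> \<open>A loop with coefficient x exists by \<open>hits_nilp\<close>, and
    \<open>A\<close> identifies it with \<open>quad_loop l x\<close>; thus the quadratic loop never
    has to be factorized by hand.\<close>
  have B: "quad_loop l x \<in> GOminus0 l \<and> (\<exists>k\<in>GO l. \<exists>k'\<in>GO l. quad_loop l x = k * nmat (l+1) 1 * k')"
    if x: "x \<in> nilp_p l - {0\<^sub>m ?n ?n}" for x
  proof -
    have "hits True ?n (nmat (l+1) 1) x" using x by (intro hits_nilp l) auto
    then obtain g k k' where "g \<in> GOminus0 l" "k \<in> GO l" "k' \<in> GO l" "g = k * nmat (l+1) 1 * k'" "coeff_mat (-1) g = x"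
      by (rule hits_GO)
    then show ?thesis using A by metis
  qed
  show "M l lam = {act (quad_loop l x) (e0 l) | x. x \<in> nilp_p l - {0\<^sub>m ?n ?n}}"
  proof (intro equalityI subsetI)
    fix X assume "X \<in> M l lam"
    then obtain g k k' where g: "g \<in> GOminus0 l" "X = act g (e0 l)" "k \<in> GO l" "k' \<in> GO l" "g = k * nmat (l+1) 1 * k'"
      unfolding M_iff[OF nc] n by blast
    then have "X = act (quad_loop l (coeff_mat (-1) g)) (e0 l)" "coeff_mat (-1) g \<in> nilp_p l - {0\<^sub>m ?n ?n}"
      using A[OF g(1,3,4,5)] by simp_all
    then show "X \<in> {act (quad_loop l x) (e0 l) | x. x \<in> nilp_p l - {0\<^sub>m ?n ?n}}" by blast
  next
    fix X assume "X \<in> {act (quad_loop l x) (e0 l) | x. x \<in> nilp_p l - {0\<^sub>m ?n ?n}}"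
    then show "X \<in> M l lam" unfolding M_iff[OF nc] n using B by blast
  qed
  show "quad_loop l x \<in> GOminus0 l" if "x \<in> nilp_p l - {0\<^sub>m ?n ?n}" using B[OF that] by blast
qed

text \<open>The projection reads off some of the coordinates. Its inverse sends x to the coset of
  the quadratic loop, whose coefficients are constant, linear or quadratic in the entries of
  x.\<close>

lemma M_ones_1_iso:
  assumes l: "1 \<le> l" and lam: "lam \<in> spin_cochars l" "coinv_class l lam = ones 1"
  shows "variety_iso (Gr_coords l) (M l lam) (mat_coords l) (nilp_p l - {0\<^sub>m (2*l+2) (2*l+2)}) (proj l)"
proof -
  let ?n = "2*l+2"
  let ?W = "nilp_p l - {0\<^sub>m ?n ?n}"
  let ?psi = "\<lambda>x. act (quad_loop l x) (e0 l)"
  note M = M_ones_1(1)[OF assms] and q = M_ones_1(2)[OF assms]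
  have c: "x \<in> carrier_mat ?n ?n" if "x \<in> ?W" for x
    using that unfolding nilp_p_def p_space_def so_alg_def by blast
  have cq: "quad_loop l x \<in> carrier_mat ?n ?n" if "x \<in> ?W" for x using GOminus0_carrier[OF q[OF that]] .
  have pr: "proj l (?psi x) = x" if x: "x \<in> ?W" for x
  proof -
    have "coeff_mat (-1) (quad_loop l x) = x"
      using c[OF x] cq[OF x] quad_loop_index[OF c[OF x]] by (intro eq_matI) (auto simp: coeff_mat_def)
    then show ?thesis using proj_act[OF q[OF x]] by simp
  qed
  have 1: "variety_morphism (Gr_coords l) (M l lam) (mat_coords l) ?W (proj l)"
  proof (rule variety_morphismI)
    show "proj l ` M l lam \<subseteq> ?W" unfolding M using pr by auto
    fix f :: "complex mat \<Rightarrow> complex" assume "f \<in> mat_coords l"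
    then obtain p q where f: "p < ?n" "q < ?n" "f = (\<lambda>x. x $$ (p, q))" unfolding mat_coords_def by blast
    have "(\<lambda>X. coeff_mat (-1) (rep l X) $$ (p, q)) \<in> Gr_coords l" unfolding Gr_coords_def using f by blast
    from poly_funs.coord[OF this] show "\<exists>f'\<in>poly_funs (Gr_coords l). \<forall>z\<in>M l lam. f (proj l z) = f' z"
      by (rule bexI[rotated]) (simp add: f(3) proj_def)
  qed
  have 2: "variety_morphism (mat_coords l) ?W (Gr_coords l) (M l lam) ?psi"
  proof (rule variety_morphismI)
    show "?psi ` ?W \<subseteq> M l lam" unfolding M by blast
    fix f :: "complex fls mat set \<Rightarrow> complex" assume "f \<in> Gr_coords l"
    then obtain k p r where f: "p < ?n" "r < ?n" "f = (\<lambda>X. coeff_mat k (rep l X) $$ (p, r))" unfolding Gr_coords_def by blast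
    have v: "f (?psi x) = (if k = 0 then if p = r then 1 else 0 else if k = -1 then x $$ (p, r)
        else if k = -2 then (1/2) * (\<Sum>i<?n. x $$ (p, i) * x $$ (i, r)) else 0)" if x: "x \<in> ?W" for x
    proof -
      have "f (?psi x) = fls_nth (quad_loop l x $$ (p, r)) k"
        unfolding f(3) rep_act[OF q[OF x]] using cq[OF x] f(1,2) by (simp add: coeff_mat_def)
      then show ?thesis unfolding quad_loop_index[OF c[OF x] f(1,2)] square_mult_index[OF c[OF x] c[OF x] f(1,2)] by simp
    qed
    have co: "(\<lambda>x. x $$ (p, q)) \<in> poly_funs (mat_coords l)" if "p < ?n" "q < ?n" for p q
      using that by (intro poly_funs.coord) (auto simp: mat_coords_def)
    have s: "(\<lambda>x. (1/2) * (\<Sum>i<?n. x $$ (p, i) * x $$ (i, r))) \<in> poly_funs (mat_coords l)"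
      using co f(1,2) by (intro poly_funs.mult poly_funs.const poly_funs_sum) auto
    consider "k = 0" | "k = -1" | "k = -2" | "k \<notin> {0, -1, -2}" by blast
    then show "\<exists>f'\<in>poly_funs (mat_coords l). \<forall>z\<in>?W. f (?psi z) = f' z"
    proof cases
      case 1
      then show ?thesis using v by (intro bexI[OF _ poly_funs.const[of "if p = r then 1 else 0"]]) auto
    next
      case 2
      then show ?thesis using v by (intro bexI[OF _ co[OF f(1,2)]]) auto
    next
      case 3
      then show ?thesis using v by (intro bexI[OF _ s]) auto
    next
      case 4
      then show ?thesis using v by (intro bexI[OF _ poly_funs.const[of 0]]) auto
    qed
  qed
  have "?psi (proj l X) = X" if "X \<in> M l lam" for X
    using that pr unfolding M by auto
  then show ?thesis unfolding variety_iso_def using 1 2 pr by blast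
qed

theorem theorem4p14:
  fixes l :: nat
  assumes "1 \<le> l"
  shows "(\<forall>j\<le>l. \<forall>lam\<in>spin_cochars l. coinv_class l lam = ones j \<longrightarrow>
            proj l ` M l lam =
              (if odd j then nilp_p l - {0\<^sub>m (2*l+2) (2*l+2)}
               else if j = 0 then {0\<^sub>m (2*l+2) (2*l+2)}
               else nilp_p l))
    \<and> (\<forall>lam\<in>spin_cochars l. coinv_class l lam = ones 1 \<longrightarrow>
            M l lam = {act (quad_loop l x) (e0 l) | x. x \<in> nilp_p l - {0\<^sub>m (2*l+2) (2*l+2)}}
          \<and> variety_iso (Gr_coords l) (M l lam)
               (mat_coords l) (nilp_p l - {0\<^sub>m (2*l+2) (2*l+2)}) (proj l))"
  using proj_M[OF assms] M_ones_1(1)[OF assms] M_ones_1_iso[OF assms] by blast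

end
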